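(* Let $X$ be a connected smooth manifold, $x_0\in X$ a base point, $\Gamma=\pi_1(X,x_0)$, $\tilde X$ the universal covering of $X$, and let $s\ge0$ be an integer. If $\omega\in B_s(X)_{x_0}^{\mathrm{hom}}$, then the function $x\mapsto\int_{x_0}^x\omega$, $x\in\tilde X$, is an invariant of order at most $s+1$ in the $\Gamma$-module $C^\infty(\tilde X)$, i.e. it lies in $\mathrm H_{s+1}^0(\Gamma,C^\infty(\tilde X))$. This defines an injective linear map $$\Psi:\ B_s(X)_{x_0}^{\mathrm{hom}}\hookrightarrow \mathrm H_{s+1}^0(\Gamma,C^\infty(\tilde X)),\qquad \Psi(\omega)(x)=\int_{x_0}^x\omega.$$
   Context: Path spaces: $PX$ is the set of all smooth maps $p:[0,1]\to X$; $PX_{x_0}$ is the subset of paths starting at $x_0$. Iterated integrals: for a path $p$ and smooth $1$-forms $\omega_1,\dots,\omega_r$ on $X$, $$\int_p\omega_1\cdots\omega_r=\int_0^1\int_0^{t_r}\cdots\int_0^{t_2}p^*\omega_1(t_1)\,p^*\omega_2(t_2)\cdots p^*\omega_r(t_r).$$ $B_s(X)$ is the space of all maps $PX\to\mathbb C$ which are linear combinations of maps $p\mapsto\int_p\omega_1\cdots\omega_r$ with $r\le s$ (constants are included as iterated integrals of length $0$). $B_s(X)_{x_0}$ is the set of restrictions of elements of $B_s(X)$ to $PX_{x_0}$, and $B_s(X)_{x_0}^{\mathrm{hom}}$ is the subspace of those elements which are invariant under homotopies of paths with fixed end-points. Higher order invariants: for a group $\Gamma$, let $J\subset\mathbb Z\Gamma$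 be the augmentation ideal (spanned by all $\gamma-1$, $\gamma\in\Gamma$). For a $\mathbb Z\Gamma$-module $V$, $\mathrm H_s^0(\Gamma,V)=\{v\in V: J^sv=0\}$. The order of $v$ is $s$ if $v\in\mathrm H_s^0(\Gamma,V)$ but $v\notin\mathrm H_{s-1}^0(\Gamma,V)$. $\Gamma=\pi_1(X,x_0)$ acts on $\tilde X$ by deck transformations and on $C^\infty(\tilde X)$ (complex-valued smooth functions) by $(\gamma f)(x)=f(\gamma^{-1}x)$. A preimage of $x_0$ in $\tilde X$ is fixed and again denoted $x_0$. For $\omega\in B_s(X)_{x_0}^{\mathrm{hom}}$ and $x\in\tilde X$, $\int_{x_0}^x\omega$ denotes the value of $\omega$ on the projection to $X$ of any smooth path in $\tilde X$ from $x_0$ to $x$; this is independent of the path by homotopy invariance. *)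

theory Defs
  imports "HOL-Analysis.Analysis" "HOL-Algebra.Module" "HOL-Algebra.Ideal_Product"
begin

section \<open>Smooth maps between normed spaces\<close>

text \<open>
  The derivatives are taken within \<open>S\<close>: for open \<open>S\<close> they are the ordinary ones, and for
  relatively open \<open>S \<subseteq> {0..1}\<close> they are one-sided at the end points.  In finite dimensions,
  testing all directional derivatives agrees with the usual notion of \<open>C\<^sup>k\<close>.
\<close>

primrec Ck_on :: "nat \<Rightarrow> 'e::real_normed_vector set \<Rightarrow> ('e \<Rightarrow> 'f::real_normed_vector) \<Rightarrow> bool" where
  "Ck_on 0 S f \<longleftrightarrow> continuous_on S f"
| "Ck_on (Suc k) S f \<longleftrightarrow>
     f differentiable_on S \<and> (\<forall>v. Ck_on k S (\<lambda>x. frechet_derivative f (at x within S) v))"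

definition smooth_on :: "'e::real_normed_vector set \<Rightarrow> ('e \<Rightarrow> 'f::real_normed_vector) \<Rightarrow> bool" where
  "smooth_on S f \<longleftrightarrow> (\<forall>k. Ck_on k S f)"


section \<open>Smooth manifolds\<close>

text \<open>
  A chart \<open>(U, \<phi>)\<close> is a homeomorphism \<open>\<phi>\<close> from a relatively open \<open>U \<subseteq> M\<close> onto an open subset of
  the model space \<open>'e\<close>; the values of \<open>\<phi>\<close> outside \<open>U\<close> are irrelevant.  The topology of \<open>M\<close> is
  the subspace topology.
\<close>

type_synonym ('a, 'e) chart = "'a set \<times> ('a \<Rightarrow> 'e)"

definition smooth_atlas ::
    "'a::topological_space set \<Rightarrow> ('a, 'e::real_normed_vector) chart set \<Rightarrow> bool" where
  "smooth_atlas M A \<longleftrightarrow>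
     (\<Union>(U, \<phi>)\<in>A. U) = M \<and>
     (\<forall>(U, \<phi>)\<in>A. openin (top_of_set M) U \<and> open (\<phi> ` U) \<and>
                  homeomorphism U (\<phi> ` U) \<phi> (inv_into U \<phi>)) \<and>
     (\<forall>(U, \<phi>)\<in>A. \<forall>(V, \<psi>)\<in>A. smooth_on (\<phi> ` (U \<inter> V)) (\<psi> \<circ> inv_into U \<phi>))"

text \<open>
  The model is a finite-dimensional normed space, so that \<open>span X = UNIV\<close> for a finite \<open>X\<close>.
  The class \<open>euclidean_space\<close> would exclude dimension \<open>0\<close>, i.e. the one-point manifold.
  The classes \<open>banach\<close> and \<open>heine_borel\<close> contain every finite-dimensional normed space and hence
  are no further restriction.
\<close>

definition smooth_manifold ::
    "'a::topological_space set \<Rightarrow> ('a, 'e::{banach, heine_borel}) chart set \<Rightarrow> bool" where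
  "smooth_manifold M A \<longleftrightarrow>
     Hausdorff_space (top_of_set M) \<and> second_countable (top_of_set M) \<and>
     (\<exists>X::'e set. finite X \<and> span X = UNIV) \<and> smooth_atlas M A"

text \<open>Smoothness on an open subset \<open>W\<close> of a manifold with atlas \<open>B\<close>, for maps into a manifold
  with atlas \<open>A\<close>.\<close>

definition smooth_map ::
    "'b::topological_space set \<Rightarrow> ('b, 'e::real_normed_vector) chart set \<Rightarrow>
     ('a::topological_space, 'e) chart set \<Rightarrow> ('b \<Rightarrow> 'a) \<Rightarrow> bool" where
  "smooth_map W B A f \<longleftrightarrow>
     continuous_on W f \<and>
     (\<forall>(U, \<phi>)\<in>B. \<forall>(V, \<psi>)\<in>A.
        smooth_on (\<phi> ` (U \<inter> W \<inter> f -` V)) (\<psi> \<circ> f \<circ> inv_into U \<phi>))"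

text \<open>Functions on \<open>N\<close> are represented by functions on the whole type that vanish outside \<open>N\<close>.\<close>

definition C_infinity ::
    "'b::topological_space set \<Rightarrow> ('b, 'e::real_normed_vector) chart set \<Rightarrow> ('b \<Rightarrow> complex) set" where
  "C_infinity N B =
     {f. (\<forall>(U, \<phi>)\<in>B. smooth_on (\<phi> ` U) (f \<circ> inv_into U \<phi>)) \<and> (\<forall>x. x \<notin> N \<longrightarrow> f x = 0)}"

text \<open>As in the library's theory of paths, the values of a path outside \<open>{0..1}\<close> are irrelevant.\<close>

definition smooth_paths ::
    "'a::topological_space set \<Rightarrow> ('a, 'e::real_normed_vector) chart set \<Rightarrow> (real \<Rightarrow> 'a) set" where
  "smooth_paths M A =
     {p. path p \<and> path_image p \<subseteq> M \<and>
         (\<forall>(U, \<phi>)\<in>A. smooth_on ({0..1} \<inter> p -` U) (\<phi> \<circ> p))}"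

definition smooth_paths_from ::
    "'a::topological_space set \<Rightarrow> ('a, 'e::real_normed_vector) chart set \<Rightarrow> 'a \<Rightarrow> (real \<Rightarrow> 'a) set" where
  "smooth_paths_from M A x0 = {p \<in> smooth_paths M A. pathstart p = x0}"


section \<open>Iterated integrals\<close>

text \<open>
  A complex-valued 1-form is given by its local representatives: \<open>w c x\<close> is the linear form on the
  model space at the point \<open>x\<close> of the image of the chart \<open>c\<close>, and the representatives in
  overlapping charts correspond under pull-back along the coordinate change.
\<close>

type_synonym ('a, 'e) one_form = "('a, 'e) chart \<Rightarrow> 'e \<Rightarrow> 'e \<Rightarrow> complex"

definition one_forms ::
    "('a::topological_space, 'e::real_normed_vector) chart set \<Rightarrow> ('a, 'e) one_form set" where
  "one_forms A =
     {w. (\<forall>(U, \<phi>)\<in>A. (\<forall>x\<in>\<phi> ` U. linear (w (U, \<phi>) x)) \<and>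
                      (\<forall>v. smooth_on (\<phi> ` U) (\<lambda>x. w (U, \<phi>) x v))) \<and>
         (\<forall>(U, \<phi>)\<in>A. \<forall>(V, \<psi>)\<in>A. \<forall>x\<in>U \<inter> V. \<forall>v.
            w (U, \<phi>) (\<phi> x) v =
            w (V, \<psi>) (\<psi> x) (frechet_derivative (\<psi> \<circ> inv_into U \<phi>) (at (\<phi> x)) v))}"

text \<open>The coefficient of \<open>dt\<close> in \<open>p\<^sup>*w\<close>, computed in any chart around \<open>p t\<close>.\<close>

definition pullback ::
    "('a::topological_space, 'e::real_normed_vector) chart set \<Rightarrow> (real \<Rightarrow> 'a) \<Rightarrow>
     ('a, 'e) one_form \<Rightarrow> real \<Rightarrow> complex" where
  "pullback A p w t =
     (let c = (SOME c. c \<in> A \<and> p t \<in> fst c)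
      in w c (snd c (p t)) (vector_derivative (snd c \<circ> p) (at t within {0..1})))"

text \<open>
  The first form in the list is integrated innermost: with \<open>F\<^sub>0 = 1\<close> and
  \<open>F\<^sub>i(t) = \<integral>\<^sub>0\<^sup>t F\<^sub>i\<^sub>-\<^sub>1(u) p\<^sup>*w\<^sub>i(u)\<close> the value is \<open>F\<^sub>r(1)\<close>.
\<close>

definition iterated_integral ::
    "('a::topological_space, 'e::real_normed_vector) chart set \<Rightarrow> ('a, 'e) one_form list \<Rightarrow>
     (real \<Rightarrow> 'a) \<Rightarrow> complex" where
  "iterated_integral A ws p =
     foldl (\<lambda>F w t. integral {0..t} (\<lambda>u. F u * pullback A p w u)) (\<lambda>_. 1) ws 1"

definition iterated_integrals ::
    "('a::topological_space, 'e::real_normed_vector) chart set \<Rightarrow> nat \<Rightarrow>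
     ((real \<Rightarrow> 'a) \<Rightarrow> complex) set" where
  "iterated_integrals A s =
     {\<lambda>p. \<Sum>i<n. c i * iterated_integral A (ws i) p | (n::nat) c ws.
        \<forall>i<n. length (ws i) \<le> s \<and> set (ws i) \<subseteq> one_forms A}"

text \<open>A function on the smooth paths starting at \<open>x0\<close> is extended by \<open>0\<close> to the whole type.\<close>

definition iterated_integrals_from ::
    "'a::topological_space set \<Rightarrow> ('a, 'e::real_normed_vector) chart set \<Rightarrow> 'a \<Rightarrow> nat \<Rightarrow>
     ((real \<Rightarrow> 'a) \<Rightarrow> complex) set" where
  "iterated_integrals_from M A x0 s =
     (\<lambda>I p. if p \<in> smooth_paths_from M A x0 then I p else 0) ` iterated_integrals A s"

definition homotopy_invariant_integrals ::
    "'a::topological_space set \<Rightarrow> ('a, 'e::real_normed_vector) chart set \<Rightarrow> 'a \<Rightarrow> nat \<Rightarrow>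
     ((real \<Rightarrow> 'a) \<Rightarrow> complex) set" where
  "homotopy_invariant_integrals M A x0 s =
     {\<omega> \<in> iterated_integrals_from M A x0 s.
        \<forall>p\<in>smooth_paths_from M A x0. \<forall>q\<in>smooth_paths_from M A x0.
          homotopic_paths M p q \<longrightarrow> \<omega> p = \<omega> q}"


section \<open>Fundamental group and universal covering\<close>

text \<open>Product \<open>[p] [q] = [p +++ q]\<close>, where \<open>p\<close> is traversed first.\<close>

definition fundamental_group :: "'a::topological_space set \<Rightarrow> 'a \<Rightarrow> (real \<Rightarrow> 'a) set monoid" where
  "fundamental_group M x0 =
     \<lparr> carrier = {Collect (homotopic_paths M p) | p.
                    path p \<and> path_image p \<subseteq> M \<and> pathstart p = x0 \<and> pathfinish p = x0},
       mult = (\<lambda>a b. {r. \<exists>p\<in>a. \<exists>q\<in>b. homotopic_paths M (p +++ q) r}),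
       one = Collect (homotopic_paths M (\<lambda>_. x0)) \<rparr>"

definition universal_covering ::
    "'b::topological_space set \<Rightarrow> ('b, 'e::{banach, heine_borel}) chart set \<Rightarrow> ('b \<Rightarrow> 'a) \<Rightarrow>
     'a::topological_space set \<Rightarrow> ('a, 'e) chart set \<Rightarrow> bool" where
  "universal_covering N B \<pi> M A \<longleftrightarrow>
     smooth_manifold N B \<and> simply_connected N \<and> covering_space N \<pi> M \<and>
     (\<forall>y\<in>N. \<exists>W g. y \<in> W \<and> openin (top_of_set N) W \<and> openin (top_of_set M) (\<pi> ` W) \<and>
        homeomorphism W (\<pi> ` W) \<pi> g \<and> smooth_map W B A \<pi> \<and> smooth_map (\<pi> ` W) A B g)"

definition deck_transformations :: "'b::topological_space set \<Rightarrow> ('b \<Rightarrow> 'a) \<Rightarrow> ('b \<Rightarrow> 'b) set" where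
  "deck_transformations N \<pi> =
     {h \<in> extensional N. (\<exists>g. homeomorphism N N h g) \<and> (\<forall>y\<in>N. \<pi> (h y) = \<pi> y)}"

text \<open>
  The deck transformation of \<open>\<gamma>\<close> moves the base point \<open>y0\<close> to the end point of the lift of \<open>\<gamma>\<close>
  starting at \<open>y0\<close>.  With the product of the fundamental group above, this is a left action.
\<close>

definition deck ::
    "'b::topological_space set \<Rightarrow> ('b \<Rightarrow> 'a) \<Rightarrow> 'b \<Rightarrow> (real \<Rightarrow> 'a) set \<Rightarrow> 'b \<Rightarrow> 'b" where
  "deck N \<pi> y0 \<gamma> =
     (THE h. h \<in> deck_transformations N \<pi> \<and>
        (\<exists>q. path q \<and> path_image q \<subseteq> N \<and> pathstart q = y0 \<and> pathfinish q = h y0 \<and> \<pi> \<circ> q \<in> \<gamma>))"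


section \<open>Higher order invariants\<close>

text \<open>The integral group ring: finitely supported functions with the convolution product.\<close>

definition group_ring :: "('g, 'm) monoid_scheme \<Rightarrow> ('g \<Rightarrow> int) ring" where
  "group_ring G =
     \<lparr> carrier = {a. finite {g. a g \<noteq> 0} \<and> {g. a g \<noteq> 0} \<subseteq> carrier G},
       mult = (\<lambda>a b k. \<Sum>g | a g \<noteq> 0. \<Sum>h | b h \<noteq> 0. if g \<otimes>\<^bsub>G\<^esub> h = k then a g * b h else 0),
       one = (\<lambda>k. if k = \<one>\<^bsub>G\<^esub> then 1 else 0),
       zero = (\<lambda>_. 0),
       add = (\<lambda>a b k. a k + b k) \<rparr>"

text \<open>The integer span of the elements \<open>g - 1\<close>.\<close>

definition augmentation_ideal :: "('g, 'm) monoid_scheme \<Rightarrow> ('g \<Rightarrow> int) set" where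
  "augmentation_ideal G =
     {\<lambda>k. \<Sum>g\<in>S. n g * ((if k = g then 1 else 0) - (if k = \<one>\<^bsub>G\<^esub> then 1 else 0)) | S n.
        finite S \<and> S \<subseteq> carrier G}"

primrec ideal_power :: "('r, 'm) ring_scheme \<Rightarrow> 'r set \<Rightarrow> nat \<Rightarrow> 'r set" where
  "ideal_power R J 0 = carrier R"
| "ideal_power R J (Suc s) = ideal_prod R J (ideal_power R J s)"

definition higher_invariants ::
    "('g, 'm) monoid_scheme \<Rightarrow> ('g \<Rightarrow> int, 'v) module \<Rightarrow> nat \<Rightarrow> 'v set" where
  "higher_invariants G V s =
     {v \<in> carrier V. \<forall>a\<in>ideal_power (group_ring G) (augmentation_ideal G) s. a \<odot>\<^bsub>V\<^esub> v = \<zero>\<^bsub>V\<^esub>}"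

definition deck_action ::
    "'b::topological_space set \<Rightarrow> ('b \<Rightarrow> 'a::topological_space) \<Rightarrow> 'a set \<Rightarrow> 'b \<Rightarrow>
     (real \<Rightarrow> 'a) set \<Rightarrow> ('b \<Rightarrow> complex) \<Rightarrow> 'b \<Rightarrow> complex" where
  "deck_action N \<pi> M y0 \<gamma> f x =
     (if x \<in> N then f (deck N \<pi> y0 (inv\<^bsub>fundamental_group M (\<pi> y0)\<^esub> \<gamma>) x) else 0)"

text \<open>The ring multiplication of the record (pointwise product) plays no role for the module.\<close>

definition C_infinity_module ::
    "'b::topological_space set \<Rightarrow> ('b, 'e::real_normed_vector) chart set \<Rightarrow>
     ('b \<Rightarrow> 'a::topological_space) \<Rightarrow> 'a set \<Rightarrow> 'b \<Rightarrow>
     ((real \<Rightarrow> 'a) set \<Rightarrow> int, 'b \<Rightarrow> complex) module" where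
  "C_infinity_module N B \<pi> M y0 =
     \<lparr> carrier = C_infinity N B,
       mult = (\<lambda>f g x. f x * g x),
       one = (\<lambda>x. if x \<in> N then 1 else 0),
       zero = (\<lambda>_. 0),
       add = (\<lambda>f g x. f x + g x),
       smult = (\<lambda>a f x. \<Sum>\<gamma> | a \<gamma> \<noteq> 0. of_int (a \<gamma>) * deck_action N \<pi> M y0 \<gamma> f x) \<rparr>"


section \<open>Integration along paths to a variable end point\<close>

definition Psi ::
    "'b::topological_space set \<Rightarrow> ('b, 'e::real_normed_vector) chart set \<Rightarrow> ('b \<Rightarrow> 'a) \<Rightarrow> 'b \<Rightarrow>
     ((real \<Rightarrow> 'a) \<Rightarrow> complex) \<Rightarrow> 'b \<Rightarrow> complex" where
  "Psi N B \<pi> y0 \<omega> x =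
     (if x \<in> N then \<omega> (\<pi> \<circ> (SOME q. q \<in> smooth_paths_from N B y0 \<and> pathfinish q = x)) else 0)"

end

theory Submission
  imports Defs
begin

text \<open>
  By Chen's formula, prefixing a loop \<open>l\<close> to a path changes an iterated integral \<open>\<omega>\<close> of length at
  most \<open>s\<close> by \<open>\<omega>(l p) - \<omega>(p)\<close>, a homotopy invariant combination of integrals of length at most
  \<open>s - 1\<close>, since the summand without forms on \<open>l\<close> cancels.  On the covering this operation is \<open>\<gamma> - 1\<close>
  for a deck transformation \<open>\<gamma>\<close>, so by induction \<open>s + 1\<close> factors annihilate \<open>\<Psi>(\<omega>)\<close>.
  Injectivity holds because smooth paths lift.  For smoothness one moves the end point along
  radial paths in a chart: there an iterated integral of length \<open>r\<close> arises from one of length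
  \<open>r - 1\<close> by the operator taking \<open>f\<close> to \<open>v \<mapsto> \<integral>\<^sub>0\<^sup>1 f(u v) du\<close>, which preserves smoothness.
\<close>

section \<open>Homotopies in arbitrary topological spaces\<close>

text \<open>Concatenating smooth paths creates a corner. Products are therefore formed with a step
  function that is constant near both ends of the unit interval (\<open>smooth_join\<close>); they
  are homotopic to \<open>+++\<close>. Around the junction such a product rests, which is why Chen's
  formula is stated for two reparametrizations such that at each time the first does not move or the
  second has not started. \<open>Ck_on\<close> differentiates within a set and in fixed directions,
  and this shapes the calculus. Derivatives within a set must be unique, whence \<open>fat\<close>;
  a linear map applied to a varying vector must be expanded in coordinates, whence the locale
  \<open>coordinates\<close>, used both for the chain rule and for radial integrals.
  \<open>M\<close> and \<open>N\<close> carry only a topology. Homotopies are obtained as images of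
  straight-line homotopies in an interval or a square, and liftings start from a subdivision of the
  square. The order of a function is handled by a filtration that tests one group element at a time.
  It fits an induction on the length of the integrals, and the passage to powers of the augmentation
  ideal is pure algebra.\<close>

lemma homotopic_paths_via_square:
  fixes h :: "real \<times> real \<Rightarrow> 'a::topological_space"
  assumes h: "continuous_on ({0..1} \<times> {0..1}) h" "h ` ({0..1} \<times> {0..1}) \<subseteq> S"
    and pq: "path p" "path q" "path_image p \<subseteq> {0..1} \<times> {0..1}" "path_image q \<subseteq> {0..1} \<times> {0..1}"
      "pathstart p = pathstart q" "pathfinish p = pathfinish q"
  shows "homotopic_paths S (h \<circ> p) (h \<circ> q)"
proof (rule homotopic_paths_continuous_image)
  show "homotopic_paths ({0..1} \<times> {0..1}) p q"
  proof (rule homotopic_paths_linear)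
    fix t :: real assume t: "t \<in> {0..1}"
    show "closed_segment (p t) (q t) \<subseteq> {0..1} \<times> {0..1}"
    proof (rule closed_segment_subset)
      show "p t \<in> {0..1} \<times> {0..1}" "q t \<in> {0..1} \<times> {0..1}"
        using pq(3,4) t unfolding path_image_def by blast+
      show "convex ({0..1::real} \<times> {0..1::real})"
        by (intro convex_Times convex_real_interval)
    qed
  qed (use pq in auto)
qed (use h in auto)

text \<open>The homotopy is the image of the straight-line homotopy between two parameter paths. The
  laws for constant and reversed paths below are instances in which only the parameter path
  changes.\<close>

lemma homotopic_paths_via_interval:
  fixes r :: "real \<Rightarrow> 'a::topological_space"
  assumes r: "path r" "path_image r \<subseteq> S"
    and pq: "path p" "path q" "path_image p \<subseteq> {0..1}" "path_image q \<subseteq> {0..1}"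
      "pathstart p = pathstart q" "pathfinish p = pathfinish q"
  shows "homotopic_paths S (r \<circ> p) (r \<circ> q)"
proof (rule homotopic_paths_continuous_image)
  show "homotopic_paths {0..1} p q"
  proof (rule homotopic_paths_linear)
    fix t :: real assume t: "t \<in> {0..1}"
    show "closed_segment (p t) (q t) \<subseteq> {0..1}"
    proof (rule closed_segment_subset)
      show "p t \<in> {0..1}" "q t \<in> {0..1}"
        using pq(3,4) t unfolding path_image_def by blast+
    qed auto
  qed (use pq in auto)
qed (use r in \<open>auto simp: path_def path_image_def\<close>)

lemma path_const: "path (\<lambda>_. x)"
  by (simp add: path_def)

lemma path_ends_const [simp]: "pathstart (\<lambda>_. x) = x" "pathfinish (\<lambda>_. x) = x"
  by (simp_all add: pathstart_def pathfinish_def)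

lemma path_id: "path (\<lambda>t::real. t)"
  by (simp add: path_def)

lemma homotopic_paths_const_right:
  fixes p :: "real \<Rightarrow> 'a::topological_space"
  assumes "path p" "path_image p \<subseteq> S" "pathfinish p = x"
  shows "homotopic_paths S (p +++ (\<lambda>_. x)) p"
proof -
  have "homotopic_paths S (p \<circ> ((\<lambda>t. t) +++ (\<lambda>_. 1))) (p \<circ> (\<lambda>t. t))"
  proof (rule homotopic_paths_via_interval)
    show "path ((\<lambda>t::real. t) +++ (\<lambda>_. 1))"
      by (intro path_join_imp path_const path_id) (simp add: pathstart_def pathfinish_def)
    show "path_image ((\<lambda>t::real. t) +++ (\<lambda>_. 1)) \<subseteq> {0..1}"
      by (auto simp: path_image_def joinpaths_def)
  qed (use assms in \<open>auto simp: path_image_def pathstart_def pathfinish_def joinpaths_def intro: path_id\<close>)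
  moreover have "p \<circ> ((\<lambda>t. t) +++ (\<lambda>_. 1)) = p +++ (\<lambda>_. x)"
    using assms by (auto simp: joinpaths_def fun_eq_iff pathfinish_def)
  ultimately show ?thesis by (simp add: o_def)
qed

lemma homotopic_paths_const_left:
  fixes p :: "real \<Rightarrow> 'a::topological_space"
  assumes "path p" "path_image p \<subseteq> S" "pathstart p = x"
  shows "homotopic_paths S ((\<lambda>_. x) +++ p) p"
proof -
  have "homotopic_paths S (p \<circ> ((\<lambda>_. 0) +++ (\<lambda>t. t))) (p \<circ> (\<lambda>t. t))"
  proof (rule homotopic_paths_via_interval)
    show "path ((\<lambda>_. 0) +++ (\<lambda>t::real. t))"
      by (intro path_join_imp path_const path_id) (simp add: pathstart_def pathfinish_def)
    show "path_image ((\<lambda>_. 0) +++ (\<lambda>t::real. t)) \<subseteq> {0..1}"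
      by (auto simp: path_image_def joinpaths_def)
  qed (use assms in \<open>auto simp: path_image_def pathstart_def pathfinish_def joinpaths_def intro: path_id\<close>)
  moreover have "p \<circ> ((\<lambda>_. 0) +++ (\<lambda>t. t)) = (\<lambda>_. x) +++ p"
    using assms by (auto simp: joinpaths_def fun_eq_iff pathstart_def)
  ultimately show ?thesis by (simp add: o_def)
qed

lemma homotopic_paths_join_reversepath:
  fixes p :: "real \<Rightarrow> 'a::topological_space"
  assumes "path p" "path_image p \<subseteq> S" "pathstart p = x"
  shows "homotopic_paths S (p +++ reversepath p) (\<lambda>_. x)"
proof -
  have "homotopic_paths S (p \<circ> ((\<lambda>t. t) +++ (\<lambda>t. 1 - t))) (p \<circ> (\<lambda>_::real. 0))"
  proof (rule homotopic_paths_via_interval)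
    show "path ((\<lambda>t::real. t) +++ (\<lambda>t. 1 - t))"
      by (intro path_join_imp path_id) (auto simp: pathstart_def pathfinish_def path_def intro!: continuous_intros)
    show "path_image ((\<lambda>t::real. t) +++ (\<lambda>t. 1 - t)) \<subseteq> {0..1}"
      by (auto simp: path_image_def joinpaths_def)
  qed (use assms in \<open>auto simp: path_image_def pathstart_def pathfinish_def joinpaths_def intro: path_const\<close>)
  moreover have "p \<circ> ((\<lambda>t. t) +++ (\<lambda>t. 1 - t)) = p +++ reversepath p" "p \<circ> (\<lambda>_::real. 0) = (\<lambda>_. x)"
    using assms by (auto simp: joinpaths_def fun_eq_iff pathstart_def reversepath_def)
  ultimately show ?thesis by (simp only:)
qed

lemma homotopic_paths_reversepath_join:
  fixes p :: "real \<Rightarrow> 'a::topological_space"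
  assumes "path p" "path_image p \<subseteq> S" "pathfinish p = x"
  shows "homotopic_paths S (reversepath p +++ p) (\<lambda>_. x)"
  using homotopic_paths_join_reversepath[of "reversepath p" S x] assms by simp

text \<open>A free homotopy \<open>h\<close> to a constant loop moves the base point along
  \<open>h \<circ> A\<close>. In the square, the edge carrying \<open>p\<close> is homotopic with
  fixed end points to the other three edges. Every intermediate path is a loop, so the last of these
  three is mapped to the reverse of the first, and the middle one to a constant.\<close>

lemma homotopic_loops_const_imp_homotopic_paths_const:
  fixes p :: "real \<Rightarrow> 'a::topological_space"
  assumes "homotopic_loops S p (\<lambda>_. a)" "pathstart p = x"
  shows "homotopic_paths S p (\<lambda>_. x)"
proof -
  obtain h where h: "continuous_on ({0..1::real} \<times> {0..1}) h" "h \<in> ({0..1} \<times> {0..1}) \<rightarrow> S"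
    "\<And>t. t \<in> {0..1} \<Longrightarrow> h (0, t) = p t" "\<And>t. t \<in> {0..1} \<Longrightarrow> h (1, t) = a"
    "\<And>u. u \<in> {0..1} \<Longrightarrow> pathfinish (h \<circ> Pair u) = pathstart (h \<circ> Pair u)"
    using assms(1) unfolding homotopic_loops by blast
  have p: "path p" "path_image p \<subseteq> S"
    using homotopic_loops_imp_path[OF assms(1)] homotopic_loops_imp_subset[OF assms(1)] by auto
  define A where "A = (\<lambda>u::real. (u, 0::real))"
  define B where "B = (\<lambda>u::real. (1 - u, 1::real))"
  define b where "b = (\<lambda>t::real. (1::real, t))"
  have paths: "path A" "path B" "path b"
    by (auto simp: A_def B_def b_def path_def intro!: continuous_intros)
  have "homotopic_paths S p (h \<circ> (\<lambda>t. (0, t)))"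
    using h p by (intro homotopic_paths_eq) auto
  also have "homotopic_paths S (h \<circ> (\<lambda>t. (0, t))) (h \<circ> (A +++ (b +++ B)))"
  proof (rule homotopic_paths_via_square[OF h(1)])
    show "path (A +++ b +++ B)"
      by (intro path_join_imp paths) (auto simp: A_def B_def b_def pathstart_def pathfinish_def joinpaths_def)
    show "path (\<lambda>t::real. (0::real, t))"
      by (auto simp: path_def intro!: continuous_intros)
    show "path_image (A +++ b +++ B) \<subseteq> {0..1} \<times> {0..1}"
      by (intro subset_path_image_join) (auto simp: A_def B_def b_def path_image_def)
    show "h ` ({0..1} \<times> {0..1}) \<subseteq> S" using h(2) by auto
  qed (auto simp: path_image_def A_def B_def b_def pathstart_def pathfinish_def joinpaths_def)
  also have "homotopic_paths S (h \<circ> (A +++ (b +++ B))) ((h \<circ> A) +++ ((\<lambda>_. a) +++ reversepath (h \<circ> A)))"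
  proof (rule homotopic_paths_eq)
    show "path (h \<circ> (A +++ (b +++ B)))"
      using \<open>homotopic_paths S (h \<circ> (\<lambda>t. (0, t))) (h \<circ> (A +++ (b +++ B)))\<close>
      by (auto dest: homotopic_paths_imp_path)
    show "path_image (h \<circ> (A +++ (b +++ B))) \<subseteq> S"
      using \<open>homotopic_paths S (h \<circ> (\<lambda>t. (0, t))) (h \<circ> (A +++ (b +++ B)))\<close>
      by (auto dest: homotopic_paths_imp_subset)
    fix t :: real assume t: "t \<in> {0..1}"
    have "h (1 - (2 * (2 * t - 1) - 1), 1) = h (1 - (2 * (2 * t - 1) - 1), 0)"
      if "\<not> t * 2 \<le> 1" "\<not> (2 * t - 1) * 2 \<le> 1"
      using h(5)[of "1 - (2 * (2 * t - 1) - 1)"] t that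
      by (auto simp: pathstart_def pathfinish_def)
    then show "(h \<circ> A +++ b +++ B) t = ((h \<circ> A) +++ (\<lambda>_. a) +++ reversepath (h \<circ> A)) t"
      using h(4) t by (auto simp: joinpaths_def A_def b_def B_def reversepath_def)
  qed
  finally have 1: "homotopic_paths S p ((h \<circ> A) +++ ((\<lambda>_. a) +++ reversepath (h \<circ> A)))" .
  have 2: "homotopic_paths S ((h \<circ> A) +++ ((\<lambda>_. a) +++ reversepath (h \<circ> A))) ((h \<circ> A) +++ reversepath (h \<circ> A))"
    and 3: "homotopic_paths S ((h \<circ> A) +++ reversepath (h \<circ> A)) (\<lambda>_. x)"
  proof -
    have hA: "path (h \<circ> A)" "path_image (h \<circ> A) \<subseteq> S"
    proof -
      show "path (h \<circ> A)" unfolding path_def o_def A_def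
        by (rule continuous_on_compose2[OF h(1)]) (auto intro!: continuous_intros)
      show "path_image (h \<circ> A) \<subseteq> S" using h(2) by (auto simp: path_image_def A_def)
    qed
    have e: "pathfinish (h \<circ> A) = a" "pathstart (h \<circ> A) = x"
      using h(4)[of 0] h(3)[of 0] assms(2) by (auto simp: A_def pathfinish_def pathstart_def)
    show "homotopic_paths S ((h \<circ> A) +++ ((\<lambda>_. a) +++ reversepath (h \<circ> A))) ((h \<circ> A) +++ reversepath (h \<circ> A))"
      using hA e by (intro homotopic_paths_join homotopic_paths_const_left)
        auto
    show "homotopic_paths S ((h \<circ> A) +++ reversepath (h \<circ> A)) (\<lambda>_. x)"
      using hA e by (intro homotopic_paths_join_reversepath) auto
  qed
  show ?thesis using 1 2 3 by (blast intro: homotopic_paths_trans)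
qed

text \<open>\<open>simply_connected\<close> speaks of free homotopies of loops. Closing
  \<open>p\<close> by the reverse of \<open>q\<close> gives a contractible loop, and
  \<open>q\<close> is recovered by regrouping \<open>p\<close>, the reverse of \<open>q\<close>, and
  \<open>q\<close>.\<close>

lemma simply_connected_imp_homotopic_paths:
  fixes S :: "'a::topological_space set"
  assumes "simply_connected S" "path p" "path q" "path_image p \<subseteq> S" "path_image q \<subseteq> S"
    "pathstart p = pathstart q" "pathfinish p = pathfinish q"
  shows "homotopic_paths S p q"
proof -
  define x where "x = pathstart p"
  have "x \<in> S" using assms unfolding x_def by auto
  have loop: "path (p +++ reversepath q)" "path_image (p +++ reversepath q) \<subseteq> S"
    using assms by (auto simp: subset_path_image_join)
  have "homotopic_loops S (p +++ reversepath q) (\<lambda>_. x)"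
  proof (rule assms(1)[unfolded simply_connected_def, rule_format], intro conjI)
    show "path_image (\<lambda>_. x) \<subseteq> S" using \<open>x \<in> S\<close> by (auto simp: path_image_def)
  qed (use loop assms(6,7) in \<open>auto simp: path_const pathstart_def pathfinish_def reversepath_def joinpaths_def\<close>)
  then have pq: "homotopic_paths S (p +++ reversepath q) (\<lambda>_. x)"
    by (rule homotopic_loops_const_imp_homotopic_paths_const) (simp add: x_def)
  have "homotopic_paths S p (p +++ (\<lambda>_. pathfinish p))"
    using assms by (intro homotopic_paths_sym[OF homotopic_paths_const_right]) auto
  also have "homotopic_paths S (p +++ (\<lambda>_. pathfinish p)) (p +++ (reversepath q +++ q))"
    using assms by (intro homotopic_paths_join homotopic_paths_sym[OF homotopic_paths_reversepath_join])
      (auto simp: pathstart_def)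
  also have "homotopic_paths S (p +++ (reversepath q +++ q)) ((p +++ reversepath q) +++ q)"
    using assms by (intro homotopic_paths_assoc) auto
  also have "homotopic_paths S ((p +++ reversepath q) +++ q) ((\<lambda>_. x) +++ q)"
    using assms pq by (intro homotopic_paths_join) auto
  also have "homotopic_paths S ((\<lambda>_. x) +++ q) q"
    using assms by (intro homotopic_paths_const_left) (auto simp: x_def)
  finally show ?thesis .
qed

text \<open>Two constant loops are freely homotopic, and during the homotopy the base point travels
  along a path joining them.\<close>

lemma simply_connected_imp_path_connected_space:
  fixes S :: "'a::topological_space set"
  assumes "simply_connected S"
  shows "path_connected S"
  unfolding path_connected_def
proof (intro ballI)
  fix x y assume xy: "x \<in> S" "y \<in> S"
  have "homotopic_loops S (\<lambda>_. x) (\<lambda>_. y)"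
    using xy assms[unfolded simply_connected_def, rule_format, of "\<lambda>_. x" "\<lambda>_. y"]
    by (simp add: path_const pathstart_def pathfinish_def path_image_def)
  then obtain h where h: "continuous_on ({0..1::real} \<times> {0..1::real}) h" "h \<in> ({0..1} \<times> {0..1}) \<rightarrow> S"
    "h (0, 0) = x" "h (1, 0) = y"
    unfolding homotopic_loops by force
  let ?g = "\<lambda>u. h (u, 0)"
  have "path ?g"
    unfolding path_def
    by (rule continuous_on_compose2[OF h(1)]) (auto intro!: continuous_intros)
  then show "\<exists>g. path g \<and> path_image g \<subseteq> S \<and> pathstart g = x \<and> pathfinish g = y"
    using h by (intro exI[of _ ?g]) (auto simp: path_image_def pathstart_def pathfinish_def)
qed

section \<open>The fundamental group\<close>

lemma in_fundamental_groupI: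
  assumes "path p" "path_image p \<subseteq> M" "pathstart p = x" "pathfinish p = x"
  shows "Collect (homotopic_paths M p) \<in> carrier (fundamental_group M x)"
  using assms by (auto simp: fundamental_group_def)

lemma in_fundamental_groupE:
  assumes "\<gamma> \<in> carrier (fundamental_group M x)"
  obtains p where "path p" "path_image p \<subseteq> M" "pathstart p = x" "pathfinish p = x"
    "\<gamma> = Collect (homotopic_paths M p)"
  using assms by (auto simp: fundamental_group_def)

lemma homotopy_class_eq:
  "homotopic_paths M p q \<Longrightarrow> Collect (homotopic_paths M p) = Collect (homotopic_paths M q)"
  using homotopic_paths_sym homotopic_paths_trans by blast

lemma fundamental_group_mult:
  assumes "path p" "path_image p \<subseteq> M" "path q" "path_image q \<subseteq> M" "pathfinish p = pathstart q"
  shows "Collect (homotopic_paths M p) \<otimes>\<^bsub>fundamental_group M x\<^esub> Collect (homotopic_paths M q)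
       = Collect (homotopic_paths M (p +++ q))"
proof (intro Set.set_eqI iffI)
  fix r assume "r \<in> Collect (homotopic_paths M p) \<otimes>\<^bsub>fundamental_group M x\<^esub> Collect (homotopic_paths M q)"
  then obtain p' q' where "homotopic_paths M p p'" "homotopic_paths M q q'" "homotopic_paths M (p' +++ q') r"
    by (auto simp: fundamental_group_def)
  then show "r \<in> Collect (homotopic_paths M (p +++ q))"
    using assms homotopic_paths_join homotopic_paths_trans by blast
next
  fix r assume "r \<in> Collect (homotopic_paths M (p +++ q))"
  moreover have "homotopic_paths M p p" "homotopic_paths M q q" using assms by auto
  ultimately show "r \<in> Collect (homotopic_paths M p) \<otimes>\<^bsub>fundamental_group M x\<^esub> Collect (homotopic_paths M q)"
    unfolding fundamental_group_def monoid.simps by blast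
qed

lemma fundamental_group_one: "\<one>\<^bsub>fundamental_group M x\<^esub> = Collect (homotopic_paths M (\<lambda>_. x))"
  by (simp add: fundamental_group_def)

lemma group_fundamental_group:
  assumes "x \<in> M"
  shows "group (fundamental_group M x)" (is "group ?G")
proof (rule groupI)
  show "\<one>\<^bsub>?G\<^esub> \<in> carrier ?G"
    unfolding fundamental_group_one using assms
    by (intro in_fundamental_groupI) (auto simp: path_const path_image_def pathstart_def pathfinish_def)
next
  fix a b assume "a \<in> carrier ?G" "b \<in> carrier ?G"
  then show "a \<otimes>\<^bsub>?G\<^esub> b \<in> carrier ?G"
    by (elim in_fundamental_groupE)
      (simp add: fundamental_group_mult, intro in_fundamental_groupI, auto simp: subset_path_image_join)
next
  fix a b c assume "a \<in> carrier ?G" "b \<in> carrier ?G" "c \<in> carrier ?G"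
  then show "a \<otimes>\<^bsub>?G\<^esub> b \<otimes>\<^bsub>?G\<^esub> c = a \<otimes>\<^bsub>?G\<^esub> (b \<otimes>\<^bsub>?G\<^esub> c)"
    by (elim in_fundamental_groupE)
      (simp add: fundamental_group_mult subset_path_image_join,
        intro homotopy_class_eq[OF homotopic_paths_sym] homotopic_paths_assoc, auto)
next
  fix a assume "a \<in> carrier ?G"
  then obtain p where p: "path p" "path_image p \<subseteq> M" "pathstart p = x" "pathfinish p = x"
    "a = Collect (homotopic_paths M p)" by (rule in_fundamental_groupE)
  have "\<one>\<^bsub>?G\<^esub> \<otimes>\<^bsub>?G\<^esub> a = Collect (homotopic_paths M ((\<lambda>_. x) +++ p))"
    unfolding p(5) fundamental_group_one using p assms
    by (intro fundamental_group_mult) (auto simp: path_const path_image_def pathstart_def pathfinish_def)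
  also have "\<dots> = a"
    unfolding p(5) using p by (intro homotopy_class_eq homotopic_paths_const_left)
  finally show "\<one>\<^bsub>?G\<^esub> \<otimes>\<^bsub>?G\<^esub> a = a" .
  show "\<exists>b\<in>carrier ?G. b \<otimes>\<^bsub>?G\<^esub> a = \<one>\<^bsub>?G\<^esub>"
  proof
    have "Collect (homotopic_paths M (reversepath p)) \<otimes>\<^bsub>?G\<^esub> a
        = Collect (homotopic_paths M (reversepath p +++ p))"
      unfolding p(5) using p by (intro fundamental_group_mult) auto
    also have "\<dots> = \<one>\<^bsub>?G\<^esub>"
      unfolding fundamental_group_one using p by (intro homotopy_class_eq homotopic_paths_reversepath_join)
    finally show "Collect (homotopic_paths M (reversepath p)) \<otimes>\<^bsub>?G\<^esub> a = \<one>\<^bsub>?G\<^esub>" .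
    show "Collect (homotopic_paths M (reversepath p)) \<in> carrier ?G"
      using p by (intro in_fundamental_groupI) auto
  qed
qed
section \<open>Lifting to covering spaces\<close>

text \<open>The lifting theorems of the library require normed spaces.\<close>

lemma evenly_covered_nbhd:
  assumes "covering_space C p S" "z \<in> S"
  obtains U \<V> where "z \<in> U" "openin (top_of_set S) U" "\<Union>\<V> = C \<inter> p -` U"
    "\<And>V. V \<in> \<V> \<Longrightarrow> openin (top_of_set C) V" "pairwise disjnt \<V>"
    "\<And>V. V \<in> \<V> \<Longrightarrow> \<exists>q. homeomorphism V U p q"
proof -
  have "\<exists>T. z \<in> T \<and> openin (top_of_set S) T \<and>
                    (\<exists>v. \<Union>v = C \<inter> p -` T \<and>
                        (\<forall>u \<in> v. openin (top_of_set C) u) \<and>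
                        pairwise disjnt v \<and>
                        (\<forall>u \<in> v. \<exists>q. homeomorphism u T p q))"
    using assms unfolding covering_space_def by blast
  then show ?thesis by (elim exE conjE) (rule that, assumption+, auto)
qed

text \<open>The truth value of \<open>g1 x = g2 x\<close> is locally constant: where both lifts lie
  in one sheet, injectivity of \<open>p\<close> on it forces equality, and two different sheets are
  disjoint.\<close>

lemma covering_lift_unique:
  fixes p :: "'c::topological_space \<Rightarrow> 'a::topological_space" and g1 g2 :: "'b::topological_space \<Rightarrow> 'c"
  assumes cov: "covering_space C p S" and T: "connected T"
    and g1: "continuous_on T g1" "g1 ` T \<subseteq> C" and g2: "continuous_on T g2" "g2 ` T \<subseteq> C"
    and eq: "\<And>x. x \<in> T \<Longrightarrow> p (g1 x) = p (g2 x)" and a: "a \<in> T" "g1 a = g2 a" and x: "x \<in> T"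
  shows "g1 x = g2 x"
proof -
  have "(g1 a = g2 a) = (g1 x = g2 x)"
  proof (rule connected_equivalence_relation[OF T a(1) x, where R = "\<lambda>x y. (g1 x = g2 x) = (g1 y = g2 y)"])
    fix z assume z: "z \<in> T"
    have "p (g1 z) \<in> S"
      using z g1(2) covering_space_imp_surjective[OF cov] by auto
    then obtain U \<V> where U: "p (g1 z) \<in> U" "openin (top_of_set S) U" "\<Union>\<V> = C \<inter> p -` U"
      "\<And>V. V \<in> \<V> \<Longrightarrow> openin (top_of_set C) V" "pairwise disjnt \<V>"
      "\<And>V. V \<in> \<V> \<Longrightarrow> \<exists>q. homeomorphism V U p q"
      using evenly_covered_nbhd[OF cov] by metis
    have "g1 z \<in> C \<inter> p -` U" "g2 z \<in> C \<inter> p -` U"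
      using z g1(2) g2(2) U(1) eq[OF z] by auto
    then obtain V1 V2 where V: "V1 \<in> \<V>" "g1 z \<in> V1" "V2 \<in> \<V>" "g2 z \<in> V2"
      using U(3) by (metis UnionE)
    let ?W = "(T \<inter> g1 -` V1) \<inter> (T \<inter> g2 -` V2)"
    have "openin (top_of_set T) ?W"
      using V U(4) g1 g2 by (intro openin_Int continuous_openin_preimage[of _ _ C]) auto
    moreover have "z \<in> ?W" using z V by auto
    moreover have "(g1 z = g2 z) = (g1 y = g2 y)" if "y \<in> ?W" for y
    proof (cases "V1 = V2")
      case True
      obtain q where "homeomorphism V1 U p q" using U(6) V(1) by blast
      then have "inj_on p V1"
        by (metis homeomorphism_apply1 inj_onI)
      then show ?thesis
        using that V z eq True unfolding inj_on_def by auto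
    next
      case False
      then have "V1 \<inter> V2 = {}"
        using U(5) V unfolding pairwise_def disjnt_def by auto
      then show ?thesis using that V by auto
    qed
    ultimately show "\<exists>W. openin (top_of_set T) W \<and> z \<in> W \<and> (\<forall>y\<in>W. (g1 z = g2 z) = (g1 y = g2 y))"
      by blast
  qed auto
  then show ?thesis using a(2) by simp
qed

section \<open>Lifting over the unit square, paths and monodromy\<close>

text \<open>The value of the lift is prescribed at an arbitrary point of \<open>T\<close>, so that
  lifts on two pieces can be matched at any common point. For empty \<open>T\<close> the property is
  vacuous, which covers degenerate rectangles.\<close>

definition liftable ::
    "'c::topological_space set \<Rightarrow> ('c \<Rightarrow> 'a::topological_space) \<Rightarrow> 'b::topological_space set \<Rightarrow> ('b \<Rightarrow> 'a) \<Rightarrow> bool" where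
  "liftable C p T f \<longleftrightarrow> (\<forall>a\<in>T. \<forall>y\<in>C. p y = f a \<longrightarrow>
     (\<exists>g. continuous_on T g \<and> g ` T \<subseteq> C \<and> (\<forall>x\<in>T. p (g x) = f x) \<and> g a = y))"

text \<open>A lift over one set supplies the prescribed value for the other at a common point.
  Connectedness of the overlap makes the two lifts agree there, and closedness makes the glued map
  continuous.\<close>

lemma liftable_Un:
  fixes p :: "'c::topological_space \<Rightarrow> 'a::topological_space" and A B :: "'b::topological_space set"
  assumes cov: "covering_space C p S" and AB: "closed A" "closed B" "connected (A \<inter> B)" "A \<inter> B \<noteq> {}"
    and l: "liftable C p A f" "liftable C p B f"
  shows "liftable C p (A \<union> B) f"
proof -
  \<comment> \<open>Only a prescribed point in the first set is treated; \<open>A\<close> and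
    \<open>B\<close> are bound anew so that their roles can be exchanged afterwards.\<close>
  have *: "\<exists>g. continuous_on (A \<union> B) g \<and> g ` (A \<union> B) \<subseteq> C \<and> (\<forall>x\<in>A \<union> B. p (g x) = f x) \<and> g a = y"
    if AB: "closed A" "closed B" "connected (A \<inter> B)" "A \<inter> B \<noteq> {}"
      and l: "liftable C p A f" "liftable C p B f" and a: "a \<in> A" "y \<in> C" "p y = f a" for A B a y
  proof -
    obtain g where g: "continuous_on A g" "g ` A \<subseteq> C" "\<And>x. x \<in> A \<Longrightarrow> p (g x) = f x" "g a = y"
      using l(1) a unfolding liftable_def by blast
    obtain c where c: "c \<in> A" "c \<in> B" using AB by auto
    then have gc: "g c \<in> C" "p (g c) = f c" using g by auto
    obtain k where k: "continuous_on B k" "k ` B \<subseteq> C" "\<And>x. x \<in> B \<Longrightarrow> p (k x) = f x" "k c = g c"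
      using l(2) c gc unfolding liftable_def by blast
    have eq: "g x = k x" if "x \<in> A \<inter> B" for x
    proof (rule covering_lift_unique[OF cov AB(3), where a = c])
      show "continuous_on (A \<inter> B) g" "continuous_on (A \<inter> B) k"
        using g(1) k(1) by (auto intro: continuous_on_subset)
    qed (use g k c that in auto)
    let ?m = "\<lambda>x. if x \<in> A then g x else k x"
    have "continuous_on (A \<union> B) ?m"
      using AB g(1) k(1) eq by (intro continuous_on_cases) auto
    moreover have "?m ` (A \<union> B) \<subseteq> C" using g k by auto
    moreover have "\<forall>x\<in>A \<union> B. p (?m x) = f x" using g k by auto
    moreover have "?m a = y" using a g by auto
    ultimately show ?thesis by blast
  qed
  show ?thesis
    unfolding liftable_def
  proof (intro ballI impI)
    fix a y assume y: "a \<in> A \<union> B" "y \<in> C" "p y = f a"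
    show "\<exists>g. continuous_on (A \<union> B) g \<and> g ` (A \<union> B) \<subseteq> C \<and> (\<forall>x\<in>A \<union> B. p (g x) = f x) \<and> g a = y"
    proof (cases "a \<in> A")
      case True
      then show ?thesis using *[OF AB l _ y(2,3)] by blast
    next
      case False
      then have "a \<in> B" using y(1) by blast
      moreover have "connected (B \<inter> A)" "B \<inter> A \<noteq> {}" using AB by (simp_all add: Int_commute)
      ultimately show ?thesis using *[OF AB(2,1) _ _ l(2,1) _ y(2,3)] by (simp add: Un_commute)
    qed
  qed
qed

lemma liftable_into_evenly_covered:
  assumes U: "\<Union>\<V> = C \<inter> p -` U" "\<And>V. V \<in> \<V> \<Longrightarrow> \<exists>q. homeomorphism V U p q"
    and f: "continuous_on T f" "f ` T \<subseteq> U"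
  shows "liftable C p T f"
  unfolding liftable_def
proof (intro ballI impI)
  fix a y assume a: "a \<in> T" "y \<in> C" "p y = f a"
  then obtain V where V: "V \<in> \<V>" "y \<in> V" using U(1) f(2) by blast
  then obtain q where q: "homeomorphism V U p q" using U(2) by blast
  have "continuous_on T (q \<circ> f)"
    using f q by (metis continuous_on_compose continuous_on_subset homeomorphism_cont2)
  moreover have "(q \<circ> f) ` T \<subseteq> C"
    using f q V U(1) homeomorphism_image2[OF q] by fastforce
  moreover have "\<forall>x\<in>T. p ((q \<circ> f) x) = f x"
    using f(2) homeomorphism_apply2[OF q] by auto
  moreover have "(q \<circ> f) a = y"
    using a V homeomorphism_apply1[OF q V(2)] by simp
  ultimately show "\<exists>g. continuous_on T g \<and> g ` T \<subseteq> C \<and> (\<forall>x\<in>T. p (g x) = f x) \<and> g a = y" by blast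
qed

text \<open>A Lebesgue number makes small rectangles land in evenly covered sets. Bisection in the
  first coordinate yields thin strips, and bisection in the second the whole square; adjacent pieces
  meet in connected segments.\<close>

lemma covering_lift_square:
  fixes p :: "'c::topological_space \<Rightarrow> 'a::topological_space" and f :: "real \<times> real \<Rightarrow> 'a"
  assumes cov: "covering_space C p S" and f: "continuous_on ({0..1} \<times> {0..1}) f" "f ` ({0..1} \<times> {0..1}) \<subseteq> S"
  shows "liftable C p ({0..1} \<times> {0..1}) f"
proof -
  let ?Q = "{0..1::real} \<times> {0..1::real}"
  \<comment> \<open>Liftability is required on all subsets of \<open>?Q \<inter> G\<close>, so that
    it holds for every rectangle inside a small ball.\<close>
  define \<G> where "\<G> = {G. open G \<and> (\<forall>T. T \<subseteq> ?Q \<inter> G \<longrightarrow> liftable C p T f)}"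
  have "?Q \<subseteq> \<Union>\<G>"
  proof
    fix z assume z: "z \<in> ?Q"
    have fz: "f z \<in> S" using f(2) z by blast
    obtain U \<V> where U: "f z \<in> U" "openin (top_of_set S) U" "\<Union>\<V> = C \<inter> p -` U"
      "\<And>V. V \<in> \<V> \<Longrightarrow> openin (top_of_set C) V" "pairwise disjnt \<V>"
      "\<And>V. V \<in> \<V> \<Longrightarrow> \<exists>q. homeomorphism V U p q"
      by (rule evenly_covered_nbhd[OF cov fz]) auto
    have "openin (top_of_set ?Q) (?Q \<inter> f -` U)"
      using f U(2) by (intro continuous_openin_preimage[of _ _ S]) auto
    then obtain G where G: "open G" "?Q \<inter> f -` U = ?Q \<inter> G"
      by (auto simp: openin_open)
    have "liftable C p T f" if "T \<subseteq> ?Q \<inter> G" for T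
    proof (rule liftable_into_evenly_covered[OF U(3) U(6)])
      show "continuous_on T f" using that f(1) by (auto intro: continuous_on_subset)
      show "f ` T \<subseteq> U" using that G(2) by blast
    qed
    then have "G \<in> \<G>" using G(1) by (auto simp: \<G>_def)
    moreover have "z \<in> G" using G(2) U(1) z by blast
    ultimately show "z \<in> \<Union>\<G>" by blast
  qed
  moreover have "compact ?Q" by (intro compact_Times compact_Icc)
  moreover have "\<And>G. G \<in> \<G> \<Longrightarrow> open G" by (simp add: \<G>_def)
  ultimately obtain e where e: "e > 0" "\<And>x. x \<in> ?Q \<Longrightarrow> \<exists>G\<in>\<G>. ball x e \<subseteq> G"
    using Heine_Borel_lemma[of ?Q \<G>] by metis
  have small: "liftable C p ({a..b} \<times> {c..d}) f"
    if ab: "0 \<le> a" "b \<le> 1" "b - a < e / 2" and cd: "0 \<le> c" "d \<le> 1" "d - c < e / 2" for a b c d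
  proof (cases "a \<le> b \<and> c \<le> d")
    case True
    have *: "{a..b} \<times> {c..d} \<subseteq> ball (a, c) e"
    proof
      fix z assume "z \<in> {a..b} \<times> {c..d}"
      then have z: "a \<le> fst z" "fst z \<le> b" "c \<le> snd z" "snd z \<le> d" by auto
      have "dist (a, c) z \<le> \<bar>a - fst z\<bar> + \<bar>c - snd z\<bar>"
        using sqrt_sum_squares_le_sum_abs[of "a - fst z" "c - snd z"]
        by (simp add: dist_prod_def dist_real_def)
      also have "\<dots> < e" using z ab cd by auto
      finally show "z \<in> ball (a, c) e" by simp
    qed
    obtain G where G: "G \<in> \<G>" "ball (a, c) e \<subseteq> G"
      using e(2)[of "(a, c)"] True ab cd by auto
    have "{a..b} \<times> {c..d} \<subseteq> ?Q" using ab cd by auto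
    then have "{a..b} \<times> {c..d} \<subseteq> ?Q \<inter> G" using * G(2) by (meson Int_greatest order_trans)
    with G(1) show ?thesis by (simp add: \<G>_def)
  qed (auto simp: liftable_def)
  have strip: "liftable C p ({0..1} \<times> {c..d}) f"
    if cd: "0 \<le> c" "d \<le> 1" "d - c < e / 2" for c d
  proof (cases "c \<le> d")
    case True
    have "0 \<le> (0::real) \<and> 1 \<le> (1::real) \<longrightarrow> liftable C p ({0..1} \<times> {c..d}) f"
    \<comment> \<open>\<open>Bolzano\<close> also tests short intervals that stick out of the unit
      interval; the guards on \<open>a\<close> and \<open>b\<close> discard them.\<close>
    proof (rule Bolzano[of 0 1 "\<lambda>a b. 0 \<le> a \<and> b \<le> 1 \<longrightarrow> liftable C p ({a..b} \<times> {c..d}) f"])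
      fix a b c' :: real
      assume trans: "0 \<le> a \<and> b \<le> 1 \<longrightarrow> liftable C p ({a..b} \<times> {c..d}) f"
        "0 \<le> b \<and> c' \<le> 1 \<longrightarrow> liftable C p ({b..c'} \<times> {c..d}) f" "a \<le> b" "b \<le> c'"
      show "0 \<le> a \<and> c' \<le> 1 \<longrightarrow> liftable C p ({a..c'} \<times> {c..d}) f"
      proof
        assume *: "0 \<le> a \<and> c' \<le> 1"
        have "liftable C p ({a..b} \<times> {c..d} \<union> {b..c'} \<times> {c..d}) f"
        proof (rule liftable_Un[OF cov])
          have "({a..b} \<times> {c..d}) \<inter> ({b..c'} \<times> {c..d}) = {b..b} \<times> {c..d}"
            using trans by auto
          then show "connected (({a..b} \<times> {c..d}) \<inter> ({b..c'} \<times> {c..d}))"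
            "({a..b} \<times> {c..d}) \<inter> ({b..c'} \<times> {c..d}) \<noteq> {}"
            using True by (auto intro!: connected_Times)
        qed (use trans * in \<open>auto intro!: closed_Times\<close>)
        moreover have "{a..b} \<times> {c..d} \<union> {b..c'} \<times> {c..d} = {a..c'} \<times> {c..d}"
          using trans by auto
        ultimately show "liftable C p ({a..c'} \<times> {c..d}) f" by simp
      qed
    next
      fix x :: real
      show "\<exists>\<delta>>0. \<forall>a b. a \<le> x \<and> x \<le> b \<and> b - a < \<delta> \<longrightarrow> 0 \<le> a \<and> b \<le> 1 \<longrightarrow> liftable C p ({a..b} \<times> {c..d}) f"
        using e(1) small cd by (intro exI[of _ "e / 2"]) auto
    qed auto
    then show ?thesis by simp
  qed (auto simp: liftable_def)
  have "0 \<le> (0::real) \<and> 1 \<le> (1::real) \<longrightarrow> liftable C p ({0..1} \<times> {0..1}) f"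
  proof (rule Bolzano[of 0 1 "\<lambda>a b. 0 \<le> a \<and> b \<le> 1 \<longrightarrow> liftable C p ({0..1} \<times> {a..b}) f"])
    fix a b c :: real
    assume trans: "0 \<le> a \<and> b \<le> 1 \<longrightarrow> liftable C p ({0..1} \<times> {a..b}) f"
      "0 \<le> b \<and> c \<le> 1 \<longrightarrow> liftable C p ({0..1} \<times> {b..c}) f" "a \<le> b" "b \<le> c"
    show "0 \<le> a \<and> c \<le> 1 \<longrightarrow> liftable C p ({0..1} \<times> {a..c}) f"
    proof
      assume *: "0 \<le> a \<and> c \<le> 1"
      have "liftable C p ({0..1} \<times> {a..b} \<union> {0..1} \<times> {b..c}) f"
      proof (rule liftable_Un[OF cov])
        have "({0..1::real} \<times> {a..b}) \<inter> ({0..1} \<times> {b..c}) = {0..1} \<times> {b..b}"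
          using trans by auto
        then show "connected (({0..1::real} \<times> {a..b}) \<inter> ({0..1} \<times> {b..c}))"
          "({0..1::real} \<times> {a..b}) \<inter> ({0..1} \<times> {b..c}) \<noteq> {}"
          by (auto intro!: connected_Times)
      qed (use trans * in \<open>auto intro!: closed_Times\<close>)
      moreover have "{0..1::real} \<times> {a..b} \<union> {0..1} \<times> {b..c} = {0..1} \<times> {a..c}"
        using trans by auto
      ultimately show "liftable C p ({0..1} \<times> {a..c}) f" by simp
    qed
  next
    fix x :: real
    show "\<exists>\<delta>>0. \<forall>a b. a \<le> x \<and> x \<le> b \<and> b - a < \<delta> \<longrightarrow> 0 \<le> a \<and> b \<le> 1 \<longrightarrow> liftable C p ({0..1} \<times> {a..b}) f"
      using e(1) strip by (intro exI[of _ "e / 2"]) auto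
  qed auto
  then show ?thesis by simp
qed

text \<open>The path is lifted as a map of the square that ignores the second coordinate, and the
  lift is restricted to one edge.\<close>

lemma covering_lift_path:
  fixes p :: "'c::topological_space \<Rightarrow> 'a::topological_space"
  assumes cov: "covering_space C p S" and r: "path r" "path_image r \<subseteq> S" and y: "y \<in> C" "p y = pathstart r"
  obtains q where "path q" "path_image q \<subseteq> C" "pathstart q = y" "\<And>t. t \<in> {0..1} \<Longrightarrow> p (q t) = r t"
proof -
  have "continuous_on ({0..1} \<times> {0..1::real}) (\<lambda>z. r (fst z))"
    by (rule continuous_on_compose2[OF r(1)[unfolded path_def]]) (auto intro!: continuous_intros)
  then have "liftable C p ({0..1} \<times> {0..1::real}) (\<lambda>z. r (fst z))"
    using r(2) by (intro covering_lift_square[OF cov]) (auto simp: path_image_def)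
  then obtain g where g: "continuous_on ({0..1} \<times> {0..1::real}) g" "g ` ({0..1} \<times> {0..1::real}) \<subseteq> C"
    "\<And>x. x \<in> {0..1} \<times> {0..1} \<Longrightarrow> p (g x) = r (fst x)" "g (0, 0) = y"
    using y unfolding liftable_def pathstart_def by (metis SigmaI atLeastAtMost_iff fst_conv order_refl zero_le_one)
  have "path (\<lambda>t. g (t, 0))"
    unfolding path_def by (rule continuous_on_compose2[OF g(1)]) (auto intro!: continuous_intros)
  then show ?thesis
    using g by (intro that[of "\<lambda>t. g (t, 0)"]) (auto simp: path_image_def pathstart_def)
qed

text \<open>The homotopy lifts to \<open>g\<close> on the square, and uniqueness of lifts identifies
  \<open>g\<close> on the edges: it is \<open>q1\<close> and \<open>q2\<close> on two opposite ones
  and constant on the other two, where the homotopy fixes the end points.\<close>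

lemma covering_monodromy:
  fixes p :: "'c::topological_space \<Rightarrow> 'a::topological_space"
  assumes cov: "covering_space C p S" and q: "path q1" "path_image q1 \<subseteq> C" "path q2" "path_image q2 \<subseteq> C"
    "pathstart q1 = pathstart q2" and hom: "homotopic_paths S (p \<circ> q1) (p \<circ> q2)"
  shows "pathfinish q1 = pathfinish q2"
proof -
  let ?I = "{0..1::real}"
  obtain h where h: "continuous_on (?I \<times> ?I) h" "h ` (?I \<times> ?I) \<subseteq> S"
    "\<And>x. x \<in> ?I \<Longrightarrow> h (0, x) = p (q1 x)" "\<And>x. x \<in> ?I \<Longrightarrow> h (1, x) = p (q2 x)"
    "\<And>t. t \<in> ?I \<Longrightarrow> h (t, 0) = p (q1 0)" "\<And>t. t \<in> ?I \<Longrightarrow> h (t, 1) = p (q1 1)"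
  proof -
    obtain h where "continuous_on (?I \<times> ?I) h" "h \<in> ?I \<times> ?I \<rightarrow> S"
      "\<And>x. x \<in> ?I \<Longrightarrow> h (0, x) = p (q1 x)" "\<And>x. x \<in> ?I \<Longrightarrow> h (1, x) = p (q2 x)"
      "\<And>t. t \<in> ?I \<Longrightarrow> h (t, 0) = p (q1 0) \<and> h (t, 1) = p (q1 1)"
      using hom unfolding homotopic_paths pathstart_def pathfinish_def comp_apply by blast
    then show ?thesis by (intro that[of h]) blast+
  qed
  have C: "q1 t \<in> C" "q2 t \<in> C" if "t \<in> ?I" for t
    using q(2,4) that unfolding path_image_def by blast+
  have "liftable C p (?I \<times> ?I) h" by (rule covering_lift_square[OF cov h(1,2)])
  moreover have "q1 0 \<in> C" "p (q1 0) = h (0, 0)" "(0, 0) \<in> ?I \<times> ?I" using C h(3) by auto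
  ultimately obtain g where g: "continuous_on (?I \<times> ?I) g" "g ` (?I \<times> ?I) \<subseteq> C"
    "\<And>z. z \<in> ?I \<times> ?I \<Longrightarrow> p (g z) = h z" "g (0, 0) = q1 0"
    unfolding liftable_def by metis
  have c: "continuous_on ?I (\<lambda>t. g (s, t))" "continuous_on ?I (\<lambda>t. g (t, s))" if "s \<in> ?I" for s
    using that by (auto intro!: continuous_on_compose2[OF g(1)] continuous_intros)
  note u = covering_lift_unique[OF cov connected_Icc]
  have 1: "g (0, t) = q1 t" if "t \<in> ?I" for t
    by (rule u[where a = 0]) (use c g h q C that in \<open>auto simp: path_def\<close>)
  have 2: "g (t, 0) = q1 0" if "t \<in> ?I" for t
    by (rule u[of 0 1 "\<lambda>t. g (t, 0)" "\<lambda>t. q1 0" 0]) (use c g h q C that in \<open>auto simp: path_def\<close>)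
  have 3: "g (1, t) = q2 t" if "t \<in> ?I" for t
    by (rule u[where a = 0]) (use c g h q C that 2[of 1] in \<open>auto simp: path_def pathstart_def\<close>)
  have 4: "g (t, 1) = q1 1" if "t \<in> ?I" for t
    by (rule u[of 0 1 "\<lambda>t. g (t, 1)" "\<lambda>t. q1 1" 0]) (use c g h q C that 1[of 1] in \<open>auto simp: path_def\<close>)
  show ?thesis using 3[of 1] 4[of 1] by (simp add: pathfinish_def)
qed

section \<open>Lifting maps from simply connected, locally path connected spaces\<close>

lemma continuous_on_openin_cover:
  assumes "\<And>x. x \<in> U \<Longrightarrow> \<exists>V. openin (top_of_set U) V \<and> x \<in> V \<and> continuous_on V g"
  shows "continuous_on U g"
  unfolding continuous_on_def
proof
  fix x assume x: "x \<in> U"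
  obtain V where V: "openin (top_of_set U) V" "x \<in> V" "continuous_on V g" using assms[OF x] by blast
  then obtain G where G: "open G" "V = U \<inter> G" by (auto simp: openin_open)
  have "at x within U = at x within V"
    using G V(2) by (intro at_within_nhd[of x G]) auto
  then show "(g \<longlongrightarrow> g x) (at x within U)"
    using V by (simp add: continuous_on_def)
qed

text \<open>The classical lifting criterion: \<open>g y\<close> is the end of the lift of
  \<open>f \<circ> r\<close> for any path \<open>r\<close> from \<open>z\<close> to
  \<open>y\<close>. All such \<open>r\<close> are homotopic in \<open>U\<close>, so by monodromy the
  end does not depend on \<open>r\<close>. Near \<open>y\<close> the path can be prolonged inside a
  path connected set that \<open>f\<close> maps into an evenly covered one, so there
  \<open>g\<close> is \<open>f\<close> followed by the inverse of a single sheet.\<close>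

lemma covering_lift_map:
  fixes p :: "'c::topological_space \<Rightarrow> 'a::topological_space" and f :: "'b::topological_space \<Rightarrow> 'a"
  assumes cov: "covering_space C p S" and U: "simply_connected U"
    and lpc: "\<And>W y. openin (top_of_set U) W \<Longrightarrow> y \<in> W \<Longrightarrow>
        \<exists>V. openin (top_of_set U) V \<and> y \<in> V \<and> V \<subseteq> W \<and> path_connected V"
    and f: "continuous_on U f" "f ` U \<subseteq> S" and z: "z \<in> U" "a \<in> C" "p a = f z"
  obtains g where "continuous_on U g" "g ` U \<subseteq> C" "g z = a" "\<And>x. x \<in> U \<Longrightarrow> p (g x) = f x"
proof -
  define ends where "ends y e \<longleftrightarrow> (\<exists>r q. path r \<and> path_image r \<subseteq> U \<and> pathstart r = z \<and> pathfinish r = y \<and>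
     path q \<and> path_image q \<subseteq> C \<and> pathstart q = a \<and> pathfinish q = e \<and> (\<forall>t\<in>{0..1}. p (q t) = f (r t)))" for y e
  have fr: "path (f \<circ> r)" "path_image (f \<circ> r) \<subseteq> S" if "path r" "path_image r \<subseteq> U" for r
  proof -
    show "path (f \<circ> r)" using that f(1) by (metis continuous_on_subset path_continuous_image)
    show "path_image (f \<circ> r) \<subseteq> S" using that f(2) by (auto simp: path_image_def)
  qed
  have ex: "\<exists>e. ends y e" if y: "y \<in> U" for y
  proof -
    obtain r where r: "path r" "path_image r \<subseteq> U" "pathstart r = z" "pathfinish r = y"
      using simply_connected_imp_path_connected_space[OF U] y z(1) unfolding path_connected_def by blast
    have "p a = pathstart (f \<circ> r)" using r(3) z(3) by (simp add: pathstart_def)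
    then obtain q where "path q" "path_image q \<subseteq> C" "pathstart q = a" "\<And>t. t \<in> {0..1} \<Longrightarrow> p (q t) = (f \<circ> r) t"
      using covering_lift_path[OF cov fr[OF r(1,2)] z(2)] by blast
    then show ?thesis unfolding ends_def using r by (metis comp_apply)
  qed
  have uniq: "e = e'" if ends: "ends y e" "ends y e'" for y e e'
  proof -
    obtain r q where r: "path r" "path_image r \<subseteq> U" "pathstart r = z" "pathfinish r = y"
      and q: "path q" "path_image q \<subseteq> C" "pathstart q = a" "pathfinish q = e" "\<And>t. t \<in> {0..1} \<Longrightarrow> p (q t) = f (r t)"
      using ends(1) unfolding ends_def by blast
    obtain r' q' where r': "path r'" "path_image r' \<subseteq> U" "pathstart r' = z" "pathfinish r' = y"
      and q': "path q'" "path_image q' \<subseteq> C" "pathstart q' = a" "pathfinish q' = e'" "\<And>t. t \<in> {0..1} \<Longrightarrow> p (q' t) = f (r' t)"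
      using ends(2) unfolding ends_def by blast
    have "homotopic_paths S (p \<circ> q) (f \<circ> r)"
      using q fr[OF r(1,2)] by (intro homotopic_paths_sym[OF homotopic_paths_eq]) auto
    also have "homotopic_paths S (f \<circ> r) (f \<circ> r')"
      using r r' f by (intro homotopic_paths_continuous_image[OF simply_connected_imp_homotopic_paths[OF U]]) auto
    also have "homotopic_paths S (f \<circ> r') (p \<circ> q')"
      using q' fr[OF r'(1,2)] by (intro homotopic_paths_eq) auto
    finally have "pathfinish q = pathfinish q'"
      using q q' by (intro covering_monodromy[OF cov]) auto
    then show ?thesis using q q' by simp
  qed
  define g where "g y = (SOME e. ends y e)" for y
  have g: "ends y (g y)" if "y \<in> U" for y
    unfolding g_def using ex[OF that] by (rule someI_ex)
  have gC: "g y \<in> C" "p (g y) = f y" if y: "y \<in> U" for y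
  proof -
    obtain r q where "pathfinish r = y" "path_image q \<subseteq> C" "pathfinish q = g y" "\<forall>t\<in>{0..1}. p (q t) = f (r t)"
      using g[OF y] unfolding ends_def by blast
    moreover from this have "p (q 1) = f (r 1)" by simp
    ultimately show "g y \<in> C" "p (g y) = f y"
      using pathfinish_in_path_image[of q] by (auto simp: pathfinish_def)
  qed
  have "continuous_on U g"
  proof (rule continuous_on_openin_cover)
    fix y assume y: "y \<in> U"
    have fy: "f y \<in> S" using f(2) y by blast
    obtain E \<V> where E: "f y \<in> E" "openin (top_of_set S) E" "\<Union>\<V> = C \<inter> p -` E"
      "\<And>V. V \<in> \<V> \<Longrightarrow> openin (top_of_set C) V" "pairwise disjnt \<V>"
      "\<And>V. V \<in> \<V> \<Longrightarrow> \<exists>q. homeomorphism V E p q"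
      by (rule evenly_covered_nbhd[OF cov fy]) auto
    have "g y \<in> \<Union>\<V>" using E(1,3) gC[OF y] by auto
    then obtain V where V: "V \<in> \<V>" "g y \<in> V" by blast
    then obtain k where k: "homeomorphism V E p k" using E(6) by blast
    have "openin (top_of_set U) (U \<inter> f -` E)"
      using f E(2) by (intro continuous_openin_preimage[of _ _ S]) auto
    then obtain W where W: "openin (top_of_set U) W" "y \<in> W" "W \<subseteq> U \<inter> f -` E" "path_connected W"
      using lpc[of "U \<inter> f -` E" y] y E(1) by blast
    have kf: "continuous_on W (k \<circ> f)"
      using W(3) f(1) homeomorphism_cont2[OF k]
      by (intro continuous_on_compose) (auto intro: continuous_on_subset)
    have "g x = (k \<circ> f) x" if x: "x \<in> W" for x
    proof -
      obtain r q where r: "path r" "path_image r \<subseteq> U" "pathstart r = z" "pathfinish r = y"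
        and q: "path q" "path_image q \<subseteq> C" "pathstart q = a" "pathfinish q = g y" "\<And>t. t \<in> {0..1} \<Longrightarrow> p (q t) = f (r t)"
        using g[OF y] unfolding ends_def by blast
      obtain \<rho> where \<rho>: "path \<rho>" "path_image \<rho> \<subseteq> W" "pathstart \<rho> = y" "pathfinish \<rho> = x"
        using W(2,4) x unfolding path_connected_def by blast
      have \<rho>E: "f (\<rho> t) \<in> E" if "t \<in> {0..1}" for t
        using \<rho>(2) W(3) that unfolding path_image_def by blast
      have l: "path (k \<circ> f \<circ> \<rho>)" "path_image (k \<circ> f \<circ> \<rho>) \<subseteq> C" "pathstart (k \<circ> f \<circ> \<rho>) = g y"
        "pathfinish (k \<circ> f \<circ> \<rho>) = k (f x)"
      proof -
        show "path (k \<circ> f \<circ> \<rho>)" using \<rho> kf by (metis continuous_on_subset path_continuous_image)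
        have "k ` E \<subseteq> C" using homeomorphism_image2[OF k] V(1) E(3) by blast
        then show "path_image (k \<circ> f \<circ> \<rho>) \<subseteq> C" using \<rho>E by (auto simp: path_image_def)
        have "k (f y) = g y" using homeomorphism_apply1[OF k V(2)] gC(2)[OF y] by simp
        then show "pathstart (k \<circ> f \<circ> \<rho>) = g y" "pathfinish (k \<circ> f \<circ> \<rho>) = k (f x)"
          using \<rho>(3,4) by (auto simp: pathstart_def pathfinish_def)
      qed
      have "ends x (k (f x))"
        unfolding ends_def
      proof (intro exI conjI ballI)
        show "path (r +++ \<rho>)" "path (q +++ (k \<circ> f \<circ> \<rho>))"
          using r \<rho> q l by auto
        show "path_image (r +++ \<rho>) \<subseteq> U" "path_image (q +++ (k \<circ> f \<circ> \<rho>)) \<subseteq> C"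
          using r \<rho> W(3) q l by - (intro subset_path_image_join; auto)+
        fix t :: real assume t: "t \<in> {0..1}"
        show "p ((q +++ (k \<circ> f \<circ> \<rho>)) t) = f ((r +++ \<rho>) t)"
          using t q(5) homeomorphism_apply2[OF k \<rho>E] by (auto simp: joinpaths_def)
      qed (use r q \<rho> l in auto)
      moreover have "ends x (g x)" using g W(3) x by blast
      ultimately show ?thesis using uniq by simp
    qed
    then have "continuous_on W g" using kf by (metis continuous_on_cong)
    then show "\<exists>V. openin (top_of_set U) V \<and> y \<in> V \<and> continuous_on V g" using W by blast
  qed
  moreover have "g z = a"
  proof -
    have "ends z a"
      unfolding ends_def using z
      by (intro exI[of _ "\<lambda>_. z"] exI[of _ "\<lambda>_. a"]) (auto simp: path_const path_image_def pathstart_def pathfinish_def)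
    then show ?thesis using uniq g z(1) by blast
  qed
  ultimately show ?thesis using gC by (intro that[of g]) auto
qed

section \<open>Deck transformations of a simply connected covering\<close>

locale simply_connected_cover =
  fixes N :: "'b::topological_space set" and \<pi> :: "'b \<Rightarrow> 'a::topological_space" and M :: "'a set"
  assumes cov: "covering_space N \<pi> M" and simply_connected: "simply_connected N"
    and locally_path_connected: "\<And>W y. openin (top_of_set N) W \<Longrightarrow> y \<in> W \<Longrightarrow>
        \<exists>V. openin (top_of_set N) V \<and> y \<in> V \<and> V \<subseteq> W \<and> path_connected V"
begin

lemma connected_N: "connected N"
  using simply_connected_imp_path_connected_space[OF simply_connected] by (rule path_connected_imp_connected)

lemma cont_\<pi>: "continuous_on N \<pi>" and \<pi>_image: "\<pi> ` N = M"
  using cov by (auto simp: covering_space_def)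

lemma path_project:
  assumes "path q" "path_image q \<subseteq> N"
  shows "path (\<pi> \<circ> q)" "path_image (\<pi> \<circ> q) \<subseteq> M"
proof -
  show "path (\<pi> \<circ> q)" using assms cont_\<pi> by (metis continuous_on_subset path_continuous_image)
  show "path_image (\<pi> \<circ> q) \<subseteq> M" using assms \<pi>_image by (auto simp: path_image_def)
qed

lemma deck_transformationD:
  assumes "h \<in> deck_transformations N \<pi>"
  shows "continuous_on N h" "h ` N = N" "\<And>y. y \<in> N \<Longrightarrow> \<pi> (h y) = \<pi> y" "h \<in> extensional N"
  using assms by (auto simp: deck_transformations_def homeomorphism_def)

text \<open>Deck transformations are lifts of \<open>\<pi>\<close> through itself on a connected
  space, so one value determines them; \<open>extensional\<close> turns agreement on
  \<open>N\<close> into equality.\<close>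

lemma deck_transformation_unique:
  assumes h: "h \<in> deck_transformations N \<pi>" "k \<in> deck_transformations N \<pi>" and y: "y \<in> N" "h y = k y"
  shows "h = k"
proof (rule extensionalityI)
  fix x assume x: "x \<in> N"
  show "h x = k x"
    by (rule covering_lift_unique[OF cov connected_N, where a = y])
      (use deck_transformationD[OF h(1)] deck_transformationD[OF h(2)] y x in auto)
qed (use assms in \<open>auto simp: deck_transformations_def\<close>)

text \<open>\<open>\<pi>\<close> is lifted through itself twice, once sending \<open>y0\<close> to
  \<open>y1\<close> and once back. Both composites lift \<open>\<pi>\<close> and fix a point, hence
  are the identity.\<close>

lemma deck_transformation_exists:
  assumes y: "y0 \<in> N" "y1 \<in> N" "\<pi> y0 = \<pi> y1"
  obtains h where "h \<in> deck_transformations N \<pi>" "h y0 = y1"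
proof -
  have \<pi>N: "\<pi> ` N \<subseteq> M" using \<pi>_image by simp
  obtain g where g: "continuous_on N g" "g ` N \<subseteq> N" "g y0 = y1" "\<And>x. x \<in> N \<Longrightarrow> \<pi> (g x) = \<pi> x"
    using covering_lift_map[OF cov simply_connected locally_path_connected cont_\<pi> \<pi>N y(1,2)] y(3) by metis
  obtain k where k: "continuous_on N k" "k ` N \<subseteq> N" "k y1 = y0" "\<And>x. x \<in> N \<Longrightarrow> \<pi> (k x) = \<pi> x"
    using covering_lift_map[OF cov simply_connected locally_path_connected cont_\<pi> \<pi>N y(2,1)] y(3) by metis
  have im: "g x \<in> N" "k x \<in> N" if "x \<in> N" for x
    using that g(2) k(2) by auto
  have gk: "g (k x) = x" if "x \<in> N" for x
    by (rule covering_lift_unique[OF cov connected_N, of "\<lambda>x. g (k x)" "\<lambda>x. x" y1])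
      (use that y g k im in \<open>auto intro: continuous_on_compose2\<close>)
  have kg: "k (g x) = x" if "x \<in> N" for x
    by (rule covering_lift_unique[OF cov connected_N, of "\<lambda>x. k (g x)" "\<lambda>x. x" y0])
      (use that y g k im in \<open>auto intro: continuous_on_compose2\<close>)
  have "homeomorphism N N g k"
    using g k gk kg by (intro homeomorphismI) auto
  then have "homeomorphism N N (restrict g N) k"
    by (rule homeomorphism_cong) auto
  then have "restrict g N \<in> deck_transformations N \<pi>"
    using g(4) by (auto simp: deck_transformations_def)
  then show ?thesis using g(3) y(1) by (intro that[of "restrict g N"]) auto
qed

text \<open>The description in \<open>deck\<close> is unambiguous: lifts of two representatives of
  \<open>\<gamma>\<close> end at the same point by monodromy, and that point determines the deck
  transformation.\<close>

lemma deck_eqI: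
  assumes h: "h \<in> deck_transformations N \<pi>" and \<gamma>: "\<gamma> \<in> carrier (fundamental_group M (\<pi> y0))"
    and q: "path q" "path_image q \<subseteq> N" "pathstart q = y0" "pathfinish q = h y0" "\<pi> \<circ> q \<in> \<gamma>"
  shows "deck N \<pi> y0 \<gamma> = h"
  unfolding deck_def
proof (rule the_equality)
  show "h \<in> deck_transformations N \<pi> \<and>
      (\<exists>q. path q \<and> path_image q \<subseteq> N \<and> pathstart q = y0 \<and> pathfinish q = h y0 \<and> \<pi> \<circ> q \<in> \<gamma>)"
    using h q by blast
next
  fix h' assume "h' \<in> deck_transformations N \<pi> \<and>
      (\<exists>q. path q \<and> path_image q \<subseteq> N \<and> pathstart q = y0 \<and> pathfinish q = h' y0 \<and> \<pi> \<circ> q \<in> \<gamma>)"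
  then obtain q' where h': "h' \<in> deck_transformations N \<pi>"
    and q': "path q'" "path_image q' \<subseteq> N" "pathstart q' = y0" "pathfinish q' = h' y0" "\<pi> \<circ> q' \<in> \<gamma>" by blast
  obtain p where p: "\<gamma> = Collect (homotopic_paths M p)" using \<gamma> by (rule in_fundamental_groupE)
  have "homotopic_paths M (\<pi> \<circ> q) (\<pi> \<circ> q')"
    using q(5) q'(5) unfolding p by (metis homotopic_paths_sym homotopic_paths_trans mem_Collect_eq)
  then have "pathfinish q = pathfinish q'"
    using q q' by (intro covering_monodromy[OF cov]) auto
  then show "h' = h"
    using q q' h h' deck_transformation_unique[of h' h y0] pathstart_in_path_image[of q] by auto
qed

lemma deck_spec:
  assumes y0: "y0 \<in> N" and \<gamma>: "\<gamma> \<in> carrier (fundamental_group M (\<pi> y0))"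
  shows "deck N \<pi> y0 \<gamma> \<in> deck_transformations N \<pi>"
    and "\<exists>q. path q \<and> path_image q \<subseteq> N \<and> pathstart q = y0 \<and> pathfinish q = deck N \<pi> y0 \<gamma> y0 \<and> \<pi> \<circ> q \<in> \<gamma>"
proof -
  obtain p where p: "path p" "path_image p \<subseteq> M" "pathstart p = \<pi> y0" "pathfinish p = \<pi> y0"
    "\<gamma> = Collect (homotopic_paths M p)" using \<gamma> by (rule in_fundamental_groupE)
  obtain q where q: "path q" "path_image q \<subseteq> N" "pathstart q = y0" "\<And>t. t \<in> {0..1} \<Longrightarrow> \<pi> (q t) = p t"
    using covering_lift_path[OF cov p(1,2) y0] p(3) by metis
  have "\<pi> (pathfinish q) = \<pi> y0"
    using q(4)[of 1] p(4) by (simp add: pathfinish_def)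
  moreover have "pathfinish q \<in> N" using q(2) by auto
  ultimately obtain h where h: "h \<in> deck_transformations N \<pi>" "h y0 = pathfinish q"
    using deck_transformation_exists[OF y0] by metis
  have "\<pi> \<circ> q \<in> \<gamma>"
    unfolding p(5) using p q by (auto intro: homotopic_paths_eq)
  moreover from this have "deck N \<pi> y0 \<gamma> = h"
    using h q by (intro deck_eqI[OF _ \<gamma>]) auto
  ultimately show "deck N \<pi> y0 \<gamma> \<in> deck_transformations N \<pi>"
    and "\<exists>q. path q \<and> path_image q \<subseteq> N \<and> pathstart q = y0 \<and> pathfinish q = deck N \<pi> y0 \<gamma> y0 \<and> \<pi> \<circ> q \<in> \<gamma>"
    using h q by auto
qed

lemma deck_transformation_comp:
  assumes h: "h \<in> deck_transformations N \<pi>" and k: "k \<in> deck_transformations N \<pi>"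
  shows "restrict (h \<circ> k) N \<in> deck_transformations N \<pi>"
proof -
  obtain h' k' where "homeomorphism N N h h'" "homeomorphism N N k k'"
    using h k by (auto simp: deck_transformations_def)
  then have "homeomorphism N N (h \<circ> k) (k' \<circ> h')" by (metis homeomorphism_compose)
  then have "homeomorphism N N (restrict (h \<circ> k) N) (k' \<circ> h')" by (rule homeomorphism_cong) auto
  moreover have "\<pi> (restrict (h \<circ> k) N y) = \<pi> y" if "y \<in> N" for y
  proof -
    have "k y \<in> N" using that deck_transformationD(2)[OF k] by blast
    then show ?thesis using that deck_transformationD(3)[OF h] deck_transformationD(3)[OF k] by simp
  qed
  ultimately show ?thesis by (auto simp: deck_transformations_def)
qed

text \<open>If \<open>q\<close> lifts \<open>\<gamma>\<close> and \<open>r\<close> lifts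
  \<open>\<delta>\<close>, the product is lifted by \<open>q\<close> followed by the translate
  \<open>?h \<circ> r\<close>, which ends at \<open>?h (?k y0)\<close>. So traversing the first path
  first corresponds to applying its deck transformation last.\<close>

lemma deck_mult:
  assumes y0: "y0 \<in> N" and \<gamma>: "\<gamma> \<in> carrier (fundamental_group M (\<pi> y0))" and \<delta>: "\<delta> \<in> carrier (fundamental_group M (\<pi> y0))"
    and x: "x \<in> N"
  shows "deck N \<pi> y0 (\<gamma> \<otimes>\<^bsub>fundamental_group M (\<pi> y0)\<^esub> \<delta>) x = deck N \<pi> y0 \<gamma> (deck N \<pi> y0 \<delta> x)"
proof -
  let ?h = "deck N \<pi> y0 \<gamma>" and ?k = "deck N \<pi> y0 \<delta>"
  note h = deck_transformationD[OF deck_spec(1)[OF y0 \<gamma>]] and k = deck_transformationD[OF deck_spec(1)[OF y0 \<delta>]]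
  obtain q where q: "path q" "path_image q \<subseteq> N" "pathstart q = y0" "pathfinish q = ?h y0" "\<pi> \<circ> q \<in> \<gamma>"
    using deck_spec(2)[OF y0 \<gamma>] by blast
  obtain r where r: "path r" "path_image r \<subseteq> N" "pathstart r = y0" "pathfinish r = ?k y0" "\<pi> \<circ> r \<in> \<delta>"
    using deck_spec(2)[OF y0 \<delta>] by blast
  have hr: "path (?h \<circ> r)" "path_image (?h \<circ> r) \<subseteq> N"
  proof -
    show "path (?h \<circ> r)" using r h(1) by (metis continuous_on_subset path_continuous_image)
    show "path_image (?h \<circ> r) \<subseteq> N" using r(2) h(2) by (auto simp: path_image_def)
  qed
  have "\<pi> \<circ> (q +++ (?h \<circ> r)) \<in> \<gamma> \<otimes>\<^bsub>fundamental_group M (\<pi> y0)\<^esub> \<delta>"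
  proof -
    have "homotopic_paths M ((\<pi> \<circ> q) +++ (\<pi> \<circ> r)) (\<pi> \<circ> (q +++ (?h \<circ> r)))"
    proof (rule homotopic_paths_eq)
      have "\<pi> (?k y0) = \<pi> y0" "\<pi> (?h y0) = \<pi> y0" using k(3) h(3) y0 by auto
      then show "path ((\<pi> \<circ> q) +++ (\<pi> \<circ> r))"
        using path_project q r by (intro path_join_imp) (auto simp: pathstart_compose pathfinish_compose)
      show "path_image ((\<pi> \<circ> q) +++ (\<pi> \<circ> r)) \<subseteq> M"
        using path_project q r by (intro subset_path_image_join) auto
      fix t :: real assume t: "t \<in> {0..1}"
      then have "r (2 * t - 1) \<in> N" if "\<not> t * 2 \<le> 1"
        using that r(2) unfolding path_image_def by force
      then show "((\<pi> \<circ> q) +++ (\<pi> \<circ> r)) t = (\<pi> \<circ> (q +++ (?h \<circ> r))) t"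
        using h(3) by (auto simp: joinpaths_def)
    qed
    then show ?thesis
      using q(5) r(5) by (auto simp: fundamental_group_def)
  qed
  moreover have "\<gamma> \<otimes>\<^bsub>fundamental_group M (\<pi> y0)\<^esub> \<delta> \<in> carrier (fundamental_group M (\<pi> y0))"
    using \<gamma> \<delta> group_fundamental_group[of "\<pi> y0" M] y0 \<pi>_image by (auto intro: monoid.m_closed group.is_monoid)
  ultimately have "deck N \<pi> y0 (\<gamma> \<otimes>\<^bsub>fundamental_group M (\<pi> y0)\<^esub> \<delta>) = restrict (?h \<circ> ?k) N"
  proof (intro deck_eqI[where q = "q +++ (?h \<circ> r)"])
    show "restrict (?h \<circ> ?k) N \<in> deck_transformations N \<pi>"
      by (intro deck_transformation_comp deck_spec y0 \<gamma> \<delta>)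
  qed (use q r hr y0 in \<open>auto simp: pathstart_compose pathfinish_compose subset_path_image_join\<close>)
  then show ?thesis using x by simp
qed

lemma deck_one:
  assumes y0: "y0 \<in> N" and x: "x \<in> N"
  shows "deck N \<pi> y0 \<one>\<^bsub>fundamental_group M (\<pi> y0)\<^esub> x = x"
proof -
  have *: "\<one>\<^bsub>fundamental_group M (\<pi> y0)\<^esub> \<in> carrier (fundamental_group M (\<pi> y0))"
    using group_fundamental_group[of "\<pi> y0" M] y0 \<pi>_image by (auto intro: monoid.one_closed group.is_monoid)
  have "homeomorphism N N (restrict (\<lambda>x. x) N) (\<lambda>x. x)"
    by (rule homeomorphism_cong[OF homeomorphism_ident]) auto
  then have "restrict (\<lambda>x. x) N \<in> deck_transformations N \<pi>"
    by (auto simp: deck_transformations_def)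
  then have "deck N \<pi> y0 \<one>\<^bsub>fundamental_group M (\<pi> y0)\<^esub> = restrict (\<lambda>x. x) N"
    using y0 \<pi>_image
    by (intro deck_eqI[OF _ *, where q = "\<lambda>_. y0"])
      (auto simp: path_const path_image_def pathstart_def pathfinish_def fundamental_group_one o_def)
  then show ?thesis using x by simp
qed

end

section \<open>Calculus of smooth functions\<close>

text \<open>On a fat set the derivatives within the set are unique.\<close>

definition fat :: "'e::real_normed_vector set \<Rightarrow> bool" where
  "fat S \<longleftrightarrow> (\<forall>x\<in>S. \<forall>v. \<forall>e>0. \<exists>d. 0 < \<bar>d\<bar> \<and> \<bar>d\<bar> < e \<and> x + d *\<^sub>R v \<in> S)"

lemma fat_Int_open:
  assumes "fat S" "open G" shows "fat (S \<inter> G)"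
  unfolding fat_def
proof (intro ballI allI impI)
  fix x v :: 'a and e :: real assume x: "x \<in> S \<inter> G" and e: "e > 0"
  obtain r where r: "r > 0" "ball x r \<subseteq> G" using assms(2) x openE by blast
  define e' where "e' = min e (r / (norm v + 1))"
  have "e' > 0" using e r by (simp add: e'_def add_nonneg_pos)
  then obtain d where d: "0 < \<bar>d\<bar>" "\<bar>d\<bar> < e'" "x + d *\<^sub>R v \<in> S"
    using assms(1) x unfolding fat_def by blast
  have "norm (d *\<^sub>R v) \<le> \<bar>d\<bar> * (norm v + 1)" by (simp add: mult_left_mono)
  also have "\<dots> < r" using d(2) by (simp add: e'_def pos_less_divide_eq add_nonneg_pos)
  finally have "x + d *\<^sub>R v \<in> G" using r(2) by (auto simp: dist_norm subset_iff)
  then show "\<exists>d. 0 < \<bar>d\<bar> \<and> \<bar>d\<bar> < e \<and> x + d *\<^sub>R v \<in> S \<inter> G"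
    using d by (auto simp: e'_def)
qed

lemma fat_UNIV [simp]: "fat UNIV"
  unfolding fat_def by (metis UNIV_I abs_of_pos dense)

lemma fat_open: "open S \<Longrightarrow> fat S"
  using fat_Int_open[OF fat_UNIV] by auto

text \<open>The sign of \<open>d\<close> in \<open>fat\<close> is free, so at an end point one can
  always step inwards.\<close>

lemma fat_unit_interval: "fat {0..1::real}"
  unfolding fat_def
proof (intro ballI allI impI)
  fix x v e :: real assume x: "x \<in> {0..1}" and e: "e > 0"
  \<comment> \<open>The second bound gives \<open>d * \<bar>v\<bar> \<le> 1 / 2\<close>, so at least
    one of the steps \<open>d * v\<close> and \<open>(- d) * v\<close> stays in the unit
    interval.\<close>
  define d where "d = min (e / 2) (1 / (2 * \<bar>v\<bar> + 2))"
  have d: "d > 0" "d < e" using e by (auto simp: d_def min_def)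
  have "d * \<bar>v\<bar> \<le> 1 / (2 * \<bar>v\<bar> + 2) * \<bar>v\<bar>" by (intro mult_right_mono) (auto simp: d_def)
  also have "\<dots> \<le> 1 / 2" by (simp add: field_simps)
  finally have "\<bar>d * v\<bar> \<le> 1 / 2" using d by (simp add: abs_mult)
  then have "x + d * v \<in> {0..1} \<or> x + (- d) * v \<in> {0..1}" using x by (auto simp: abs_le_iff)
  then show "\<exists>d. 0 < \<bar>d\<bar> \<and> \<bar>d\<bar> < e \<and> x + d *\<^sub>R v \<in> {0..1}"
    using d by (metis abs_minus_cancel abs_of_pos real_scaleR_def)
qed

lemma fat_openin_unit_interval: "openin (top_of_set {0..1::real}) S \<Longrightarrow> fat S"
  using fat_Int_open[OF fat_unit_interval] by (auto simp: openin_open)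

text \<open>The difference \<open>L\<close> of the two derivatives is a derivative of the zero
  function. Fatness supplies arbitrarily short multiples of \<open>v\<close> leading into
  \<open>S\<close>, and by homogeneity their length cancels in the estimate for
  \<open>L\<close>.\<close>

lemma fat_has_derivative_unique:
  assumes S: "fat S" "x \<in> S" and D: "(f has_derivative D) (at x within S)" "(f has_derivative D') (at x within S)"
  shows "D = D'"
proof
  fix v
  show "D v = D' v"
  proof (rule ccontr)
    assume ne: "D v \<noteq> D' v"
    define L where "L = (\<lambda>h. D h - D' h)"
    have "((\<lambda>y. f y - f y) has_derivative L) (at x within S)"
      unfolding L_def by (intro has_derivative_diff D)
    then have L: "bounded_linear L" "\<And>e. e > 0 \<Longrightarrow> \<exists>d>0. \<forall>y\<in>S. norm (y - x) < d \<longrightarrow> norm (L (y - x)) \<le> e * norm (y - x)"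
      by (auto simp: has_derivative_within_alt)
    \<comment> \<open>Chosen so that \<open>e * norm v\<close> is at most half of
      \<open>norm (L v)\<close>; the \<open>+ 1\<close> keeps the denominator positive.\<close>
    define e where "e = norm (L v) / (2 * (norm v + 1))"
    have Lv: "norm (L v) > 0" using ne by (simp add: L_def)
    then have "e > 0" by (simp add: e_def add_nonneg_pos)
    then obtain d where d: "d > 0" "\<And>y. y \<in> S \<Longrightarrow> norm (y - x) < d \<Longrightarrow> norm (L (y - x)) \<le> e * norm (y - x)"
      using L(2) by blast
    have "d / (norm v + 1) > 0" using d(1) by (simp add: add_nonneg_pos)
    then obtain t where t: "0 < \<bar>t\<bar>" "\<bar>t\<bar> < d / (norm v + 1)" "x + t *\<^sub>R v \<in> S"
      using S unfolding fat_def by blast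
    have "norm (t *\<^sub>R v) \<le> \<bar>t\<bar> * (norm v + 1)" by (simp add: mult_left_mono)
    also have "\<dots> < d" using t(2) by (simp add: pos_less_divide_eq add_nonneg_pos)
    finally have "norm (L (t *\<^sub>R v)) \<le> e * norm (t *\<^sub>R v)" using d(2)[OF t(3)] by simp
    also have "L (t *\<^sub>R v) = t *\<^sub>R L v" using L(1) by (simp add: linear_simps)
    finally have "\<bar>t\<bar> * norm (L v) \<le> \<bar>t\<bar> * (e * norm v)" by (simp add: mult.left_commute)
    then have "norm (L v) \<le> e * norm v" using t(1) by simp
    also have "\<dots> \<le> e * (norm v + 1)" using \<open>e > 0\<close> by simp
    also have "\<dots> = norm (L v) / 2"
      unfolding e_def using add_nonneg_pos[OF norm_ge_zero zero_less_one, of v] by (simp add: field_simps)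
    finally show False using Lv by simp
  qed
qed

lemma frechet_derivative_fat:
  assumes "fat S" "x \<in> S" "(f has_derivative D) (at x within S)"
  shows "frechet_derivative f (at x within S) = D"
proof (rule fat_has_derivative_unique[OF assms(1,2) _ assms(3)])
  show "(f has_derivative frechet_derivative f (at x within S)) (at x within S)"
    using assms(3) frechet_derivative_works differentiable_def by blast
qed

section \<open>Rules for functions of class C^k on fat sets\<close>

text \<open>All derivatives in \<open>Ck_on\<close> are taken within \<open>S\<close>, so values off
  \<open>S\<close> never enter, not even at boundary points.\<close>

lemma Ck_on_cong:
  assumes "\<And>x. x \<in> S \<Longrightarrow> f x = g x"
  shows "Ck_on k S f = Ck_on k S g"
  using assms
proof (induction k arbitrary: f g)
  case 0
  then show ?case by (simp cong: continuous_on_cong)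
next
  case (Suc k)
  have *: "(f has_derivative D) (at x within S) \<longleftrightarrow> (g has_derivative D) (at x within S)" if "x \<in> S" for x D
    using that Suc.prems by (metis has_derivative_transform)
  then have "frechet_derivative f (at x within S) = frechet_derivative g (at x within S)" if "x \<in> S" for x
    using that by (simp add: frechet_derivative_def)
  then have "Ck_on k S (\<lambda>x. frechet_derivative f (at x within S) v)
           = Ck_on k S (\<lambda>x. frechet_derivative g (at x within S) v)" for v
    by (intro Suc.IH) simp
  then show ?case using * by (auto simp: differentiable_on_def differentiable_def)
qed

lemma Ck_on_eq: "Ck_on k S f \<Longrightarrow> (\<And>x. x \<in> S \<Longrightarrow> g x = f x) \<Longrightarrow> Ck_on k S g"
  using Ck_on_cong[of S g f] by simp

text \<open>\<open>frechet_derivative\<close> is a choice, which fatness forces to be the given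
  \<open>D\<close>. Together with the elimination rule below, this lets inductions on
  \<open>k\<close> work with explicit derivatives.\<close>

lemma Ck_on_SucI:
  assumes "fat S" "\<And>x. x \<in> S \<Longrightarrow> (f has_derivative D x) (at x within S)" "\<And>v. Ck_on k S (\<lambda>x. D x v)"
  shows "Ck_on (Suc k) S f"
proof -
  have "Ck_on k S (\<lambda>x. frechet_derivative f (at x within S) v)" for v
    using assms(3)[of v] frechet_derivative_fat[OF assms(1) _ assms(2)] by (simp cong: Ck_on_cong)
  then show ?thesis
    using assms(2) by (auto simp: differentiable_on_def differentiable_def)
qed

lemma Ck_on_SucE:
  assumes "Ck_on (Suc k) S f"
  obtains D where "\<And>x. x \<in> S \<Longrightarrow> (f has_derivative D x) (at x within S)" "\<And>v. Ck_on k S (\<lambda>x. D x v)"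
  using assms by (intro that[of "\<lambda>x. frechet_derivative f (at x within S)"])
    (auto simp: differentiable_on_def frechet_derivative_works)

lemma Ck_on_imp_continuous_on: "Ck_on k S f \<Longrightarrow> continuous_on S f"
  by (cases k) (auto simp: differentiable_imp_continuous_on)

lemma Ck_on_Suc_imp_Ck_on: "Ck_on (Suc k) S f \<Longrightarrow> Ck_on k S f"
proof (induction k arbitrary: f)
  case 0
  then show ?case by (simp add: differentiable_imp_continuous_on)
next
  case (Suc k)
  then show ?case using Ck_on.simps(2) by blast
qed

text \<open>A smaller set could admit further derivatives where it is thin; \<open>fat T\<close>
  excludes that.\<close>

lemma Ck_on_subset:
  assumes "Ck_on k S f" "T \<subseteq> S" "fat T"
  shows "Ck_on k T f"
  using assms(1)
proof (induction k arbitrary: f)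
  case 0
  then show ?case using assms(2) continuous_on_subset by auto
next
  case (Suc k)
  obtain D where D: "\<And>x. x \<in> S \<Longrightarrow> (f has_derivative D x) (at x within S)" "\<And>v. Ck_on k S (\<lambda>x. D x v)"
    using Suc.prems by (rule Ck_on_SucE) auto
  have "(f has_derivative D x) (at x within T)" if "x \<in> T" for x
    using has_derivative_subset[OF D(1) assms(2)] that assms(2) by blast
  then show ?case using Suc.IH D(2)
    by (intro Ck_on_SucI[OF assms(3), of _ D]) auto
qed

lemma Ck_on_local:
  assumes "\<And>x. x \<in> S \<Longrightarrow> \<exists>G. open G \<and> x \<in> G \<and> Ck_on k (S \<inter> G) f"
  shows "Ck_on k S f"
  using assms
proof (induction k arbitrary: f)
  case 0
  show ?case
    unfolding Ck_on.simps
  proof (rule continuous_on_openin_cover)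
    fix x assume "x \<in> S"
    with 0[OF this] obtain G where "open G" "x \<in> G" "Ck_on 0 (S \<inter> G) f" by blast
    then show "\<exists>V. openin (top_of_set S) V \<and> x \<in> V \<and> continuous_on V f"
      using \<open>x \<in> S\<close> by (intro exI[of _ "S \<inter> G"]) auto
  qed
next
  case (Suc k)
  have at: "at x within S = at x within (S \<inter> G)" if "open G" "x \<in> G" for x G
    using that by (intro at_within_nhd[of x G]) auto
  have "f differentiable (at x within S)" if x: "x \<in> S" for x
  proof -
    obtain G where G: "open G" "x \<in> G" "Ck_on (Suc k) (S \<inter> G) f" using Suc.prems[OF x] by blast
    then show ?thesis using x by (simp add: at[OF G(1,2)] differentiable_on_def)
  qed
  moreover have "Ck_on k S (\<lambda>x. frechet_derivative f (at x within S) v)" for v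
  proof (rule Suc.IH)
    fix x assume "x \<in> S"
    from Suc.prems[OF this] obtain G where G: "open G" "x \<in> G" "Ck_on (Suc k) (S \<inter> G) f" by blast
    then have "Ck_on k (S \<inter> G) (\<lambda>x. frechet_derivative f (at x within S \<inter> G) v)" by simp
    also have "?this = Ck_on k (S \<inter> G) (\<lambda>x. frechet_derivative f (at x within S) v)"
      using G(1) at by (intro Ck_on_cong) auto
    finally show "\<exists>G. open G \<and> x \<in> G \<and> Ck_on k (S \<inter> G) (\<lambda>x. frechet_derivative f (at x within S) v)"
      using G by blast
  qed
  ultimately show ?case by (simp add: differentiable_on_def)
qed

lemma Ck_on_const: "fat S \<Longrightarrow> Ck_on k S (\<lambda>_. c)"
proof (induction k arbitrary: c)
  case (Suc k)
  then show ?case by (intro Ck_on_SucI[where D = "\<lambda>_ _. 0"]) auto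
qed auto

lemma Ck_on_add: "fat S \<Longrightarrow> Ck_on k S f \<Longrightarrow> Ck_on k S g \<Longrightarrow> Ck_on k S (\<lambda>x. f x + g x)"
proof (induction k arbitrary: f g)
  case 0
  then show ?case by (simp add: continuous_on_add)
next
  case (Suc k)
  obtain D where D: "\<And>x. x \<in> S \<Longrightarrow> (f has_derivative D x) (at x within S)" "\<And>v. Ck_on k S (\<lambda>x. D x v)"
    using Suc.prems(2) by (rule Ck_on_SucE) auto
  obtain D' where D': "\<And>x. x \<in> S \<Longrightarrow> (g has_derivative D' x) (at x within S)" "\<And>v. Ck_on k S (\<lambda>x. D' x v)"
    using Suc.prems(3) by (rule Ck_on_SucE) auto
  show ?case
    using Suc.IH[OF Suc.prems(1) D(2) D'(2)] D(1) D'(1)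
    by (intro Ck_on_SucI[where D = "\<lambda>x v. D x v + D' x v"] Suc.prems has_derivative_add) auto
qed

lemma Ck_on_sum:
  assumes "fat S" "\<And>i. i \<in> I \<Longrightarrow> Ck_on k S (f i)"
  shows "Ck_on k S (\<lambda>x. \<Sum>i\<in>I. f i x)"
  using assms(2) by (induction I rule: infinite_finite_induct) (auto intro: Ck_on_add Ck_on_const assms(1))

lemma Ck_on_bounded_linear_comp:
  assumes "bounded_linear L" "fat S" "Ck_on k S f"
  shows "Ck_on k S (\<lambda>x. L (f x))"
  using assms(3)
proof (induction k arbitrary: f)
  case 0
  then show ?case using assms(1) by (simp add: bounded_linear.continuous_on)
next
  case (Suc k)
  obtain D where D: "\<And>x. x \<in> S \<Longrightarrow> (f has_derivative D x) (at x within S)" "\<And>v. Ck_on k S (\<lambda>x. D x v)"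
    using Suc.prems by (rule Ck_on_SucE) auto
  then show ?case
    using Suc.IH[OF D(2)]
    by (intro Ck_on_SucI[where D = "\<lambda>x v. L (D x v)"] assms(2) bounded_linear.has_derivative[OF assms(1)]) auto
qed

lemma Ck_on_id: "fat S \<Longrightarrow> Ck_on k S (\<lambda>x. x)"
proof (cases k)
  case (Suc j)
  assume "fat S"
  then show ?thesis unfolding Suc by (intro Ck_on_SucI[where D = "\<lambda>_ v. v"] Ck_on_const) auto
qed auto

lemma Ck_on_bounded_linear: "bounded_linear L \<Longrightarrow> fat S \<Longrightarrow> Ck_on k S L"
  by (rule Ck_on_bounded_linear_comp[OF _ _ Ck_on_id])

lemma Ck_on_bilinear:
  assumes p: "bounded_bilinear p" and S: "fat S" and "Ck_on k S f" "Ck_on k S g"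
  shows "Ck_on k S (\<lambda>x. p (f x) (g x))"
  using assms(3,4)
proof (induction k arbitrary: f g)
  case 0
  then show ?case using p by (simp add: bounded_bilinear.continuous_on)
next
  case (Suc k)
  obtain D where D: "\<And>x. x \<in> S \<Longrightarrow> (f has_derivative D x) (at x within S)" "\<And>v. Ck_on k S (\<lambda>x. D x v)"
    using Suc.prems(1) by (rule Ck_on_SucE) auto
  obtain D' where D': "\<And>x. x \<in> S \<Longrightarrow> (g has_derivative D' x) (at x within S)" "\<And>v. Ck_on k S (\<lambda>x. D' x v)"
    using Suc.prems(2) by (rule Ck_on_SucE) auto
  note fg = Suc.prems[THEN Ck_on_Suc_imp_Ck_on]
  show ?case
  proof (rule Ck_on_SucI[OF S])
    show "((\<lambda>x. p (f x) (g x)) has_derivative (\<lambda>v. p (f x) (D' x v) + p (D x v) (g x))) (at x within S)" if "x \<in> S" for x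
      using that D(1) D'(1) by (intro bounded_bilinear.FDERIV[OF p])
    show "Ck_on k S (\<lambda>x. p (f x) (D' x v) + p (D x v) (g x))" for v
      by (intro Ck_on_add S Suc.IH fg D D')
  qed
qed

lemmas Ck_on_mult = Ck_on_bilinear[OF bounded_bilinear_mult]
lemmas Ck_on_scaleR = Ck_on_bilinear[OF bounded_bilinear_scaleR]

section \<open>Coordinates on finite-dimensional normed spaces\<close>

text \<open>A finite spanning set with bounded coordinate functionals stands in for the Euclidean
  basis; dimension 0 is the case of empty \<open>E\<close>.\<close>

locale coordinates =
  fixes E :: "'e::banach set" and coord :: "'e \<Rightarrow> 'e \<Rightarrow> real"
  assumes finite_E: "finite E" and coord: "\<And>b. b \<in> E \<Longrightarrow> bounded_linear (coord b)"
    and coord_sum: "\<And>x. (\<Sum>b\<in>E. coord b x *\<^sub>R b) = x"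
begin

lemma linear_coord_sum:
  assumes "linear L" shows "L x = (\<Sum>b\<in>E. coord b x *\<^sub>R L b)"
proof -
  have "L x = L (\<Sum>b\<in>E. coord b x *\<^sub>R b)" by (simp add: coord_sum)
  then show ?thesis using assms by (simp add: linear_sum linear_cmul)
qed

text \<open>In the chain rule both the point and the direction of \<open>D' (f x) (D x v)\<close>
  vary with \<open>x\<close>, whereas \<open>Ck_on\<close> controls \<open>D'\<close> in fixed
  directions only. Expanding \<open>D x v\<close> in coordinates leaves the fixed directions
  \<open>b\<close> with scalar coefficients, to which the induction hypothesis and the product rule
  apply.\<close>

lemma Ck_on_comp:
  fixes f :: "'d::real_normed_vector \<Rightarrow> 'e" and g :: "'e \<Rightarrow> 'f::real_normed_vector"
  assumes S: "fat S" and "Ck_on k S f" "Ck_on k T g" "f ` S \<subseteq> T"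
  shows "Ck_on k S (\<lambda>x. g (f x))"
  using assms(2,3)
proof (induction k arbitrary: g)
  case 0
  then show ?case using assms(4) continuous_on_compose2 by auto
next
  case (Suc k)
  obtain D where D: "\<And>x. x \<in> S \<Longrightarrow> (f has_derivative D x) (at x within S)" "\<And>v. Ck_on k S (\<lambda>x. D x v)"
    using Suc.prems(1) by (rule Ck_on_SucE) auto
  obtain D' where D': "\<And>x. x \<in> T \<Longrightarrow> (g has_derivative D' x) (at x within T)" "\<And>v. Ck_on k T (\<lambda>x. D' x v)"
    using Suc.prems(2) by (rule Ck_on_SucE) auto
  show ?case
  proof (rule Ck_on_SucI[OF S])
    fix x assume x: "x \<in> S"
    have "(g has_derivative D' (f x)) (at (f x) within f ` S)"
      using D'(1)[of "f x"] assms(4) x by (auto intro: has_derivative_subset)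
    then have "((\<lambda>x. g (f x)) has_derivative (\<lambda>v. D' (f x) (D x v))) (at x within S)"
      using has_derivative_in_compose[OF D(1)[OF x]] by blast
    moreover have "D' (f x) (D x v) = (\<Sum>b\<in>E. coord b (D x v) *\<^sub>R D' (f x) b)" for v
      using D'(1)[of "f x"] assms(4) x by (intro linear_coord_sum) (auto intro: has_derivative_linear)
    ultimately show "((\<lambda>x. g (f x)) has_derivative (\<lambda>v. \<Sum>b\<in>E. coord b (D x v) *\<^sub>R D' (f x) b)) (at x within S)"
      by simp
  next
    fix v
    show "Ck_on k S (\<lambda>x. \<Sum>b\<in>E. coord b (D x v) *\<^sub>R D' (f x) b)"
      by (intro Ck_on_sum S Ck_on_scaleR Ck_on_bounded_linear_comp[OF coord] D Suc.IH D' Ck_on_Suc_imp_Ck_on[OF Suc.prems(1)])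
  qed
qed

text \<open>The varying direction \<open>h x\<close> is expanded in coordinates, as in the chain
  rule.\<close>

lemma Ck_on_linear_form:
  fixes w :: "'e \<Rightarrow> 'e \<Rightarrow> 'f::real_normed_vector" and f h :: "'d::real_normed_vector \<Rightarrow> 'e"
  assumes S: "fat S" and w: "\<And>x. x \<in> T \<Longrightarrow> linear (w x)" "\<And>v. Ck_on k T (\<lambda>x. w x v)"
    and f: "Ck_on k S f" "f ` S \<subseteq> T" and h: "Ck_on k S h"
  shows "Ck_on k S (\<lambda>x. w (f x) (h x))"
proof -
  have "Ck_on k S (\<lambda>x. \<Sum>b\<in>E. coord b (h x) *\<^sub>R w (f x) b)"
    by (intro Ck_on_sum S Ck_on_scaleR Ck_on_bounded_linear_comp[OF coord] h Ck_on_comp[OF S f(1) w(2) f(2)])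
  also have "?this = Ck_on k S (\<lambda>x. w (f x) (h x))"
    using f(2) by (intro Ck_on_cong linear_coord_sum[symmetric] w(1)) auto
  finally show ?thesis .
qed

text \<open>Differentiating \<open>f (u *\<^sub>R v)\<close> in \<open>v\<close> produces one more
  factor \<open>u\<close>. The weight \<open>u ^ m\<close> absorbs it, so that each directional
  derivative is an integral of the same kind with exponent \<open>Suc m\<close>.\<close>

lemma Ck_on_radial_integral:
  fixes f :: "'e \<Rightarrow> 'f::banach"
  assumes "Ck_on k (ball 0 r) f"
  shows "Ck_on k (ball 0 r) (\<lambda>v. integral {0..1} (\<lambda>u. u ^ m *\<^sub>R f (u *\<^sub>R v)))"
  using assms
proof (induction k arbitrary: f m)
  have in_ball: "u *\<^sub>R v \<in> ball 0 r" if "v \<in> ball 0 r" "u \<in> {0..1}" for u and v :: 'e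
  proof -
    have "u * norm v \<le> 1 * norm v" using that by (intro mult_right_mono) auto
    then show ?thesis using that by simp
  qed
  have cont: "continuous_on (ball 0 r \<times> cbox 0 1) (\<lambda>(v, u). u ^ m *\<^sub>R f (u *\<^sub>R v))"
    if "continuous_on (ball 0 r) f" for f :: "'e \<Rightarrow> 'f" and m
    unfolding split_beta using in_ball
    by (intro continuous_intros continuous_on_compose2[OF that]) (auto simp: cbox_interval)
  {
    case 0
    then show ?case using integral_continuous_on_param[OF cont] by (simp add: cbox_interval)
  next
    case (Suc k)
    obtain D where D: "\<And>x. x \<in> ball 0 r \<Longrightarrow> (f has_derivative D x) (at x within ball 0 r)"
      "\<And>v. Ck_on k (ball 0 r) (\<lambda>x. D x v)"
      using Suc.prems by (rule Ck_on_SucE) auto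
    define K where "K b = Blinfun (coord b)" for b
    have K: "blinfun_apply (K b) = coord b" if "b \<in> E" for b
      unfolding K_def by (rule bounded_linear_Blinfun_apply[OF coord[OF that]])
    \<comment> \<open>The Leibniz rule takes the derivative as a continuous family of bounded linear
      maps. Assembling it from coordinates reduces its continuity to that of the derivatives in the
      directions \<open>b\<close>.\<close>
    define F where "F v u = (\<Sum>b\<in>E. blinfun_scaleR_left (u ^ Suc m *\<^sub>R D (u *\<^sub>R v) b) o\<^sub>L K b)" for v u
    have F: "blinfun_apply (F v u) w = u ^ Suc m *\<^sub>R D (u *\<^sub>R v) w" if "v \<in> ball 0 r" "u \<in> {0..1}" for v u w
    proof -
      have "linear (D (u *\<^sub>R v))" using D(1)[OF in_ball[OF that]] by (rule has_derivative_linear)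
      then have "D (u *\<^sub>R v) w = (\<Sum>b\<in>E. coord b w *\<^sub>R D (u *\<^sub>R v) b)" by (rule linear_coord_sum)
      moreover have "blinfun_apply (F v u) w = (\<Sum>b\<in>E. coord b w *\<^sub>R u ^ Suc m *\<^sub>R D (u *\<^sub>R v) b)"
        unfolding F_def by (simp add: blinfun.sum_left K cong: sum.cong)
      ultimately show ?thesis by (simp add: scaleR_sum_right mult.commute mult.left_commute)
    qed
    have contF: "continuous_on (ball 0 r \<times> cbox 0 1) (\<lambda>(v, u). F v u)"
    proof -
      have c: "continuous_on (ball 0 r \<times> cbox 0 1) (\<lambda>z. snd z ^ Suc m *\<^sub>R D (snd z *\<^sub>R fst z) b)" for b
        using cont[OF Ck_on_imp_continuous_on[OF D(2)], of "Suc m" b] by (simp add: split_beta)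
      show ?thesis
        unfolding F_def split_beta
        by (intro continuous_on_sum bounded_bilinear.continuous_on[OF bounded_bilinear_blinfun_compose]
            bounded_linear.continuous_on[OF bounded_linear_blinfun_scaleR_left] c continuous_on_const)
    qed
    have int: "(\<lambda>u. u ^ m *\<^sub>R f (u *\<^sub>R v)) integrable_on cbox 0 1" if "v \<in> ball 0 r" for v
    proof (rule integrable_continuous)
      show "continuous_on (cbox 0 1) (\<lambda>u. u ^ m *\<^sub>R f (u *\<^sub>R v))"
        using that by (intro continuous_on_compose2[OF cont[OF Ck_on_imp_continuous_on[OF Suc.prems]], of _ "\<lambda>u. (v, u)" m, simplified])
          (auto intro!: continuous_intros)
    qed
    have intF: "F v integrable_on cbox 0 1" if "v \<in> ball 0 r" for v
    proof (rule integrable_continuous)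
      show "continuous_on (cbox 0 1) (F v)"
        using that by (intro continuous_on_compose2[OF contF, of _ "\<lambda>u. (v, u)", simplified])
          (auto intro!: continuous_intros)
    qed
    have deriv: "((\<lambda>v. integral (cbox 0 1) (\<lambda>u. u ^ m *\<^sub>R f (u *\<^sub>R v))) has_derivative
        blinfun_apply (integral (cbox 0 1) (F v))) (at v within ball 0 r)" if v: "v \<in> ball 0 r" for v
    proof (rule leibniz_rule[where fx = F and U = "ball 0 r"])
      fix x :: 'e and u assume x: "x \<in> ball 0 r" and u: "u \<in> cbox 0 (1::real)"
      then have u': "u \<in> {0..1}" by simp
      have "(f has_derivative D (u *\<^sub>R x)) (at (u *\<^sub>R x) within (\<lambda>x. u *\<^sub>R x) ` ball 0 r)"
        using D(1)[OF in_ball[OF x u']] in_ball u' by (auto intro: has_derivative_subset)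
      from has_derivative_in_compose[OF has_derivative_scaleR_right[OF has_derivative_ident] this]
      have "((\<lambda>x. f (u *\<^sub>R x)) has_derivative (\<lambda>w. D (u *\<^sub>R x) (u *\<^sub>R w))) (at x within ball 0 r)" .
      then have "((\<lambda>x. u ^ m *\<^sub>R f (u *\<^sub>R x)) has_derivative (\<lambda>w. u ^ m *\<^sub>R D (u *\<^sub>R x) (u *\<^sub>R w))) (at x within ball 0 r)"
        by (intro has_derivative_scaleR_right)
      moreover have "D (u *\<^sub>R x) (u *\<^sub>R w) = u *\<^sub>R D (u *\<^sub>R x) w" for w
        using has_derivative_linear[OF D(1)[OF in_ball[OF x u']]] by (simp add: linear_cmul)
      moreover have "blinfun_apply (F x u) = (\<lambda>w. u ^ m *\<^sub>R u *\<^sub>R D (u *\<^sub>R x) w)"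
        using F[OF x u'] by (simp add: fun_eq_iff mult.commute)
      ultimately show "((\<lambda>x. u ^ m *\<^sub>R f (u *\<^sub>R x)) has_derivative blinfun_apply (F x u)) (at x within ball 0 r)"
        by simp
    qed (use int contF v in auto)
    show ?case
    proof (rule Ck_on_SucI[OF fat_open[OF open_ball]])
      show "((\<lambda>v. integral {0..1} (\<lambda>u. u ^ m *\<^sub>R f (u *\<^sub>R v))) has_derivative
          blinfun_apply (integral (cbox 0 1) (F v))) (at v within ball 0 r)" if "v \<in> ball 0 r" for v
        using deriv[OF that] by (simp add: cbox_interval)
      show "Ck_on k (ball 0 r) (\<lambda>v. blinfun_apply (integral (cbox 0 1) (F v)) w)" for w
      proof -
        have "blinfun_apply (integral (cbox 0 1) (F v)) w = integral {0..1} (\<lambda>u. u ^ Suc m *\<^sub>R D (u *\<^sub>R v) w)"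
          if "v \<in> ball 0 r" for v
        proof -
          have "blinfun_apply (integral (cbox 0 1) (F v)) w = integral (cbox 0 1) (\<lambda>u. blinfun_apply (F v u) w)"
            by (rule blinfun_apply_integral[OF intF[OF that]])
          also have "\<dots> = integral {0..1} (\<lambda>u. u ^ Suc m *\<^sub>R D (u *\<^sub>R v) w)"
            unfolding cbox_interval using F[OF that] by (intro integral_cong) auto
          finally show ?thesis .
        qed
        then show ?thesis by (rule Ck_on_eq[OF Suc.IH[OF D(2), of "Suc m" w]])
      qed
    qed
  }
qed

end

lemma coordinates_real: "coordinates {1::real} (\<lambda>_ x. x)"
  by (rule coordinates.intro) (auto simp: bounded_linear_ident)

lemmas Ck_on_comp_real = coordinates.Ck_on_comp[OF coordinates_real]

text \<open>A form of the equivalence of norms in finite dimensions. In the induction step, the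
  bound for \<open>B\<close> shows that the new vector \<open>b\<close> has positive distance from
  \<open>span B\<close>, and this distance controls its coefficient.\<close>

lemma finite_independent_bound:
  fixes B :: "'e::real_normed_vector set"
  assumes "finite B" "independent B"
  shows "\<exists>K\<ge>0. \<forall>u. (\<Sum>b\<in>B. \<bar>u b\<bar>) \<le> K * norm (\<Sum>b\<in>B. u b *\<^sub>R b)"
  using assms
proof (induction B rule: finite_induct)
  case empty
  then show ?case by auto
next
  case (insert b B)
  have ind: "independent B" "b \<notin> span B"
    using insert by (auto simp: independent_insert)
  obtain K where K: "K \<ge> 0" "\<And>u. (\<Sum>b\<in>B. \<bar>u b\<bar>) \<le> K * norm (\<Sum>b\<in>B. u b *\<^sub>R b)"
    using insert.IH[OF ind(1)] by blast
  \<comment> \<open>Otherwise elements \<open>y n\<close> of the span converge to \<open>b\<close>;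
    by the bound for \<open>B\<close> their coefficients form Cauchy sequences, so the limit
    \<open>b\<close> would lie in the span.\<close>
  have "\<exists>d>0. \<forall>y\<in>span B. d \<le> norm (b - y)"
  proof (rule ccontr)
    assume "\<not> ?thesis"
    then have "\<forall>n. \<exists>y\<in>span B. norm (b - y) < inverse (real (Suc n))"
      by (metis inverse_positive_iff_positive not_le of_nat_0_less_iff zero_less_Suc)
    then obtain y where y: "\<And>n. y n \<in> span B" "\<And>n. norm (b - y n) < inverse (real (Suc n))"
      by metis
    have "\<forall>n. \<exists>u. y n = (\<Sum>a\<in>B. u a *\<^sub>R a)"
      using y(1) insert.hyps(1) by (auto simp: span_finite)
    then obtain u where u: "\<And>n. y n = (\<Sum>a\<in>B. u n a *\<^sub>R a)" by metis
    have lim: "y \<longlonglongrightarrow> b"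
    proof (rule LIM_zero_cancel, rule Lim_null_comparison)
      show "\<forall>\<^sub>F n in sequentially. norm (y n - b) \<le> inverse (real (Suc n))"
        using y(2) by (auto simp: norm_minus_commute less_imp_le)
      show "(\<lambda>n. inverse (real (Suc n))) \<longlonglongrightarrow> 0" by (rule LIMSEQ_inverse_real_of_nat)
    qed
    have conv: "convergent (\<lambda>n. u n a)" if a: "a \<in> B" for a
    proof (rule Cauchy_convergent, rule metric_CauchyI)
      fix e :: real assume e: "e > 0"
      have "Cauchy y" using lim by (rule LIMSEQ_imp_Cauchy)
      moreover have "e / (K + 1) > 0" using e K(1) by simp
      ultimately obtain n0 where n0: "\<And>m n. m \<ge> n0 \<Longrightarrow> n \<ge> n0 \<Longrightarrow> dist (y m) (y n) < e / (K + 1)"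
        using metric_CauchyD by metis
      have "dist (u m a) (u n a) < e" if "m \<ge> n0" "n \<ge> n0" for m n
      proof -
        have "\<bar>u m a - u n a\<bar> \<le> (\<Sum>a\<in>B. \<bar>u m a - u n a\<bar>)"
          using a insert.hyps(1) by (intro member_le_sum) auto
        also have "\<dots> \<le> K * norm (\<Sum>a\<in>B. (u m a - u n a) *\<^sub>R a)" by (rule K(2))
        also have "(\<Sum>a\<in>B. (u m a - u n a) *\<^sub>R a) = y m - y n"
          by (simp add: u scaleR_diff_left sum_subtractf)
        also have "K * norm (y m - y n) \<le> K * (e / (K + 1))"
          using n0[OF that] K(1) by (intro mult_left_mono) (auto simp: dist_norm)
        also have "\<dots> < e" using e K(1) by (simp add: field_simps)
        finally show ?thesis by (simp add: dist_real_def)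
      qed
      then show "\<exists>M. \<forall>m\<ge>M. \<forall>n\<ge>M. dist (u m a) (u n a) < e" by blast
    qed
    then have "(\<lambda>n. \<Sum>a\<in>B. u n a *\<^sub>R a) \<longlonglongrightarrow> (\<Sum>a\<in>B. lim (\<lambda>n. u n a) *\<^sub>R a)"
      by (intro tendsto_sum tendsto_scaleR tendsto_const) (simp add: convergent_LIMSEQ_iff)
    then have "y \<longlonglongrightarrow> (\<Sum>a\<in>B. lim (\<lambda>n. u n a) *\<^sub>R a)" by (simp add: u[symmetric])
    then have "b = (\<Sum>a\<in>B. lim (\<lambda>n. u n a) *\<^sub>R a)" using lim LIMSEQ_unique by blast
    moreover have "(\<Sum>a\<in>B. lim (\<lambda>n. u n a) *\<^sub>R a) \<in> span B"
      by (intro span_sum span_scale span_base)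
    ultimately show False using ind(2) by simp
  qed
  then obtain d where d: "d > 0" "\<And>y. y \<in> span B \<Longrightarrow> d \<le> norm (b - y)" by blast
  \<comment> \<open>\<open>1 / d\<close> bounds the coefficient of \<open>b\<close>. Subtracting
    that multiple of \<open>b\<close> costs the factor \<open>1 + norm b / d\<close> before the
    bound \<open>K\<close> for \<open>B\<close> applies.\<close>
  define K' where "K' = 1 / d + K * (1 + norm b / d)"
  have "(\<Sum>a\<in>insert b B. \<bar>u a\<bar>) \<le> K' * norm (\<Sum>a\<in>insert b B. u a *\<^sub>R a)" for u
  proof -
    define y where "y = (\<Sum>a\<in>B. u a *\<^sub>R a)"
    define x where "x = u b *\<^sub>R b + y"
    have y: "y \<in> span B" unfolding y_def by (intro span_sum span_scale span_base)
    have 1: "\<bar>u b\<bar> \<le> norm x / d"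
    proof (cases "u b = 0")
      case False
      have "d \<le> norm (b - (- inverse (u b)) *\<^sub>R y)" by (intro d(2) span_scale y)
      then have "\<bar>u b\<bar> * d \<le> \<bar>u b\<bar> * norm (b - (- inverse (u b)) *\<^sub>R y)" by (intro mult_left_mono) auto
      also have "\<dots> = norm (u b *\<^sub>R (b - (- inverse (u b)) *\<^sub>R y))" by simp
      also have "u b *\<^sub>R (b - (- inverse (u b)) *\<^sub>R y) = x"
        using False by (simp add: x_def scaleR_right_distrib)
      finally show ?thesis using d(1) by (simp add: field_simps)
    qed (use d in auto)
    have "norm y \<le> norm x + \<bar>u b\<bar> * norm b"
      using norm_triangle_ineq4[of x "u b *\<^sub>R b"] by (simp add: x_def)
    also have "\<dots> \<le> norm x + norm x / d * norm b" using 1 by (intro add_left_mono mult_right_mono) auto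
    also have "\<dots> = (1 + norm b / d) * norm x" by (simp add: field_simps)
    finally have "(\<Sum>a\<in>B. \<bar>u a\<bar>) \<le> K * ((1 + norm b / d) * norm x)"
      using K(2)[of u] K(1) mult_left_mono unfolding y_def by (meson order_trans)
    then show ?thesis
      using 1 insert.hyps by (simp add: K'_def x_def y_def algebra_simps)
  qed
  moreover have "K' \<ge> 0" using K(1) d(1) by (simp add: K'_def)
  ultimately show ?case by blast
qed

lemma finite_span_coordinates:
  fixes X :: "'e::banach set"
  assumes "finite X" "span X = UNIV"
  obtains E coord where "coordinates E (coord :: 'e \<Rightarrow> 'e \<Rightarrow> real)"
proof -
  obtain E where E: "E \<subseteq> X" "independent E" "X \<subseteq> span E"
    using maximal_independent_subset by blast
  have fin: "finite E" using E(1) assms(1) finite_subset by blast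
  have span: "span E = UNIV"
    using span_mono[OF E(3)] assms(2) by (auto simp: span_span)
  obtain K where K: "K \<ge> 0" "\<And>u. (\<Sum>b\<in>E. \<bar>u b\<bar>) \<le> K * norm (\<Sum>b\<in>E. u b *\<^sub>R b)"
    using finite_independent_bound[OF fin E(2)] by blast
  define coord where "coord b x = representation E x b" for b x
  have s: "(\<Sum>b\<in>E. coord b x *\<^sub>R b) = x" for x
    unfolding coord_def using E(2) span fin by (intro real_vector.sum_representation_eq) auto
  have "coordinates E coord"
  proof (rule coordinates.intro)
    fix b assume b: "b \<in> E"
    show "bounded_linear (coord b)"
    proof (rule bounded_linear_intro)
      show "coord b (x + y) = coord b x + coord b y" for x y
        unfolding coord_def using E(2) span by (subst real_vector.representation_add) auto
      show "coord b (r *\<^sub>R x) = r *\<^sub>R coord b x" for r x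
        unfolding coord_def using E(2) span by (subst real_vector.representation_scale) auto
      show "norm (coord b x) \<le> norm x * K" for x
      proof -
        have "\<bar>coord b x\<bar> \<le> (\<Sum>b\<in>E. \<bar>coord b x\<bar>)" using b fin by (intro member_le_sum) auto
        also have "\<dots> \<le> K * norm x" using K(2)[of "\<lambda>b. coord b x"] s by simp
        finally show ?thesis by (simp add: mult.commute)
      qed
    qed
  qed (use fin s in auto)
  then show ?thesis by (rule that)
qed

section \<open>A smooth step function\<close>

lemma Ck_on_real_SucI:
  fixes f :: "real \<Rightarrow> real"
  assumes "fat S" "\<And>x. x \<in> S \<Longrightarrow> (f has_real_derivative f' x) (at x within S)" "Ck_on k S f'"
  shows "Ck_on (Suc k) S f"
  using assms
  by (intro Ck_on_SucI[where D = "\<lambda>x v. f' x * v"] Ck_on_mult Ck_on_const) (auto simp: has_field_derivative_def)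

text \<open>For \<open>P = 1\<close> this is the standard flat function exp (-1/x). The polynomial
  factor makes the family closed under differentiation, so one induction on \<open>k\<close> serves
  all members.\<close>

definition flat :: "real poly \<Rightarrow> real \<Rightarrow> real" where
  "flat P x = (if x > 0 then poly P (1 / x) * exp (- (1 / x)) else 0)"

text \<open>The power \<open>t ^ k\<close> is there for the induction: splitting off the constant
  term of the polynomial moves one factor \<open>t\<close> into it.\<close>

lemma poly_exp_tendsto_0: "((\<lambda>t::real. t ^ k * poly P t * exp (- t)) \<longlongrightarrow> 0) at_top"
proof (induction P arbitrary: k)
  case (pCons a P)
  have "((\<lambda>t. a * (t ^ k / exp t) + t ^ Suc k * poly P t * exp (- t)) \<longlongrightarrow> a * 0 + 0) at_top"
    by (intro tendsto_add tendsto_mult_left tendsto_power_div_exp_0 pCons.IH)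
  then show ?case by (simp add: algebra_simps exp_minus divide_inverse)
qed simp

text \<open>In the variable \<open>t = 1 / x\<close>, differentiation in \<open>x\<close> is
  \<open>- t ^ 2\<close> times differentiation in \<open>t\<close>, which replaces \<open>P\<close>
  by \<open>t ^ 2\<close> times \<open>P - pderiv P\<close>; the polynomial
  \<open>[:0, 0, 1:]\<close> is this \<open>t ^ 2\<close>. At 0 the quotient from the right is
  \<open>t\<close> times \<open>poly P t\<close> times exp (-t), with \<open>t\<close> tending to
  infinity.\<close>

lemma flat_has_derivative: "(flat P has_real_derivative flat ([:0, 0, 1:] * (P - pderiv P)) x) (at x)"
proof -
  consider "x > 0" | "x < 0" | "x = 0" by linarith
  then show ?thesis
  proof cases
    case 1
    have "((\<lambda>x. poly P (1 / x) * exp (- (1 / x))) has_real_derivative flat ([:0, 0, 1:] * (P - pderiv P)) x) (at x)"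
      using 1 by (auto intro!: derivative_eq_intros DERIV_chain2[OF poly_DERIV]
          simp: flat_def field_simps power2_eq_square)
    then show ?thesis
      by (rule has_field_derivative_transform_within_open[where S = "{0<..}"]) (use 1 in \<open>auto simp: flat_def\<close>)
  next
    case 2
    have "((\<lambda>_. 0) has_real_derivative flat ([:0, 0, 1:] * (P - pderiv P)) x) (at x)"
      using 2 by (simp add: flat_def)
    then show ?thesis
      by (rule has_field_derivative_transform_within_open[where S = "{..<0}"]) (use 2 in \<open>auto simp: flat_def\<close>)
  next
    case 3
    have "((\<lambda>h. (flat P (0 + h) - flat P 0) / h) \<longlongrightarrow> 0) (at_right 0)"
    proof (rule Lim_transform_eventually)
      show "((\<lambda>h. inverse h ^ 1 * poly P (inverse h) * exp (- inverse h)) \<longlongrightarrow> 0) (at_right (0::real))"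
        by (rule filterlim_compose[OF poly_exp_tendsto_0 filterlim_inverse_at_top_right])
      show "\<forall>\<^sub>F h in at_right 0. inverse h ^ 1 * poly P (inverse h) * exp (- inverse h) = (flat P (0 + h) - flat P 0) / h"
        using eventually_at_right_less[of 0] by eventually_elim (simp add: flat_def field_simps)
    qed
    moreover have "((\<lambda>h. (flat P (0 + h) - flat P 0) / h) \<longlongrightarrow> 0) (at_left 0)"
    proof (rule Lim_transform_eventually[OF tendsto_const])
      show "\<forall>\<^sub>F h in at_left 0. 0 = (flat P (0 + h) - flat P 0) / h"
        unfolding eventually_at_filter by (auto simp: flat_def intro!: always_eventually)
    qed
    ultimately have "(\<lambda>h. (flat P (0 + h) - flat P 0) / h) \<midarrow>0\<rightarrow> 0"
      by (simp add: filterlim_split_at)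
    then show ?thesis unfolding 3 DERIV_def by (simp add: flat_def)
  qed
qed

lemma Ck_on_flat: "Ck_on k UNIV (flat P)"
proof (induction k arbitrary: P)
  case 0
  then show ?case
    using flat_has_derivative by (auto intro!: DERIV_continuous_on)
next
  case (Suc k)
  then show ?case using flat_has_derivative by (intro Ck_on_real_SucI) auto
qed

lemma smooth_step_exists:
  obtains \<sigma> :: "real \<Rightarrow> real" where "smooth_on UNIV \<sigma>" "\<And>t. t \<le> 1 / 4 \<Longrightarrow> \<sigma> t = 0" "\<And>t. 3 / 4 \<le> t \<Longrightarrow> \<sigma> t = 1"
    "\<And>t. 0 \<le> \<sigma> t" "\<And>t. \<sigma> t \<le> 1"
proof -
  \<comment> \<open>A bump that is positive exactly on the open unit interval; the step function is
    its normalized integral.\<close>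
  define g where "g t = flat 1 t * flat 1 (1 - t)" for t :: real
  have aff: "Ck_on k UNIV (\<lambda>t::real. a * t + b)" for k a b
    by (intro Ck_on_add Ck_on_mult Ck_on_const Ck_on_id fat_UNIV)
  have g: "Ck_on k UNIV g" for k
  proof -
    have "Ck_on k UNIV (\<lambda>t::real. flat 1 ((-1) * t + 1))"
      by (rule Ck_on_comp_real[OF fat_UNIV aff Ck_on_flat]) auto
    then show ?thesis unfolding g_def by (intro Ck_on_mult Ck_on_flat fat_UNIV) (simp add: add.commute)
  qed
  then have cont: "continuous_on S g" for S
    using Ck_on_imp_continuous_on continuous_on_subset by blast
  have g0: "g t = 0" if "t \<le> 0 \<or> 1 \<le> t" for t using that by (auto simp: g_def flat_def)
  have g_nonneg: "g t \<ge> 0" for t by (auto simp: g_def flat_def)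
  have g_pos: "g t > 0" if "0 < t" "t < 1" for t using that by (auto simp: g_def flat_def)
  \<comment> \<open>The lower limit -1 lies left of the support, so every \<open>x \<ge> 0\<close>
    is interior to the interval \<open>{-1..x + 1}\<close> and the derivative there is
    two-sided.\<close>
  define F where "F x = integral {-1..x} g" for x :: real
  have F0: "F x = 0" if "x \<le> 0" for x
  proof -
    have "F x = integral {-1..x} (\<lambda>_. 0)"
      unfolding F_def using that g0 by (intro integral_cong) auto
    then show ?thesis by simp
  qed
  have F: "(F has_real_derivative g x) (at x)" for x
  proof (cases "x < 0")
    case True
    have "((\<lambda>_. 0) has_real_derivative g x) (at x)" using g0 True by simp
    then show ?thesis
      by (rule has_field_derivative_transform_within_open[where S = "{..<0}"]) (use True F0 in auto)
  next
    case False
    have "(F has_vector_derivative g x) (at x within {-1..x + 1})"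
      unfolding F_def using False by (intro integral_has_vector_derivative cont) auto
    moreover have "at x within {-1..x + 1} = at x" using False by (intro at_within_Icc_at) auto
    ultimately show ?thesis by (simp add: has_real_derivative_iff_has_vector_derivative)
  qed
  have mono: "F x \<le> F y" if "x \<le> y" for x y
    using that F g_nonneg by (intro DERIV_nonneg_imp_nondecreasing[of x y F]) blast+
  have F1: "F x = F 1" if "1 \<le> x" for x
  proof (rule antisym)
    show "F x \<le> F 1"
    proof (rule DERIV_nonpos_imp_nonincreasing[of 1 x F, OF that])
      fix y :: real assume "1 \<le> y"
      then have "g y = 0" by (simp add: g0)
      then show "\<exists>z. (F has_real_derivative z) (at y) \<and> z \<le> 0" using F[of y] by (intro exI[of _ 0]) simp
    qed
  qed (rule mono[OF that])
  have pos: "F 1 > 0"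
  proof -
    have "F 0 < F 1"
    proof (rule DERIV_pos_imp_increasing_open[of 0 1 F])
      show "\<exists>y. (F has_real_derivative y) (at x) \<and> 0 < y" if "0 < x" "x < 1" for x
        using F[of x] g_pos[OF that] by (intro exI[of _ "g x"]) simp
      show "continuous_on {0..1} F"
        by (rule DERIV_continuous_on[where D = g], rule has_field_derivative_at_within, rule F)
    qed auto
    then show ?thesis using F0 by simp
  qed
  have "Ck_on k UNIV F" for k
    using Ck_on_Suc_imp_Ck_on[OF Ck_on_real_SucI[OF fat_UNIV _ g]] F by blast
  \<comment> \<open>The affine substitution maps the interval from 1/4 to 3/4 onto the unit
    interval, so that the step rests on a quarter at either end.\<close>
  then have "Ck_on k UNIV (\<lambda>t. F (2 * t + (- 1 / 2)))" for k
    by (intro Ck_on_comp_real[OF fat_UNIV aff]) auto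
  then have "Ck_on k UNIV (\<lambda>t. inverse (F 1) * F (2 * t + (- 1 / 2)))" for k
    by (intro Ck_on_mult Ck_on_const fat_UNIV)
  then have "smooth_on UNIV (\<lambda>t. inverse (F 1) * F (2 * t + (- 1 / 2)))"
    by (simp add: smooth_on_def)
  moreover have "0 \<le> inverse (F 1) * F t" "inverse (F 1) * F t \<le> 1" for t
  proof -
    have "0 \<le> F t" using F0[of "min t 0"] mono[of "min t 0" t] by simp
    moreover have "F t \<le> F 1" using mono[of t 1] F1[of t] by linarith
    ultimately show "0 \<le> inverse (F 1) * F t" "inverse (F 1) * F t \<le> 1"
      using pos by (auto simp: field_simps)
  qed
  moreover have "inverse (F 1) * F (2 * t + (- 1 / 2)) = 0" if "t \<le> 1 / 4" for t
    using that by (simp add: F0)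
  moreover have "inverse (F 1) * F (2 * t + (- 1 / 2)) = 1" if "3 / 4 \<le> t" for t
    using that pos F1[of "2 * t + (- 1 / 2)"] by simp
  ultimately show ?thesis by (intro that) blast+
qed

section \<open>Iterated integrals along an interval\<close>

text \<open>A form enters only through a coefficient function \<open>f w\<close> on the interval.
  Keeping the labels \<open>w\<close> lets one list be integrated along several paths, and the free
  upper limit allows differentiation.\<close>

definition iter_int :: "('w \<Rightarrow> real \<Rightarrow> complex) \<Rightarrow> 'w list \<Rightarrow> real \<Rightarrow> complex" where
  "iter_int f ws = foldl (\<lambda>F w t. integral {0..t} (\<lambda>u. F u * f w u)) (\<lambda>_. 1) ws"

lemma iterated_integral_eq: "iterated_integral A ws p = iter_int (pullback A p) ws 1"
  by (simp add: iterated_integral_def iter_int_def)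

lemma iter_int_Nil [simp]: "iter_int f [] t = 1"
  by (simp add: iter_int_def)

lemma iter_int_snoc: "iter_int f (ws @ [w]) t = integral {0..t} (\<lambda>u. iter_int f ws u * f w u)"
  by (simp add: iter_int_def)

lemma iter_int_0: "ws \<noteq> [] \<Longrightarrow> iter_int f ws 0 = 0"
  by (cases ws rule: rev_cases) (auto simp: iter_int_snoc)

lemma iter_int_cong:
  assumes "\<And>w t. w \<in> set ws \<Longrightarrow> t \<in> {0..1} \<Longrightarrow> f w t = g w t" "t \<in> {0..1}"
  shows "iter_int f ws t = iter_int g ws t"
  using assms
proof (induction ws arbitrary: t rule: rev_induct)
  case (snoc w ws)
  have "iter_int f ws u * f w u = iter_int g ws u * g w u" if "u \<in> {0..t}" for u
    using that snoc by auto
  then show ?case unfolding iter_int_snoc by (rule integral_cong)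
qed simp

lemma iter_int_continuous_on:
  assumes "\<And>w. w \<in> set ws \<Longrightarrow> continuous_on {0..1} (f w)"
  shows "continuous_on {0..1} (iter_int f ws)"
  using assms
proof (induction ws rule: rev_induct)
  case (snoc w ws)
  have "continuous_on {0..1} (\<lambda>t. integral {0..t} (\<lambda>u. iter_int f ws u * f w u))"
    using snoc by (intro indefinite_integral_continuous_1 integrable_continuous_real continuous_on_mult) auto
  then show ?case by (simp add: iter_int_snoc[abs_def] iter_int_snoc cong: continuous_on_cong)
qed (simp add: iter_int_def)

lemma iter_int_snoc_has_derivative:
  assumes "\<And>v. v \<in> set ws \<Longrightarrow> continuous_on {0..1} (f v)" "continuous_on {0..1} (f w)" "t \<in> {0..1}"
  shows "(iter_int f (ws @ [w]) has_vector_derivative iter_int f ws t * f w t) (at t within {0..1})"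
proof -
  have "((\<lambda>t. integral {0..t} (\<lambda>u. iter_int f ws u * f w u)) has_vector_derivative iter_int f ws t * f w t) (at t within {0..1})"
    using assms by (intro integral_has_vector_derivative continuous_on_mult iter_int_continuous_on) auto
  moreover have "iter_int f (ws @ [w]) = (\<lambda>t. integral {0..t} (\<lambda>u. iter_int f ws u * f w u))"
    by (simp add: fun_eq_iff iter_int_snoc)
  ultimately show ?thesis by simp
qed

lemma iter_int_has_derivative:
  assumes "\<And>v. v \<in> set ws \<Longrightarrow> continuous_on {0..1} (f v)" "t \<in> {0..1}"
  shows "\<exists>D. (iter_int f ws has_vector_derivative D) (at t within {0..1})"
proof (cases ws rule: rev_cases)
  case Nil
  then show ?thesis by (auto simp: iter_int_def intro!: exI[of _ 0])
next
  case (snoc us w)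
  then show ?thesis using assms iter_int_snoc_has_derivative[of us f w t] by auto
qed

text \<open>By the fundamental theorem of calculus, an iterated integral is recognized by its
  derivative and its value at 0.\<close>

lemma iter_int_snoc_eqI:
  assumes "G 0 = 0" "\<And>t. t \<in> {0..1} \<Longrightarrow> (G has_vector_derivative iter_int f ws t * f w t) (at t within {0..1})"
    and "t \<in> {0..1}"
  shows "iter_int f (ws @ [w]) t = G t"
proof -
  have "((\<lambda>u. iter_int f ws u * f w u) has_integral G t - G 0) {0..t}"
    using assms(3) by (intro fundamental_theorem_of_calculus has_vector_derivative_within_subset[OF assms(2)]) auto
  then show ?thesis using assms(1) by (simp add: iter_int_snoc integral_unique)
qed

text \<open>An integral over the trivial interval vanishes unless the list is empty. This is the
  collapse of Chen's formula at times when the second path has not started.\<close>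

lemma sum_take_drop_0:
  "(\<Sum>j\<le>length ws. a (take j ws) * iter_int g (drop j ws) 0) = a ws"
proof -
  have "(\<Sum>j\<le>length ws. a (take j ws) * iter_int g (drop j ws) 0) = (\<Sum>j\<le>length ws. if j = length ws then a ws else 0)"
    by (intro sum.cong) (auto simp: iter_int_0)
  then show ?thesis by simp
qed

text \<open>
  Chen's formula for the integral over a product of paths, where the product is given by two
  reparametrizations \<open>\<alpha>\<close> and \<open>\<beta>\<close> that are never active at the same time.  For \<open>\<beta> = 0\<close> it is
  the invariance under reparametrization.
\<close>

lemma iter_int_concat:
  assumes f: "\<And>w. w \<in> set ws \<Longrightarrow> continuous_on {0..1} (f w)" and g: "\<And>w. w \<in> set ws \<Longrightarrow> continuous_on {0..1} (g w)"
    and \<alpha>: "\<And>t. t \<in> {0..1} \<Longrightarrow> (\<alpha> has_real_derivative \<alpha>' t) (at t within {0..1})" "\<alpha> ` {0..1} \<subseteq> {0..1}" "\<alpha> 0 = 0"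
    and \<beta>: "\<And>t. t \<in> {0..1} \<Longrightarrow> (\<beta> has_real_derivative \<beta>' t) (at t within {0..1})" "\<beta> ` {0..1} \<subseteq> {0..1}" "\<beta> 0 = 0"
    and disj: "\<And>t. t \<in> {0..1} \<Longrightarrow> \<alpha>' t = 0 \<or> \<beta> t = 0"
    and h: "\<And>w t. w \<in> set ws \<Longrightarrow> t \<in> {0..1} \<Longrightarrow> h w t = \<alpha>' t *\<^sub>R f w (\<alpha> t) + \<beta>' t *\<^sub>R g w (\<beta> t)"
    and t: "t \<in> {0..1}"
  shows "iter_int h ws t = (\<Sum>j\<le>length ws. iter_int f (take j ws) (\<alpha> t) * iter_int g (drop j ws) (\<beta> t))"
  using f g h t
proof (induction ws arbitrary: t rule: rev_induct)
  case (snoc w ws)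
  have chain: "((\<lambda>t. F (\<gamma> t)) has_vector_derivative \<gamma>' *\<^sub>R F') (at t within {0..1})"
    if "(\<gamma> has_real_derivative \<gamma>') (at t within {0..1})" "\<gamma> ` {0..1} \<subseteq> {0..1}"
      "(F has_vector_derivative F') (at (\<gamma> t) within {0..1})" for F :: "real \<Rightarrow> complex" and F' \<gamma> \<gamma>' t
    using vector_diff_chain_within[OF that(1)[unfolded has_real_derivative_iff_has_vector_derivative]
        has_vector_derivative_within_subset[OF that(3,2)]] by (simp add: o_def)
  let ?n = "length ws"
  \<comment> \<open>The right-hand side for \<open>ws @ [w]\<close>, with the last summand, in which
    no form is left for \<open>g\<close>, written separately.\<close>
  define G where "G t = (\<Sum>j\<le>?n. iter_int f (take j ws) (\<alpha> t) * iter_int g (drop j ws @ [w]) (\<beta> t))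
      + iter_int f (ws @ [w]) (\<alpha> t)" for t
  have "iter_int h (ws @ [w]) t = G t"
  proof (rule iter_int_snoc_eqI[OF _ _ snoc.prems(4)])
    show "G 0 = 0" by (simp add: G_def \<alpha>(3) \<beta>(3) iter_int_0)
  next
    fix t :: real assume t: "t \<in> {0..1}"
    have \<alpha>t: "\<alpha> t \<in> {0..1}" and \<beta>t: "\<beta> t \<in> {0..1}" using \<alpha>(2) \<beta>(2) t unfolding image_subset_iff by blast+
    have IH: "iter_int h ws t = (\<Sum>j\<le>?n. iter_int f (take j ws) (\<alpha> t) * iter_int g (drop j ws) (\<beta> t))"
      using snoc.prems t by (intro snoc.IH) auto
    have summand: "((\<lambda>t. iter_int f (take j ws) (\<alpha> t) * iter_int g (drop j ws @ [w]) (\<beta> t)) has_vector_derivative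
        iter_int f (take j ws) (\<alpha> t) * (\<beta>' t *\<^sub>R (iter_int g (drop j ws) (\<beta> t) * g w (\<beta> t)))) (at t within {0..1})" for j
    proof -
      have "\<exists>D. (iter_int f (take j ws) has_vector_derivative D) (at (\<alpha> t) within {0..1})"
        using snoc.prems(1) \<alpha>t by (intro iter_int_has_derivative) (auto dest: in_set_takeD)
      then obtain D where "(iter_int f (take j ws) has_vector_derivative D) (at (\<alpha> t) within {0..1})" by blast
      then have 1: "((\<lambda>t. iter_int f (take j ws) (\<alpha> t)) has_vector_derivative \<alpha>' t *\<^sub>R D) (at t within {0..1})"
        by (rule chain[OF \<alpha>(1)[OF t] \<alpha>(2)])
      have "(iter_int g (drop j ws @ [w]) has_vector_derivative iter_int g (drop j ws) (\<beta> t) * g w (\<beta> t)) (at (\<beta> t) within {0..1})"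
        using snoc.prems(2) \<beta>t by (intro iter_int_snoc_has_derivative) (auto dest: in_set_dropD)
      then have 2: "((\<lambda>t. iter_int g (drop j ws @ [w]) (\<beta> t)) has_vector_derivative
          \<beta>' t *\<^sub>R (iter_int g (drop j ws) (\<beta> t) * g w (\<beta> t))) (at t within {0..1})"
        by (rule chain[OF \<beta>(1)[OF t] \<beta>(2)])
      \<comment> \<open>This term of the product rule vanishes: either \<open>\<alpha>\<close>
        rests, or \<open>\<beta>\<close> is still 0 and the list integrated with \<open>g\<close> is
        not empty.\<close>
      have "(\<alpha>' t *\<^sub>R D) * iter_int g (drop j ws @ [w]) (\<beta> t) = 0"
        using disj[OF t] by (auto simp: iter_int_0)
      then show ?thesis using has_vector_derivative_mult[OF 1 2] by (simp only: add_0_right)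
    qed
    have "(iter_int f (ws @ [w]) has_vector_derivative iter_int f ws (\<alpha> t) * f w (\<alpha> t)) (at (\<alpha> t) within {0..1})"
      using snoc.prems(1) \<alpha>t by (intro iter_int_snoc_has_derivative) auto
    then have last: "((\<lambda>t. iter_int f (ws @ [w]) (\<alpha> t)) has_vector_derivative
        \<alpha>' t *\<^sub>R (iter_int f ws (\<alpha> t) * f w (\<alpha> t))) (at t within {0..1})"
      by (rule chain[OF \<alpha>(1)[OF t] \<alpha>(2)])
    have "(G has_vector_derivative (\<Sum>j\<le>?n. iter_int f (take j ws) (\<alpha> t) * (\<beta>' t *\<^sub>R (iter_int g (drop j ws) (\<beta> t) * g w (\<beta> t))))
        + \<alpha>' t *\<^sub>R (iter_int f ws (\<alpha> t) * f w (\<alpha> t))) (at t within {0..1})"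
      unfolding G_def by (intro has_vector_derivative_add has_vector_derivative_sum summand last)
    also have "(\<Sum>j\<le>?n. iter_int f (take j ws) (\<alpha> t) * (\<beta>' t *\<^sub>R (iter_int g (drop j ws) (\<beta> t) * g w (\<beta> t))))
        = iter_int h ws t * (\<beta>' t *\<^sub>R g w (\<beta> t))"
      unfolding IH sum_distrib_right by (intro sum.cong) (auto simp: scaleR_conv_of_real)
    \<comment> \<open>Where \<open>\<alpha>\<close> moves, \<open>\<beta>\<close> is 0, so the
      induction hypothesis reduces to the summand with all of \<open>ws\<close> on
      \<open>f\<close>.\<close>
    also have "\<alpha>' t *\<^sub>R (iter_int f ws (\<alpha> t) * f w (\<alpha> t)) = iter_int h ws t * (\<alpha>' t *\<^sub>R f w (\<alpha> t))"
    proof (cases "\<alpha>' t = 0")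
      case False
      then have "iter_int h ws t = iter_int f ws (\<alpha> t)"
        using disj[OF t] sum_take_drop_0[where a = "\<lambda>us. iter_int f us (\<alpha> t)" and ws = ws] by (simp add: IH)
      then show ?thesis by (simp add: scaleR_conv_of_real)
    qed simp
    finally show "(G has_vector_derivative iter_int h ws t * h w t) (at t within {0..1})"
      using snoc.prems(3)[of w t] t by (simp add: algebra_simps)
  qed
  also have "G t = (\<Sum>j\<le>length (ws @ [w]). iter_int f (take j (ws @ [w])) (\<alpha> t) * iter_int g (drop j (ws @ [w])) (\<beta> t))"
    by (simp add: G_def)
  finally show ?case .
qed simp

lemma iter_int_reparam:
  assumes f: "\<And>w. w \<in> set ws \<Longrightarrow> continuous_on {0..1} (f w)"
    and \<alpha>: "\<And>t. t \<in> {0..1} \<Longrightarrow> (\<alpha> has_real_derivative \<alpha>' t) (at t within {0..1})" "\<alpha> ` {0..1} \<subseteq> {0..1}" "\<alpha> 0 = 0"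
    and h: "\<And>w t. w \<in> set ws \<Longrightarrow> t \<in> {0..1} \<Longrightarrow> h w t = \<alpha>' t *\<^sub>R f w (\<alpha> t)"
    and t: "t \<in> {0..1}"
  shows "iter_int h ws t = iter_int f ws (\<alpha> t)"
proof -
  have "iter_int h ws t = (\<Sum>j\<le>length ws. iter_int f (take j ws) (\<alpha> t) * iter_int (\<lambda>_ _. 0) (drop j ws) 0)"
    by (rule iter_int_concat[where \<beta> = "\<lambda>_. 0" and \<beta>' = "\<lambda>_. 0"]) (use assms in auto)
  then show ?thesis using sum_take_drop_0[where a = "\<lambda>us. iter_int f us (\<alpha> t)" and ws = ws] by simp
qed

section \<open>Smooth paths\<close>

lemma smooth_paths_iff:
  "p \<in> smooth_paths M A \<longleftrightarrow> path p \<and> path_image p \<subseteq> M \<and>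
     (\<forall>(U, \<phi>)\<in>A. \<forall>k. Ck_on k ({0..1} \<inter> p -` U) (\<phi> \<circ> p))"
  by (auto simp: smooth_paths_def smooth_on_def)

lemma smooth_pathD:
  assumes "p \<in> smooth_paths M A"
  shows "path p" "path_image p \<subseteq> M" "\<And>t. t \<in> {0..1} \<Longrightarrow> p t \<in> M"
  using assms by (auto simp: smooth_paths_def path_image_def)

lemma openin_path_vimage:
  assumes "path p" "path_image p \<subseteq> M" "openin (top_of_set M) U"
  shows "openin (top_of_set {0..1}) ({0..1} \<inter> p -` U)"
  using assms by (intro continuous_openin_preimage[of _ _ M]) (auto simp: path_def path_image_def)

lemma path_nbhd:
  assumes "path p" "path_image p \<subseteq> M" "openin (top_of_set M) U" "t \<in> {0..1}" "p t \<in> U"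
  obtains G where "open G" "t \<in> G" "\<And>s. s \<in> {0..1} \<inter> G \<Longrightarrow> p s \<in> U"
proof -
  obtain G where "open G" "{0..1} \<inter> p -` U = {0..1} \<inter> G"
    using openin_path_vimage[OF assms(1-3)] by (auto simp: openin_open)
  moreover from this have "t \<in> G" "\<And>s. s \<in> {0..1} \<inter> G \<Longrightarrow> p s \<in> U" using assms(4,5) by blast+
  ultimately show ?thesis by (intro that[of G])
qed

locale smooth_mfd = coordinates E coord
  for E :: "'e::banach set" and coord :: "'e \<Rightarrow> 'e \<Rightarrow> real" +
  fixes M :: "'a::topological_space set" and A :: "('a, 'e) chart set"
  assumes atlas: "smooth_atlas M A"
begin

lemma chart_exists:
  assumes "x \<in> M" obtains U \<phi> where "(U, \<phi>) \<in> A" "x \<in> U"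
  using assms atlas unfolding smooth_atlas_def by blast

context
  fixes U \<phi> assumes chart: "(U, \<phi>) \<in> A"
begin

lemma chart_openin: "openin (top_of_set M) U" and chart_open: "open (\<phi> ` U)"
  and chart_homeomorphism: "homeomorphism U (\<phi> ` U) \<phi> (inv_into U \<phi>)"
  using atlas chart unfolding smooth_atlas_def by blast+

lemma chart_subset: "U \<subseteq> M"
  using chart_openin openin_imp_subset by blast

lemma chart_continuous: "continuous_on U \<phi>" "continuous_on (\<phi> ` U) (inv_into U \<phi>)"
  using chart_homeomorphism by (auto simp: homeomorphism_def)

lemma chart_inv [simp]: "x \<in> U \<Longrightarrow> inv_into U \<phi> (\<phi> x) = x"
  using chart_homeomorphism by (auto simp: homeomorphism_def)

lemma chart_open_Int:
  assumes "openin (top_of_set M) W" shows "open (\<phi> ` (U \<inter> W))"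
proof -
  have "openin (top_of_set U) (U \<inter> W)"
    using assms chart_subset by (metis inf.absorb_iff2 openin_subtopology_Int2 subtopology_subtopology)
  then have "openin (top_of_set (\<phi> ` U)) (\<phi> ` (U \<inter> W))"
    using chart_homeomorphism homeomorphism_imp_open_map by blast
  then show ?thesis using chart_open openin_open_trans by blast
qed

lemma chart_transition:
  assumes "(V, \<psi>) \<in> A" shows "Ck_on k (\<phi> ` (U \<inter> V)) (\<psi> \<circ> inv_into U \<phi>)"
  using atlas chart assms unfolding smooth_atlas_def smooth_on_def by blast

end

lemma smooth_path_Ck_on:
  assumes "p \<in> smooth_paths M A" "(U, \<phi>) \<in> A" "G \<subseteq> {0..1}" "fat G" "p ` G \<subseteq> U"
  shows "Ck_on k G (\<phi> \<circ> p)"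
proof (rule Ck_on_subset[OF _ _ assms(4)])
  show "Ck_on k ({0..1} \<inter> p -` U) (\<phi> \<circ> p)" using assms(1,2) unfolding smooth_paths_iff by blast
qed (use assms in auto)

text \<open>One chart around each parameter suffices, since the transition maps carry smoothness
  over to all other charts.\<close>

lemma smooth_pathI:
  assumes p: "path p" "path_image p \<subseteq> M"
    and loc: "\<And>t. t \<in> {0..1} \<Longrightarrow> \<exists>U \<phi> G. (U, \<phi>) \<in> A \<and> open G \<and> t \<in> G \<and> p ` ({0..1} \<inter> G) \<subseteq> U \<and>
      (\<forall>k. Ck_on k ({0..1} \<inter> G) (\<phi> \<circ> p))"
  shows "p \<in> smooth_paths M A"
proof -
  have "Ck_on k ({0..1} \<inter> p -` V) (\<psi> \<circ> p)" if V: "(V, \<psi>) \<in> A" for V \<psi> k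
  proof (rule Ck_on_local)
    fix t assume t: "t \<in> {0..1} \<inter> p -` V"
    obtain U \<phi> G where U: "(U, \<phi>) \<in> A" "open G" "t \<in> G" "p ` ({0..1} \<inter> G) \<subseteq> U"
      "\<And>k. Ck_on k ({0..1} \<inter> G) (\<phi> \<circ> p)"
      using loc t by blast
    have op: "openin (top_of_set {0..1}) ({0..1} \<inter> p -` V)"
      by (rule openin_path_vimage[OF p chart_openin[OF V]])
    have fat: "fat ({0..1} \<inter> p -` V \<inter> G)"
      by (rule fat_Int_open[OF fat_openin_unit_interval[OF op] U(2)])
    have "Ck_on k ({0..1} \<inter> p -` V \<inter> G) (\<lambda>s. (\<psi> \<circ> inv_into U \<phi>) ((\<phi> \<circ> p) s))"
    proof (rule Ck_on_comp[OF fat _ chart_transition[OF U(1) V]])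
      show "Ck_on k ({0..1} \<inter> p -` V \<inter> G) (\<phi> \<circ> p)"
        by (rule Ck_on_subset[OF U(5) _ fat]) auto
      show "(\<phi> \<circ> p) ` ({0..1} \<inter> p -` V \<inter> G) \<subseteq> \<phi> ` (U \<inter> V)" using U(4) by auto
    qed
    then have "Ck_on k ({0..1} \<inter> p -` V \<inter> G) (\<psi> \<circ> p)"
    proof (rule Ck_on_eq)
      fix s assume "s \<in> {0..1} \<inter> p -` V \<inter> G"
      then have "p s \<in> U" using U(4) by blast
      then show "(\<psi> \<circ> p) s = (\<psi> \<circ> inv_into U \<phi>) ((\<phi> \<circ> p) s)" by (simp add: chart_inv[OF U(1)])
    qed
    then show "\<exists>G. open G \<and> t \<in> G \<and> Ck_on k ({0..1} \<inter> p -` V \<inter> G) (\<psi> \<circ> p)" using U by blast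
  qed
  then show ?thesis using p unfolding smooth_paths_iff by blast
qed

lemma smooth_path_local:
  assumes r: "path r" "path_image r \<subseteq> M"
    and loc: "\<And>t. t \<in> {0..1} \<Longrightarrow> \<exists>G p. open G \<and> t \<in> G \<and> p \<in> smooth_paths M A \<and> (\<forall>s\<in>{0..1} \<inter> G. r s = p s)"
  shows "r \<in> smooth_paths M A"
proof (rule smooth_pathI[OF r])
  fix t :: real assume t: "t \<in> {0..1}"
  obtain G p where G: "open G" "t \<in> G" "p \<in> smooth_paths M A" "\<And>s. s \<in> {0..1} \<inter> G \<Longrightarrow> r s = p s"
    using loc[OF t] by blast
  obtain U \<phi> where U: "(U, \<phi>) \<in> A" "p t \<in> U" using chart_exists smooth_pathD(3)[OF G(3) t] by blast
  obtain G' where G': "open G'" "t \<in> G'" "\<And>s. s \<in> {0..1} \<inter> G' \<Longrightarrow> p s \<in> U"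
    using path_nbhd[OF smooth_pathD(1,2)[OF G(3)] chart_openin[OF U(1)] t U(2)] by blast
  have "Ck_on k ({0..1} \<inter> (G \<inter> G')) (\<phi> \<circ> r)" for k
  proof (rule Ck_on_eq)
    show "Ck_on k ({0..1} \<inter> (G \<inter> G')) (\<phi> \<circ> p)"
      by (rule smooth_path_Ck_on[OF G(3) U(1)]) (use G G' in \<open>auto intro!: fat_Int_open fat_unit_interval\<close>)
  qed (use G in auto)
  then show "\<exists>U \<phi> G. (U, \<phi>) \<in> A \<and> open G \<and> t \<in> G \<and> r ` ({0..1} \<inter> G) \<subseteq> U \<and> (\<forall>k. Ck_on k ({0..1} \<inter> G) (\<phi> \<circ> r))"
    using U G G' by (intro exI[of _ U] exI[of _ \<phi>] exI[of _ "G \<inter> G'"]) auto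
qed

lemma smooth_path_reparam:
  assumes p: "p \<in> smooth_paths M A" and \<alpha>: "\<And>k. Ck_on k {0..1} \<alpha>" "\<alpha> ` {0..1} \<subseteq> {0..1}"
  shows "(\<lambda>t. p (\<alpha> t)) \<in> smooth_paths M A"
proof (rule smooth_pathI)
  have c: "continuous_on {0..1} \<alpha>" using \<alpha>(1) Ck_on_imp_continuous_on by blast
  show "path (\<lambda>t. p (\<alpha> t))"
    using smooth_pathD(1)[OF p] unfolding path_def by (rule continuous_on_compose2[OF _ c \<alpha>(2)])
  show "path_image (\<lambda>t. p (\<alpha> t)) \<subseteq> M"
    using smooth_pathD(3)[OF p] \<alpha>(2) by (auto simp: path_image_def)
  fix t :: real assume t: "t \<in> {0..1}"
  then have \<alpha>t: "\<alpha> t \<in> {0..1}" using \<alpha>(2) by blast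
  obtain U \<phi> where U: "(U, \<phi>) \<in> A" "p (\<alpha> t) \<in> U" using chart_exists smooth_pathD(3)[OF p \<alpha>t] by blast
  obtain G where G: "open G" "\<alpha> t \<in> G" "\<And>s. s \<in> {0..1} \<inter> G \<Longrightarrow> p s \<in> U"
    using path_nbhd[OF smooth_pathD(1,2)[OF p] chart_openin[OF U(1)] \<alpha>t U(2)] by blast
  obtain G' where G': "open G'" "{0..1} \<inter> \<alpha> -` G = {0..1} \<inter> G'"
    using continuous_openin_preimage_gen[OF c G(1)] by (auto simp: openin_open)
  have "Ck_on k ({0..1} \<inter> G') (\<phi> \<circ> (\<lambda>t. p (\<alpha> t)))" for k
  proof -
    have fat: "fat ({0..1} \<inter> G')" by (intro fat_Int_open fat_unit_interval G')
    have "Ck_on k ({0..1} \<inter> G') (\<lambda>t. (\<phi> \<circ> p) (\<alpha> t))"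
    proof (rule Ck_on_comp_real[OF fat])
      show "Ck_on k ({0..1} \<inter> G') \<alpha>" by (rule Ck_on_subset[OF \<alpha>(1) _ fat]) auto
      show "Ck_on k ({0..1} \<inter> G) (\<phi> \<circ> p)"
        by (rule smooth_path_Ck_on[OF p U(1)]) (use G in \<open>auto intro!: fat_Int_open fat_unit_interval\<close>)
      show "\<alpha> ` ({0..1} \<inter> G') \<subseteq> {0..1} \<inter> G" using G' \<alpha>(2) by blast
    qed
    then show ?thesis by (simp add: o_def)
  qed
  moreover have "t \<in> G'" "(\<lambda>t. p (\<alpha> t)) ` ({0..1} \<inter> G') \<subseteq> U" using G' G \<alpha>(2) t by blast+
  ultimately show "\<exists>U \<phi> G. (U, \<phi>) \<in> A \<and> open G \<and> t \<in> G \<and> (\<lambda>t. p (\<alpha> t)) ` ({0..1} \<inter> G) \<subseteq> U \<and>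
      (\<forall>k. Ck_on k ({0..1} \<inter> G) (\<phi> \<circ> (\<lambda>t. p (\<alpha> t))))"
    using U G' by blast
qed

lemma smooth_path_reverse:
  assumes "p \<in> smooth_paths M A" shows "reversepath p \<in> smooth_paths M A"
proof -
  have "Ck_on k {0..1} (\<lambda>t::real. 1 + (- 1) * t)" for k
    by (intro Ck_on_add Ck_on_mult Ck_on_const Ck_on_id fat_unit_interval)
  then show ?thesis
    using smooth_path_reparam[OF assms, of "\<lambda>t. 1 + (- 1) * t"] by (simp add: reversepath_def)
qed

lemma smooth_path_chart_line:
  assumes U: "(U, \<phi>) \<in> A" and b: "ball a r \<subseteq> \<phi> ` U" "a + v \<in> ball a r"
  shows "(\<lambda>t. inv_into U \<phi> (a + t *\<^sub>R v)) \<in> smooth_paths M A" (is "?l \<in> _")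
    and "\<And>t. t \<in> {0..1} \<Longrightarrow> inv_into U \<phi> (a + t *\<^sub>R v) \<in> U" "\<And>t. t \<in> {0..1} \<Longrightarrow> \<phi> (inv_into U \<phi> (a + t *\<^sub>R v)) = a + t *\<^sub>R v"
proof -
  have im: "a + t *\<^sub>R v \<in> \<phi> ` U" if "t \<in> {0..1}" for t
  proof -
    have "\<bar>t\<bar> * norm v \<le> 1 * norm v" using that by (intro mult_right_mono) auto
    then have "a + t *\<^sub>R v \<in> ball a r" using b(2) by (auto simp: dist_norm)
    then show ?thesis using b(1) by blast
  qed
  show U': "inv_into U \<phi> (a + t *\<^sub>R v) \<in> U" and e: "\<phi> (inv_into U \<phi> (a + t *\<^sub>R v)) = a + t *\<^sub>R v" if "t \<in> {0..1}" for t
    using im[OF that] by (auto intro: inv_into_into f_inv_into_f)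
  show "?l \<in> smooth_paths M A"
  proof (rule smooth_pathI)
    show "path ?l"
      unfolding path_def by (rule continuous_on_compose2[OF chart_continuous(2)[OF U]]) (use im in \<open>auto intro!: continuous_intros\<close>)
    show "path_image ?l \<subseteq> M" using U' chart_subset[OF U] by (auto simp: path_image_def)
    fix t :: real assume "t \<in> {0..1}"
    have "Ck_on k {0..1} (\<lambda>t. a + t *\<^sub>R v)" for k
      by (intro Ck_on_add Ck_on_scaleR Ck_on_const Ck_on_id fat_unit_interval)
    then have "Ck_on k {0..1} (\<phi> \<circ> ?l)" for k
      by (rule Ck_on_eq) (use e in auto)
    then show "\<exists>V \<psi> G. (V, \<psi>) \<in> A \<and> open G \<and> t \<in> G \<and> ?l ` ({0..1} \<inter> G) \<subseteq> V \<and> (\<forall>k. Ck_on k ({0..1} \<inter> G) (\<psi> \<circ> ?l))"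
      using U U' by (intro exI[of _ U] exI[of _ \<phi>] exI[of _ UNIV]) auto
  qed
qed

end

section \<open>The smooth product of paths\<close>

definition step :: "real \<Rightarrow> real" where
  "step = (SOME \<sigma>. smooth_on UNIV \<sigma> \<and> (\<forall>t. t \<le> 1 / 4 \<longrightarrow> \<sigma> t = 0) \<and> (\<forall>t. 3 / 4 \<le> t \<longrightarrow> \<sigma> t = 1) \<and>
     (\<forall>t. 0 \<le> \<sigma> t \<and> \<sigma> t \<le> 1))"

lemma step: "Ck_on k UNIV step" "t \<le> 1 / 4 \<Longrightarrow> step t = 0" "3 / 4 \<le> t \<Longrightarrow> step t = 1" "0 \<le> step t" "step t \<le> 1"
proof -
  have "\<exists>\<sigma>::real \<Rightarrow> real. smooth_on UNIV \<sigma> \<and> (\<forall>t. t \<le> 1 / 4 \<longrightarrow> \<sigma> t = 0) \<and> (\<forall>t. 3 / 4 \<le> t \<longrightarrow> \<sigma> t = 1) \<and>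
     (\<forall>t. 0 \<le> \<sigma> t \<and> \<sigma> t \<le> 1)"
    using smooth_step_exists by metis
  then have "smooth_on UNIV step \<and> (\<forall>t. t \<le> 1 / 4 \<longrightarrow> step t = 0) \<and> (\<forall>t. 3 / 4 \<le> t \<longrightarrow> step t = 1) \<and>
     (\<forall>t. 0 \<le> step t \<and> step t \<le> 1)"
    unfolding step_def by (rule someI_ex)
  then show "Ck_on k UNIV step" "t \<le> 1 / 4 \<Longrightarrow> step t = 0" "3 / 4 \<le> t \<Longrightarrow> step t = 1" "0 \<le> step t" "step t \<le> 1"
    by (auto simp: smooth_on_def)
qed

lemma step_affine: "Ck_on k {0..1} (\<lambda>t. step (a * t + b))"
proof -
  have "Ck_on k {0..1} (\<lambda>t::real. a * t + b)"
    by (intro Ck_on_add Ck_on_mult Ck_on_const Ck_on_id fat_unit_interval)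
  then show ?thesis by (rule Ck_on_comp_real[OF fat_unit_interval _ step(1)]) auto
qed

lemma step_affine_has_derivative:
  "\<exists>d. \<forall>t\<in>{0..1}. ((\<lambda>t. step (a * t + b)) has_real_derivative d t) (at t within {0..1})"
proof (rule bchoice, rule ballI)
  fix t :: real assume "t \<in> {0..1}"
  have "Ck_on (Suc 0) {0..1} (\<lambda>t. step (a * t + b))" by (rule step_affine)
  then have "(\<lambda>t. step (a * t + b)) differentiable (at t within {0..1})"
    using \<open>t \<in> {0..1}\<close> by (simp add: differentiable_on_def)
  then show "\<exists>d. ((\<lambda>t. step (a * t + b)) has_real_derivative d) (at t within {0..1})"
    by (simp add: real_differentiable_def)
qed

text \<open>\<open>step\<close> is constant near both ends, so both factors rest around the junction
  and no corner arises.\<close>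

definition smooth_join :: "(real \<Rightarrow> 'a::topological_space) \<Rightarrow> (real \<Rightarrow> 'a) \<Rightarrow> real \<Rightarrow> 'a" where
  "smooth_join p q = (\<lambda>t. p (step t)) +++ (\<lambda>t. q (step t))"

lemma smooth_join_left: "t \<le> 1 / 2 \<Longrightarrow> smooth_join p q t = p (step (2 * t + 0))"
  by (simp add: smooth_join_def joinpaths_def)

text \<open>Between 3/8 and 1/2 the first factor has already reached its end, because
  \<open>2 * t \<ge> 3 / 4\<close>, and the second is still at its start. So this formula and the
  one for the left half overlap in an interval, which makes local arguments possible at 1/2. Both
  are written in the affine form of \<open>step_affine\<close>.\<close>

lemma smooth_join_right: "pathfinish p = pathstart q \<Longrightarrow> 3 / 8 \<le> t \<Longrightarrow> smooth_join p q t = q (step (2 * t + (- 1)))"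
  by (auto simp: smooth_join_def joinpaths_def pathstart_def pathfinish_def step)

lemma pathstart_smooth_join [simp]: "pathstart (smooth_join p q) = pathstart p"
  and pathfinish_smooth_join [simp]: "pathfinish (smooth_join p q) = pathfinish q"
  by (simp_all add: smooth_join_def joinpaths_def pathstart_def pathfinish_def step)

lemma homotopic_paths_smooth_join:
  assumes "path p" "path_image p \<subseteq> S" "path q" "path_image q \<subseteq> S" "pathfinish p = pathstart q"
  shows "homotopic_paths S (p +++ q) (smooth_join p q)"
proof -
  have *: "homotopic_paths S p (\<lambda>t. p (step t))" if "path p" "path_image p \<subseteq> S" for p
  proof (rule homotopic_paths_reparametrize[OF that])
    show "continuous_on {0..1} step"
      using Ck_on_imp_continuous_on[OF step(1)] continuous_on_subset by blast
  qed (auto simp: step)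
  show ?thesis
    unfolding smooth_join_def using assms by (intro homotopic_paths_join *) auto
qed

context smooth_mfd
begin

lemma smooth_join_smooth:
  assumes p: "p \<in> smooth_paths M A" and q: "q \<in> smooth_paths M A" and pq: "pathfinish p = pathstart q"
  shows "smooth_join p q \<in> smooth_paths M A"
proof (rule smooth_path_local)
  have "homotopic_paths M (p +++ q) (smooth_join p q)"
    by (intro homotopic_paths_smooth_join smooth_pathD[OF p] smooth_pathD[OF q] pq)
  then show "path (smooth_join p q)" "path_image (smooth_join p q) \<subseteq> M"
    using homotopic_paths_imp_path homotopic_paths_imp_subset by blast+
  fix t :: real assume t: "t \<in> {0..1}"
  have 1: "(\<lambda>t. p (step (2 * t + 0))) \<in> smooth_paths M A"
    by (intro smooth_path_reparam[OF p] step_affine) (auto simp: step)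
  have 2: "(\<lambda>t. q (step (2 * t + (- 1)))) \<in> smooth_paths M A"
    by (intro smooth_path_reparam[OF q] step_affine) (auto simp: step)
  show "\<exists>G r. open G \<and> t \<in> G \<and> r \<in> smooth_paths M A \<and> (\<forall>s\<in>{0..1} \<inter> G. smooth_join p q s = r s)"
  proof (cases "t < 1 / 2")
    case True
    then show ?thesis
      by (intro exI[of _ "{..<1/2}"] exI[of _ "\<lambda>t. p (step (2 * t + 0))"]) (use 1 smooth_join_left[of _ p q] in auto)
  next
    case False
    then show ?thesis
      by (intro exI[of _ "{3/8<..}"] exI[of _ "\<lambda>t. q (step (2 * t + (- 1)))"]) (use 2 smooth_join_right[OF pq] in auto)
  qed
qed

section \<open>Pull-backs of forms along smooth paths, and Chen's formula for smooth
  products\<close>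

lemma chart_path_has_derivative:
  assumes p: "p \<in> smooth_paths M A" and U: "(U, \<phi>) \<in> A" and t: "t \<in> {0..1}" "p t \<in> U"
  shows "((\<phi> \<circ> p) has_vector_derivative vector_derivative (\<phi> \<circ> p) (at t within {0..1})) (at t within {0..1})"
proof -
  obtain G where G: "open G" "t \<in> G" "\<And>s. s \<in> {0..1} \<inter> G \<Longrightarrow> p s \<in> U"
    using path_nbhd[OF smooth_pathD(1,2)[OF p] chart_openin[OF U] t] by blast
  have "Ck_on (Suc 0) ({0..1} \<inter> G) (\<phi> \<circ> p)"
    by (rule smooth_path_Ck_on[OF p U]) (use G in \<open>auto intro!: fat_Int_open fat_unit_interval\<close>)
  then have "(\<phi> \<circ> p) differentiable (at t within {0..1} \<inter> G)"
    using t G by (auto simp: differentiable_on_def)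
  also have "at t within {0..1} \<inter> G = at t within {0..1}"
    using G by (intro at_within_nhd[of t G]) auto
  finally show ?thesis by (simp only: vector_derivative_works)
qed

lemma vector_derivative_unit_interval:
  "(f has_vector_derivative D) (at t within {0..1}) \<Longrightarrow> t \<in> {0..1} \<Longrightarrow> vector_derivative f (at t within {0..1::real}) = D"
  by (rule vector_derivative_within_cbox[of 0 1, unfolded cbox_interval]) auto

text \<open>\<open>pullback\<close> picks some chart. The chain rule transforms the velocity by the
  derivative of the coordinate change, and the compatibility condition of a form compensates for
  this, so every chart gives the same value.\<close>

lemma pullback_eq:
  assumes p: "p \<in> smooth_paths M A" and w: "w \<in> one_forms A" and U: "(U, \<phi>) \<in> A" and t: "t \<in> {0..1}" "p t \<in> U"
  shows "pullback A p w t = w (U, \<phi>) (\<phi> (p t)) (vector_derivative (\<phi> \<circ> p) (at t within {0..1}))"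
proof -
  define c where "c = (SOME c. c \<in> A \<and> p t \<in> fst c)"
  have "c \<in> A \<and> p t \<in> fst c"
    unfolding c_def by (rule someI[where P = "\<lambda>c. c \<in> A \<and> p t \<in> fst c" and x = "(U, \<phi>)"]) (simp add: U t)
  then obtain V \<psi> where V: "c = (V, \<psi>)" "(V, \<psi>) \<in> A" "p t \<in> V" by (cases c) auto
  let ?T = "\<psi> \<circ> inv_into U \<phi>" and ?v = "vector_derivative (\<phi> \<circ> p) (at t within {0..1})"
  have op: "open (\<phi> ` (U \<inter> V))" by (rule chart_open_Int[OF U chart_openin[OF V(2)]])
  have pt: "\<phi> (p t) \<in> \<phi> ` (U \<inter> V)" using t(2) V(3) by blast
  have "Ck_on (Suc 0) (\<phi> ` (U \<inter> V)) ?T" by (rule chart_transition[OF U V(2)])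
  then have "?T differentiable (at (\<phi> (p t)) within \<phi> ` (U \<inter> V))"
    unfolding Ck_on.simps differentiable_on_def using pt by blast
  then have "?T differentiable (at (\<phi> (p t)))" by (simp only: at_within_open[OF pt op])
  then have T: "(?T has_derivative frechet_derivative ?T (at (\<phi> (p t)))) (at (\<phi> (p t)))"
    by (simp only: frechet_derivative_works)
  have "((\<lambda>s. ?T ((\<phi> \<circ> p) s)) has_derivative (\<lambda>s. frechet_derivative ?T (at (\<phi> (p t))) (s *\<^sub>R ?v))) (at t within {0..1})"
    by (rule has_derivative_compose[OF chart_path_has_derivative[OF p U t, unfolded has_vector_derivative_def]])
      (simp only: comp_apply[of \<phi> p t] T)
  then have deriv: "((\<lambda>s. ?T ((\<phi> \<circ> p) s)) has_vector_derivative frechet_derivative ?T (at (\<phi> (p t))) ?v) (at t within {0..1})"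
    by (simp only: has_vector_derivative_def linear_cmul[OF has_derivative_linear[OF T]])
  obtain G where G: "open G" "t \<in> G" "\<And>s. s \<in> {0..1} \<inter> G \<Longrightarrow> p s \<in> U"
    using path_nbhd[OF smooth_pathD(1,2)[OF p] chart_openin[OF U] t] by blast
  obtain e where e: "e > 0" "ball t e \<subseteq> G" using openE[OF G(1,2)] by blast
  have "((\<psi> \<circ> p) has_vector_derivative frechet_derivative ?T (at (\<phi> (p t))) ?v) (at t within {0..1})"
  proof (rule has_vector_derivative_transform_within[OF deriv e(1) t(1)])
    fix s assume "s \<in> {0..1}" "dist s t < e"
    then have "s \<in> {0..1} \<inter> G" using e(2) by (auto simp: dist_commute)
    then show "?T ((\<phi> \<circ> p) s) = (\<psi> \<circ> p) s" using chart_inv[OF U G(3)] by simp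
  qed
  then have "vector_derivative (\<psi> \<circ> p) (at t within {0..1}) = frechet_derivative ?T (at (\<phi> (p t))) ?v"
    by (rule vector_derivative_unit_interval[OF _ t(1)])
  moreover have "pullback A p w t = w (V, \<psi>) (\<psi> (p t)) (vector_derivative (\<psi> \<circ> p) (at t within {0..1}))"
    by (simp only: pullback_def Let_def c_def[symmetric] V(1) fst_conv snd_conv)
  ultimately have "pullback A p w t = w (V, \<psi>) (\<psi> (p t)) (frechet_derivative ?T (at (\<phi> (p t))) ?v)"
    by (simp only:)
  also have "\<dots> = w (U, \<phi>) (\<phi> (p t)) ?v"
  proof -
    have "\<forall>(U, \<phi>)\<in>A. \<forall>(V, \<psi>)\<in>A. \<forall>x\<in>U \<inter> V. \<forall>v. w (U, \<phi>) (\<phi> x) v =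
        w (V, \<psi>) (\<psi> x) (frechet_derivative (\<psi> \<circ> inv_into U \<phi>) (at (\<phi> x)) v)"
      using w[unfolded one_forms_def mem_Collect_eq] by (rule conjunct2)
    from bspec[OF this U] have "\<forall>(V, \<psi>)\<in>A. \<forall>x\<in>U \<inter> V. \<forall>v. w (U, \<phi>) (\<phi> x) v =
        w (V, \<psi>) (\<psi> x) (frechet_derivative (\<psi> \<circ> inv_into U \<phi>) (at (\<phi> x)) v)" by (simp only: prod.case)
    from bspec[OF this V(2)] have "\<forall>x\<in>U \<inter> V. \<forall>v. w (U, \<phi>) (\<phi> x) v =
        w (V, \<psi>) (\<psi> x) (frechet_derivative (\<psi> \<circ> inv_into U \<phi>) (at (\<phi> x)) v)" by (simp only: prod.case)
    then show ?thesis using t(2) V(3) by simp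
  qed
  finally show ?thesis .
qed

lemma one_formD:
  assumes "w \<in> one_forms A" "(U, \<phi>) \<in> A"
  shows "x \<in> \<phi> ` U \<Longrightarrow> linear (w (U, \<phi>) x)" "Ck_on k (\<phi> ` U) (\<lambda>x. w (U, \<phi>) x v)"
  using assms unfolding one_forms_def smooth_on_def by blast+

lemma pullback_continuous:
  assumes p: "p \<in> smooth_paths M A" and w: "w \<in> one_forms A"
  shows "continuous_on {0..1} (pullback A p w)"
proof (rule continuous_on_openin_cover)
  fix t :: real assume t: "t \<in> {0..1}"
  obtain U \<phi> where U: "(U, \<phi>) \<in> A" "p t \<in> U" using chart_exists smooth_pathD(3)[OF p t] by blast
  obtain G where G: "open G" "t \<in> G" "\<And>s. s \<in> {0..1} \<inter> G \<Longrightarrow> p s \<in> U"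
    using path_nbhd[OF smooth_pathD(1,2)[OF p] chart_openin[OF U(1)] t U(2)] by blast
  let ?S = "{0..1} \<inter> G"
  have fat: "fat ?S" by (intro fat_Int_open fat_unit_interval G)
  have Ck: "Ck_on k ?S (\<phi> \<circ> p)" for k
    by (rule smooth_path_Ck_on[OF p U(1) _ fat]) (use G in auto)
  obtain D where D: "\<And>s. s \<in> ?S \<Longrightarrow> ((\<phi> \<circ> p) has_derivative D s) (at s within ?S)" "\<And>v. Ck_on 0 ?S (\<lambda>s. D s v)"
    using Ck[of "Suc 0"] by (rule Ck_on_SucE) auto
  have "Ck_on 0 ?S (\<lambda>s. w (U, \<phi>) ((\<phi> \<circ> p) s) (D s 1))"
    by (rule Ck_on_linear_form[OF fat one_formD[OF w U(1)] Ck _ D(2)]) (use G in auto)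
  moreover have "pullback A p w s = w (U, \<phi>) ((\<phi> \<circ> p) s) (D s 1)" if s: "s \<in> ?S" for s
  proof -
    have "at s within ?S = at s within {0..1}" using s G by (intro at_within_nhd[of s G]) auto
    then have "((\<phi> \<circ> p) has_derivative D s) (at s within {0..1})"
      using D(1)[OF s] by (simp only:)
    moreover have "D s = (\<lambda>r. r *\<^sub>R D s 1)"
    proof
      fix r show "D s r = r *\<^sub>R D s 1"
        using linear_cmul[OF has_derivative_linear[OF D(1)[OF s]], of r 1] by simp
    qed
    ultimately have "((\<phi> \<circ> p) has_vector_derivative D s 1) (at s within {0..1})"
      unfolding has_vector_derivative_def by (rule has_derivative_eq_rhs)
    then have "vector_derivative (\<phi> \<circ> p) (at s within {0..1}) = D s 1"
      using s by (intro vector_derivative_unit_interval) auto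
    then show ?thesis
      using s G(3)[OF s] pullback_eq[OF p w U(1), of s] by simp
  qed
  ultimately have "Ck_on 0 ?S (pullback A p w)" by (rule Ck_on_eq)
  then show "\<exists>V. openin (top_of_set {0..1}) V \<and> t \<in> V \<and> continuous_on V (pullback A p w)"
    using t G by (intro exI[of _ ?S]) auto
qed

text \<open>Only agreement with the reparametrized path near \<open>t\<close> is required, so that
  the two halves of a smooth product can be treated separately.\<close>

lemma pullback_reparam:
  assumes p: "p \<in> smooth_paths M A" and q: "q \<in> smooth_paths M A" and w: "w \<in> one_forms A" and t: "t \<in> {0..1}"
    and G: "open G" "t \<in> G" "\<And>s. s \<in> {0..1} \<inter> G \<Longrightarrow> q s = p (\<alpha> s)"
    and \<alpha>: "(\<alpha> has_real_derivative d) (at t within {0..1})" "\<alpha> ` {0..1} \<subseteq> {0..1}"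
  shows "pullback A q w t = d *\<^sub>R pullback A p w (\<alpha> t)"
proof -
  have qt: "q t = p (\<alpha> t)" using G t by auto
  have \<alpha>t: "\<alpha> t \<in> {0..1}" using \<alpha>(2) t by blast
  obtain U \<phi> where U: "(U, \<phi>) \<in> A" "p (\<alpha> t) \<in> U" using chart_exists smooth_pathD(3)[OF p \<alpha>t] by blast
  let ?v = "vector_derivative (\<phi> \<circ> p) (at (\<alpha> t) within {0..1})"
  have "((\<phi> \<circ> p) has_vector_derivative ?v) (at (\<alpha> t) within \<alpha> ` {0..1})"
    by (rule has_vector_derivative_within_subset[OF chart_path_has_derivative[OF p U(1) \<alpha>t U(2)] \<alpha>(2)])
  then have deriv: "(((\<phi> \<circ> p) \<circ> \<alpha>) has_vector_derivative d *\<^sub>R ?v) (at t within {0..1})"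
    by (rule vector_diff_chain_within[OF \<alpha>(1)[unfolded has_real_derivative_iff_has_vector_derivative]])
  obtain e where e: "e > 0" "ball t e \<subseteq> G" using openE[OF G(1,2)] by blast
  have "((\<phi> \<circ> q) has_vector_derivative d *\<^sub>R ?v) (at t within {0..1})"
  proof (rule has_vector_derivative_transform_within[OF deriv e(1) t])
    fix s assume "s \<in> {0..1}" "dist s t < e"
    then have "s \<in> {0..1} \<inter> G" using e(2) by (auto simp: dist_commute)
    then show "((\<phi> \<circ> p) \<circ> \<alpha>) s = (\<phi> \<circ> q) s" using G(3) by simp
  qed
  then have "vector_derivative (\<phi> \<circ> q) (at t within {0..1}) = d *\<^sub>R ?v"
    by (rule vector_derivative_unit_interval[OF _ t])
  moreover have "linear (w (U, \<phi>) (\<phi> (p (\<alpha> t))))" by (rule one_formD(1)[OF w U(1)]) (use U in auto)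
  ultimately show ?thesis
    using pullback_eq[OF q w U(1) t] pullback_eq[OF p w U(1) \<alpha>t U(2)] U(2) by (simp add: qt linear_cmul)
qed

text \<open>In \<open>iter_int_concat\<close> the two reparametrizations are the affinely shifted
  step functions. Both equal 1 at time 1, so the factors are integrals over the full paths.\<close>

lemma iterated_integral_smooth_join:
  assumes p: "p \<in> smooth_paths M A" and q: "q \<in> smooth_paths M A" and pq: "pathfinish p = pathstart q"
    and ws: "set ws \<subseteq> one_forms A"
  shows "iterated_integral A ws (smooth_join p q) =
    (\<Sum>j\<le>length ws. iterated_integral A (take j ws) p * iterated_integral A (drop j ws) q)"
proof -
  obtain a' where a': "\<And>t. t \<in> {0..1} \<Longrightarrow> ((\<lambda>t. step (2 * t + 0)) has_real_derivative a' t) (at t within {0..1})"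
    using step_affine_has_derivative[of 2 0] by metis
  obtain b' where b': "\<And>t. t \<in> {0..1} \<Longrightarrow> ((\<lambda>t. step (2 * t + (- 1))) has_real_derivative b' t) (at t within {0..1})"
    using step_affine_has_derivative[of 2 "- 1"] by metis
  note r = smooth_join_smooth[OF p q pq]
  have loc0: "f' = 0" if f: "(f has_real_derivative f') (at t within {0..1})" and G: "open G" "t \<in> G"
    and c: "\<And>s. s \<in> {0..1} \<inter> G \<Longrightarrow> f s = c" and t: "t \<in> {0..1}" for f :: "real \<Rightarrow> real" and f' t G c
  proof -
    obtain e where e: "e > 0" "ball t e \<subseteq> G" using openE[OF G] by blast
    have "((\<lambda>_. c) has_real_derivative f') (at t within {0..1})"
    proof (rule has_field_derivative_transform_within[OF f e(1) t])
      fix s assume "s \<in> {0..1}" "dist s t < e"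
      then have "s \<in> {0..1} \<inter> G" using e(2) by (auto simp: dist_commute)
      then show "f s = c" by (rule c)
    qed
    then have "((\<lambda>_. c) has_vector_derivative f') (at t within {0..1})"
      by (simp add: has_real_derivative_iff_has_vector_derivative)
    moreover have "((\<lambda>_. c) has_vector_derivative 0) (at t within {0..1})" by simp
    ultimately show ?thesis using vector_derivative_unit_interval[OF _ t] by metis
  qed
  \<comment> \<open>The first step function is 1 from 3/8 on, the second is 0 up to 5/8. These
    ranges overlap, so at every time at least one derivative vanishes.\<close>
  have a0: "a' t = 0" if "t \<in> {0..1}" "3 / 8 < t" for t
    by (rule loc0[OF a'[OF that(1)], of "{3/8<..}" 1]) (use that in \<open>auto simp: step\<close>)
  have b0: "b' t = 0" if "t \<in> {0..1}" "t < 5 / 8" for t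
    by (rule loc0[OF b'[OF that(1)], of "{..<5/8}" 0]) (use that in \<open>auto simp: step\<close>)
  have "iter_int (pullback A (smooth_join p q)) ws 1 =
      (\<Sum>j\<le>length ws. iter_int (pullback A p) (take j ws) (step (2 * 1 + 0)) * iter_int (pullback A q) (drop j ws) (step (2 * 1 + (- 1))))"
  proof (rule iter_int_concat[OF _ _ a' _ _ b'])
    show "continuous_on {0..1} (pullback A p w)" "continuous_on {0..1} (pullback A q w)" if "w \<in> set ws" for w
      using pullback_continuous[OF p] pullback_continuous[OF q] ws that by auto
    \<comment> \<open>If the first factor still moves then \<open>t \<le> 3 / 8\<close>, and the
      argument of the second step is negative.\<close>
    show "a' t = 0 \<or> step (2 * t + (- 1)) = 0" if "t \<in> {0..1}" for t
      using a0[OF that] step(2)[of "2 * t + (- 1)"] by (cases "t > 3 / 8") auto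
  next
    fix w t assume w: "w \<in> set ws" and t: "t \<in> {0..1::real}"
    have w': "w \<in> one_forms A" using ws w by blast
    show "pullback A (smooth_join p q) w t = a' t *\<^sub>R pullback A p w (step (2 * t + 0)) + b' t *\<^sub>R pullback A q w (step (2 * t + (- 1)))"
    proof (cases "t < 1 / 2")
      case True
      have "pullback A (smooth_join p q) w t = a' t *\<^sub>R pullback A p w (step (2 * t + 0))"
        by (rule pullback_reparam[OF p r w' t, of "{..<1/2}" "\<lambda>t. step (2 * t + 0)"])
          (use True a'[OF t] smooth_join_left[of _ p q] in \<open>auto simp: step\<close>)
      then show ?thesis using b0[OF t] True by simp
    next
      case False
      have "pullback A (smooth_join p q) w t = b' t *\<^sub>R pullback A q w (step (2 * t + (- 1)))"
        by (rule pullback_reparam[OF q r w' t, of "{3/8<..}" "\<lambda>t. step (2 * t + (- 1))"])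
          (use False b'[OF t] smooth_join_right[OF pq] in \<open>auto simp: step\<close>)
      then show ?thesis using a0[OF t] False by simp
    qed
  qed (auto simp: step)
  then show ?thesis by (simp add: iterated_integral_eq step)
qed

end

section \<open>Iterated integrals along radial paths in a chart\<close>

text \<open>The integral along the straight segment from \<open>a\<close> to \<open>a + v\<close> in
  the chart \<open>c\<close>, whose velocity is the constant \<open>v\<close>.\<close>

definition radial_integral :: "('a, 'e::real_normed_vector) chart \<Rightarrow> 'e \<Rightarrow> ('a, 'e) one_form list \<Rightarrow> 'e \<Rightarrow> complex" where
  "radial_integral c a ws v = iter_int (\<lambda>w t. w c (a + t *\<^sub>R v) v) ws 1"

context smooth_mfd
begin

context
  fixes U \<phi> a r assumes chart: "(U, \<phi>) \<in> A" and ball: "ball a r \<subseteq> \<phi> ` U"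
begin

lemma in_radial_ball:
  assumes "v \<in> ball 0 r" "t \<in> {0..1}"
  shows "t *\<^sub>R v \<in> ball 0 r" "a + t *\<^sub>R v \<in> \<phi> ` U"
proof -
  have "\<bar>t\<bar> * norm v \<le> 1 * norm v" using assms(2) by (intro mult_right_mono) auto
  then show "t *\<^sub>R v \<in> ball 0 r" using assms(1) by simp
  then show "a + t *\<^sub>R v \<in> \<phi> ` U" using ball by (auto simp: dist_norm subset_iff)
qed

lemma iterated_integral_radial:
  assumes v: "v \<in> ball 0 r" and ws: "set ws \<subseteq> one_forms A"
  shows "(\<lambda>t. inv_into U \<phi> (a + t *\<^sub>R v)) \<in> smooth_paths M A"
    and "iterated_integral A ws (\<lambda>t. inv_into U \<phi> (a + t *\<^sub>R v)) = radial_integral (U, \<phi>) a ws v"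
proof -
  let ?l = "\<lambda>t. inv_into U \<phi> (a + t *\<^sub>R v)"
  have l: "?l \<in> smooth_paths M A" and lU: "\<And>t. t \<in> {0..1} \<Longrightarrow> ?l t \<in> U"
    and \<phi>l: "\<And>t. t \<in> {0..1} \<Longrightarrow> \<phi> (?l t) = a + t *\<^sub>R v"
    using smooth_path_chart_line[OF chart, of a r v] ball v by (auto simp: dist_norm)
  show "?l \<in> smooth_paths M A" by (rule l)
  have "pullback A ?l w t = w (U, \<phi>) (a + t *\<^sub>R v) v" if w: "w \<in> set ws" and t: "t \<in> {0..1}" for w t
  proof -
    have d: "((\<lambda>t. a + t *\<^sub>R v) has_vector_derivative v) (at t within {0..1})"
      by (auto intro!: derivative_eq_intros)
    have "((\<phi> \<circ> ?l) has_vector_derivative v) (at t within {0..1})"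
      by (rule has_vector_derivative_transform_within[OF d zero_less_one t]) (simp add: \<phi>l)
    then have "vector_derivative (\<phi> \<circ> ?l) (at t within {0..1}) = v"
      by (rule vector_derivative_unit_interval[OF _ t])
    then show ?thesis using pullback_eq[OF l _ chart t lU[OF t], of w] w ws \<phi>l[OF t] by auto
  qed
  then show "iterated_integral A ws ?l = radial_integral (U, \<phi>) a ws v"
    unfolding iterated_integral_eq radial_integral_def by (intro iter_int_cong) auto
qed

lemma radial_form_continuous:
  assumes "v \<in> ball 0 r" "w \<in> one_forms A"
  shows "continuous_on {0..1} (\<lambda>t. w (U, \<phi>) (a + t *\<^sub>R v) v)"
proof -
  have "Ck_on 0 {0..1} (\<lambda>t. w (U, \<phi>) (a + t *\<^sub>R v) v)"
    by (rule Ck_on_linear_form[OF fat_unit_interval one_formD[OF assms(2) chart]])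
      (use in_radial_ball[OF assms(1)] in \<open>auto intro!: continuous_intros\<close>)
  then show ?thesis by simp
qed

text \<open>The segment stopped at time \<open>u\<close> is a reparametrization of the segment with
  direction \<open>u *\<^sub>R v\<close>. So the inner integral is the radial integral of the
  shorter list at \<open>u *\<^sub>R v\<close>.\<close>

lemma radial_integral_snoc:
  assumes v: "v \<in> ball 0 r" and ws: "set (ws @ [w]) \<subseteq> one_forms A"
  shows "radial_integral (U, \<phi>) a (ws @ [w]) v =
    integral {0..1} (\<lambda>u. radial_integral (U, \<phi>) a ws (u *\<^sub>R v) * w (U, \<phi>) (a + u *\<^sub>R v) v)"
proof -
  let ?f = "\<lambda>v w t. w (U, \<phi>) (a + t *\<^sub>R v) v"
  have "iter_int (?f v) ws u = radial_integral (U, \<phi>) a ws (u *\<^sub>R v)" if u: "u \<in> {0..1}" for u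
  proof -
    have "iter_int (?f (u *\<^sub>R v)) ws 1 = iter_int (?f v) ws (u * 1)"
    proof (rule iter_int_reparam[where \<alpha> = "\<lambda>t. u * t" and \<alpha>' = "\<lambda>_. u"])
      show "continuous_on {0..1} (?f v w)" if "w \<in> set ws" for w
        using radial_form_continuous[OF v] ws that by auto
      show "(\<lambda>t. u * t) ` {0..1} \<subseteq> {0..1}" using u by (auto simp: mult_le_one)
      fix w t assume w: "w \<in> set ws" and t: "t \<in> {0..1::real}"
      have "linear (w (U, \<phi>) (a + (u * t) *\<^sub>R v))"
        by (rule one_formD(1)[OF _ chart]) (use w ws in_radial_ball(2)[OF v, of "u * t"] u t in \<open>auto simp: mult_le_one\<close>)
      then show "?f (u *\<^sub>R v) w t = u *\<^sub>R ?f v w (u * t)"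
        by (simp add: linear_cmul mult.commute)
    qed (auto intro!: derivative_eq_intros)
    then show ?thesis by (simp add: radial_integral_def)
  qed
  then show ?thesis
    unfolding radial_integral_def[of _ _ "ws @ [w]"] iter_int_snoc by (intro integral_cong) simp
qed

text \<open>In the recursion the last form is evaluated in the direction \<open>v\<close>, which
  also varies. In coordinates the integral becomes a sum of \<open>coord b v\<close> times radial
  averages of functions \<open>g b\<close> with \<open>b\<close> fixed.\<close>

lemma radial_integral_Ck_on:
  assumes "set ws \<subseteq> one_forms A"
  shows "Ck_on k (ball 0 r) (radial_integral (U, \<phi>) a ws)"
  using assms
proof (induction ws rule: rev_induct)
  case Nil
  show ?case
    using Ck_on_const[OF fat_open[OF open_ball]] by (simp add: radial_integral_def[abs_def])
next
  case (snoc w ws)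
  let ?B = "ball (0::'e) r"
  have fat: "fat ?B" by (rule fat_open[OF open_ball])
  have w: "w \<in> one_forms A" and ws: "set ws \<subseteq> one_forms A" using snoc.prems by auto
  define g where "g b x = radial_integral (U, \<phi>) a ws x * w (U, \<phi>) (a + x) b" for b x
  have g: "Ck_on k ?B (g b)" for b
  proof -
    have "Ck_on k ?B (\<lambda>x. w (U, \<phi>) (a + x) b)"
    proof (rule Ck_on_comp[OF fat _ one_formD(2)[OF w chart]])
      show "Ck_on k ?B (\<lambda>x. a + x)" by (intro Ck_on_add Ck_on_const Ck_on_id fat)
      show "(\<lambda>x. a + x) ` ?B \<subseteq> \<phi> ` U"
      proof (rule image_subsetI)
        fix x assume "x \<in> ?B"
        then show "a + x \<in> \<phi> ` U" using in_radial_ball(2)[of x 1] by simp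
      qed
    qed
    then show ?thesis unfolding g_def by (intro Ck_on_mult fat snoc.IH ws)
  qed
  \<comment> \<open>The factor \<open>u ^ 0\<close> makes each integral an instance of
    \<open>Ck_on_radial_integral\<close> with exponent 0.\<close>
  have "Ck_on k ?B (\<lambda>v. \<Sum>b\<in>E. coord b v *\<^sub>R integral {0..1} (\<lambda>u. u ^ 0 *\<^sub>R g b (u *\<^sub>R v)))"
    by (intro Ck_on_sum fat Ck_on_scaleR Ck_on_bounded_linear coord Ck_on_radial_integral g)
  then show ?case
  proof (rule Ck_on_eq)
    fix v assume v: "v \<in> ?B"
    have int: "(\<lambda>u. coord b v *\<^sub>R g b (u *\<^sub>R v)) integrable_on {0..1}" for b
    proof (rule integrable_continuous_real)
      have "continuous_on ?B (g b)" using g by (rule Ck_on_imp_continuous_on)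
      then have "continuous_on {0..1} (\<lambda>u. g b (u *\<^sub>R v))"
        by (rule continuous_on_compose2) (use in_radial_ball(1)[OF v] in \<open>auto intro!: continuous_intros\<close>)
      then show "continuous_on {0..1} (\<lambda>u. coord b v *\<^sub>R g b (u *\<^sub>R v))" by (intro continuous_intros)
    qed
    have "radial_integral (U, \<phi>) a (ws @ [w]) v =
        integral {0..1} (\<lambda>u. radial_integral (U, \<phi>) a ws (u *\<^sub>R v) * w (U, \<phi>) (a + u *\<^sub>R v) v)"
      by (rule radial_integral_snoc[OF v snoc.prems])
    also have "\<dots> = integral {0..1} (\<lambda>u. \<Sum>b\<in>E. coord b v *\<^sub>R g b (u *\<^sub>R v))"
    proof (rule integral_cong)
      fix u :: real assume "u \<in> {0..1}"
      then have "w (U, \<phi>) (a + u *\<^sub>R v) v = (\<Sum>b\<in>E. coord b v *\<^sub>R w (U, \<phi>) (a + u *\<^sub>R v) b)"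
        using in_radial_ball(2)[OF v] by (intro linear_coord_sum one_formD(1)[OF w chart]) auto
      then show "radial_integral (U, \<phi>) a ws (u *\<^sub>R v) * w (U, \<phi>) (a + u *\<^sub>R v) v = (\<Sum>b\<in>E. coord b v *\<^sub>R g b (u *\<^sub>R v))"
        by (simp add: g_def sum_distrib_left)
    qed
    also have "\<dots> = (\<Sum>b\<in>E. integral {0..1} (\<lambda>u. coord b v *\<^sub>R g b (u *\<^sub>R v)))"
      by (rule integral_sum[OF finite_E int])
    finally show "radial_integral (U, \<phi>) a (ws @ [w]) v =
        (\<Sum>b\<in>E. coord b v *\<^sub>R integral {0..1} (\<lambda>u. u ^ 0 *\<^sub>R g b (u *\<^sub>R v)))"
      by simp
  qed
qed

end

section \<open>Connecting points by smooth paths\<close>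

lemma chart_ball_nbhd:
  assumes W: "openin (top_of_set M) W" and x: "x \<in> W"
  obtains U \<phi> r where "(U, \<phi>) \<in> A" "x \<in> U" "r > 0" "ball (\<phi> x) r \<subseteq> \<phi> ` (U \<inter> W)"
    "openin (top_of_set M) (U \<inter> \<phi> -` ball (\<phi> x) r)" "U \<inter> \<phi> -` ball (\<phi> x) r \<subseteq> W"
proof -
  have "x \<in> M" using W x openin_imp_subset by blast
  then obtain U \<phi> where U: "(U, \<phi>) \<in> A" "x \<in> U" by (rule chart_exists)
  have op: "open (\<phi> ` (U \<inter> W))" by (rule chart_open_Int[OF U(1) W])
  have "\<phi> x \<in> \<phi> ` (U \<inter> W)" using U(2) x by blast
  then obtain r where r: "r > 0" "ball (\<phi> x) r \<subseteq> \<phi> ` (U \<inter> W)" using openE[OF op] by blast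
  have "openin (top_of_set U) (U \<inter> \<phi> -` ball (\<phi> x) r)"
    by (rule continuous_openin_preimage_gen[OF chart_continuous(1)[OF U(1)] open_ball])
  then have o: "openin (top_of_set M) (U \<inter> \<phi> -` ball (\<phi> x) r)"
    using chart_openin[OF U(1)] openin_trans by blast
  have "y \<in> W" if y: "y \<in> U" "\<phi> y \<in> ball (\<phi> x) r" for y
  proof -
    obtain z where z: "z \<in> U \<inter> W" "\<phi> y = \<phi> z" using r(2) y(2) by blast
    then have "y = z" using chart_inv[OF U(1)] y(1) by (metis IntD1)
    then show ?thesis using z by blast
  qed
  then have "U \<inter> \<phi> -` ball (\<phi> x) r \<subseteq> W" by blast
  with U r o show ?thesis by (rule that)
qed

lemma locally_path_connected:
  assumes W: "openin (top_of_set M) W" and x: "x \<in> W"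
  shows "\<exists>V. openin (top_of_set M) V \<and> x \<in> V \<and> V \<subseteq> W \<and> path_connected V"
proof -
  obtain U \<phi> r where U: "(U, \<phi>) \<in> A" "x \<in> U" "r > 0" "ball (\<phi> x) r \<subseteq> \<phi> ` (U \<inter> W)"
    "openin (top_of_set M) (U \<inter> \<phi> -` ball (\<phi> x) r)" "U \<inter> \<phi> -` ball (\<phi> x) r \<subseteq> W"
    by (rule chart_ball_nbhd[OF W x])
  have sub: "ball (\<phi> x) r \<subseteq> \<phi> ` U" using U(4) by blast
  have "path_connected (inv_into U \<phi> ` ball (\<phi> x) r)"
    by (intro path_connected_continuous_image continuous_on_subset[OF chart_continuous(2)[OF U(1)] sub]
        convex_imp_path_connected convex_ball)
  also have "inv_into U \<phi> ` ball (\<phi> x) r = U \<inter> \<phi> -` ball (\<phi> x) r"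
  proof
    show "inv_into U \<phi> ` ball (\<phi> x) r \<subseteq> U \<inter> \<phi> -` ball (\<phi> x) r"
      using sub by (auto simp: inv_into_into f_inv_into_f subset_iff)
    show "U \<inter> \<phi> -` ball (\<phi> x) r \<subseteq> inv_into U \<phi> ` ball (\<phi> x) r"
      using chart_inv[OF U(1)] by (metis (no_types, lifting) IntD1 IntD2 image_eqI subsetI vimageD)
  qed
  finally show ?thesis using U by (intro exI[of _ "U \<inter> \<phi> -` ball (\<phi> x) r"]) auto
qed

text \<open>Being joined by a smooth path is an equivalence relation, transitive by
  \<open>smooth_join\<close>, and its classes are open because segments in a chart reach a whole
  ball.\<close>

lemma smooth_path_connected:
  assumes "connected M" "x \<in> M" "y \<in> M"
  shows "\<exists>p\<in>smooth_paths M A. pathstart p = x \<and> pathfinish p = y"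
proof (rule connected_equivalence_relation[OF assms, where R = "\<lambda>x y. \<exists>p\<in>smooth_paths M A. pathstart p = x \<and> pathfinish p = y"])
  fix x y assume "\<exists>p\<in>smooth_paths M A. pathstart p = x \<and> pathfinish p = y"
  then show "\<exists>p\<in>smooth_paths M A. pathstart p = y \<and> pathfinish p = x"
    using smooth_path_reverse pathstart_reversepath pathfinish_reversepath by metis
next
  fix x y z assume "\<exists>p\<in>smooth_paths M A. pathstart p = x \<and> pathfinish p = y"
    "\<exists>p\<in>smooth_paths M A. pathstart p = y \<and> pathfinish p = z"
  then obtain p q where "p \<in> smooth_paths M A" "pathstart p = x" "pathfinish p = y"
    "q \<in> smooth_paths M A" "pathstart q = y" "pathfinish q = z" by blast
  then show "\<exists>p\<in>smooth_paths M A. pathstart p = x \<and> pathfinish p = z"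
    using smooth_join_smooth by (intro bexI[of _ "smooth_join p q"]) auto
next
  fix x assume x: "x \<in> M"
  obtain U \<phi> r where U: "(U, \<phi>) \<in> A" "x \<in> U" "r > 0" "ball (\<phi> x) r \<subseteq> \<phi> ` (U \<inter> M)"
    "openin (top_of_set M) (U \<inter> \<phi> -` ball (\<phi> x) r)"
    using chart_ball_nbhd[OF openin_subtopology_self x] by metis
  have sub: "ball (\<phi> x) r \<subseteq> \<phi> ` U" using U(4) by blast
  have "\<exists>p\<in>smooth_paths M A. pathstart p = x \<and> pathfinish p = y" if y: "y \<in> U \<inter> \<phi> -` ball (\<phi> x) r" for y
  proof
    let ?l = "\<lambda>t. inv_into U \<phi> (\<phi> x + t *\<^sub>R (\<phi> y - \<phi> x))"
    have "\<phi> y - \<phi> x \<in> ball 0 r" using y by (simp add: dist_norm norm_minus_commute)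
    then show "?l \<in> smooth_paths M A"
      by (rule iterated_integral_radial(1)[OF U(1) sub, of _ "[]"]) simp
    show "pathstart ?l = x \<and> pathfinish ?l = y"
      using chart_inv[OF U(1)] U(2) y by (simp add: pathstart_def pathfinish_def)
  qed
  then show "\<exists>T. openin (top_of_set M) T \<and> x \<in> T \<and> (\<forall>y\<in>T. \<exists>p\<in>smooth_paths M A. pathstart p = x \<and> pathfinish p = y)"
    using U by (intro exI[of _ "U \<inter> \<phi> -` ball (\<phi> x) r"]) auto
qed

text \<open>The map \<open>f\<close> may change with the parameter. This serves for lifts, where the
  local inverses of a covering do not fit together to a global map.\<close>

lemma smooth_path_map:
  fixes M' :: "'b::topological_space set"
  assumes M': "smooth_mfd E coord M' A'" and p: "p \<in> smooth_paths M A" and r: "path r" "path_image r \<subseteq> M'"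
    and loc: "\<And>t. t \<in> {0..1} \<Longrightarrow> \<exists>G W f. open G \<and> t \<in> G \<and> smooth_map W A A' f \<and> (\<forall>s\<in>{0..1} \<inter> G. p s \<in> W \<and> r s = f (p s))"
  shows "r \<in> smooth_paths M' A'"
proof (rule smooth_mfd.smooth_pathI[OF M' r])
  fix t :: real assume t: "t \<in> {0..1}"
  obtain G W f where G: "open G" "t \<in> G" and f: "smooth_map W A A' f"
    and pW: "\<And>s. s \<in> {0..1} \<inter> G \<Longrightarrow> p s \<in> W \<and> r s = f (p s)"
    using loc[OF t] by metis
  obtain U \<phi> where U: "(U, \<phi>) \<in> A" "p t \<in> U" using chart_exists smooth_pathD(3)[OF p t] by blast
  have "r t \<in> M'" using r(2) t unfolding path_image_def by blast
  then obtain V \<psi> where V: "(V, \<psi>) \<in> A'" "r t \<in> V" by (rule smooth_mfd.chart_exists[OF M'])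
  obtain G1 where G1: "open G1" "t \<in> G1" "\<And>s. s \<in> {0..1} \<inter> G1 \<Longrightarrow> p s \<in> U"
    using path_nbhd[OF smooth_pathD(1,2)[OF p] chart_openin[OF U(1)] t U(2)] by blast
  obtain G2 where G2: "open G2" "t \<in> G2" "\<And>s. s \<in> {0..1} \<inter> G2 \<Longrightarrow> r s \<in> V"
    using path_nbhd[OF r smooth_mfd.chart_openin[OF M' V(1)] t V(2)] by blast
  let ?S = "{0..1} \<inter> (G \<inter> G1 \<inter> G2)"
  have fat: "fat ?S" by (intro fat_Int_open fat_unit_interval open_Int G G1 G2)
  have s: "p s \<in> U" "p s \<in> W" "r s = f (p s)" "f (p s) \<in> V" if "s \<in> ?S" for s
  proof -
    show "p s \<in> U" using G1(3)[of s] that by blast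
    show "p s \<in> W" using pW[of s] that by blast
    show e: "r s = f (p s)" using pW[of s] that by blast
    show "f (p s) \<in> V" using G2(3)[of s] that unfolding e by blast
  qed
  have "Ck_on k ?S (\<psi> \<circ> r)" for k
  proof (rule Ck_on_eq)
    show "Ck_on k ?S (\<lambda>s. (\<psi> \<circ> f \<circ> inv_into U \<phi>) ((\<phi> \<circ> p) s))"
    proof (rule Ck_on_comp[OF fat, where f = "\<phi> \<circ> p" and g = "\<psi> \<circ> f \<circ> inv_into U \<phi>" and T = "\<phi> ` (U \<inter> W \<inter> f -` V)"])
      show "Ck_on k ?S (\<phi> \<circ> p)"
      proof (rule smooth_path_Ck_on[OF p U(1) _ fat])
        show "p ` ?S \<subseteq> U" using s(1) by blast
      qed blast
      show "Ck_on k (\<phi> ` (U \<inter> W \<inter> f -` V)) (\<psi> \<circ> f \<circ> inv_into U \<phi>)"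
      proof -
        have "\<forall>(U, \<phi>)\<in>A. \<forall>(V, \<psi>)\<in>A'. smooth_on (\<phi> ` (U \<inter> W \<inter> f -` V)) (\<psi> \<circ> f \<circ> inv_into U \<phi>)"
          using f[unfolded smooth_map_def] by (rule conjunct2)
        from bspec[OF this U(1)] have "\<forall>(V, \<psi>)\<in>A'. smooth_on (\<phi> ` (U \<inter> W \<inter> f -` V)) (\<psi> \<circ> f \<circ> inv_into U \<phi>)"
          by (simp only: prod.case)
        from bspec[OF this V(1)] show ?thesis by (simp add: smooth_on_def)
      qed
      show "(\<phi> \<circ> p) ` ?S \<subseteq> \<phi> ` (U \<inter> W \<inter> f -` V)"
      proof (rule image_subsetI)
        fix u assume "u \<in> ?S"
        from s(1,2,4)[OF this] show "(\<phi> \<circ> p) u \<in> \<phi> ` (U \<inter> W \<inter> f -` V)" by simp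
      qed
    qed
    fix u assume u: "u \<in> ?S"
    show "(\<psi> \<circ> r) u = (\<psi> \<circ> f \<circ> inv_into U \<phi>) ((\<phi> \<circ> p) u)"
      using s(3)[OF u] chart_inv[OF U(1) s(1)[OF u]] by simp
  qed
  moreover have "r ` ?S \<subseteq> V" using s(3,4) by auto
  ultimately show "\<exists>V \<psi> G. (V, \<psi>) \<in> A' \<and> open G \<and> t \<in> G \<and> r ` ({0..1} \<inter> G) \<subseteq> V \<and> (\<forall>k. Ck_on k ({0..1} \<inter> G) (\<psi> \<circ> r))"
    using V G G1 G2 by (intro exI[of _ V] exI[of _ \<psi>] exI[of _ "G \<inter> G1 \<inter> G2"]) auto
qed

end

section \<open>Functions of finite order under a group action\<close>

lemma ring_record_simps [simp]:
  "carrier (group_ring G) = {a. finite {g. a g \<noteq> 0} \<and> {g. a g \<noteq> 0} \<subseteq> carrier G}"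
  "a \<oplus>\<^bsub>group_ring G\<^esub> b = (\<lambda>k. a k + b k)"
  by (simp_all add: group_ring_def)

locale function_action = group G for G :: "('g, 'm) monoid_scheme" (structure) +
  fixes N :: "'b set" and d :: "'g \<Rightarrow> 'b \<Rightarrow> 'b"
  assumes d_closed: "\<gamma> \<in> carrier G \<Longrightarrow> x \<in> N \<Longrightarrow> d \<gamma> x \<in> N"
    and d_mult: "\<gamma> \<in> carrier G \<Longrightarrow> \<delta> \<in> carrier G \<Longrightarrow> x \<in> N \<Longrightarrow> d (\<gamma> \<otimes> \<delta>) x = d \<gamma> (d \<delta> x)"
    and d_one: "x \<in> N \<Longrightarrow> d \<one> x = x"
begin

definition act :: "'g \<Rightarrow> ('b \<Rightarrow> complex) \<Rightarrow> 'b \<Rightarrow> complex" where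
  "act \<gamma> f x = (if x \<in> N then f (d (inv \<gamma>) x) else 0)"

definition lin_act :: "('g \<Rightarrow> int) \<Rightarrow> ('b \<Rightarrow> complex) \<Rightarrow> 'b \<Rightarrow> complex" where
  "lin_act a f x = (\<Sum>\<gamma> | a \<gamma> \<noteq> 0. of_int (a \<gamma>) * act \<gamma> f x)"

text \<open>The filtration level \<open>m\<close> asks every product of \<open>m\<close> operators
  \<open>act \<gamma> - 1\<close> to annihilate the function. It tests single group elements, as an
  induction that strips one form at a time provides them, and it does not involve
  smoothness.\<close>

primrec filtration :: "nat \<Rightarrow> ('b \<Rightarrow> complex) set" where
  "filtration 0 = {\<lambda>_. 0}"
| "filtration (Suc m) = {f. (\<forall>x. x \<notin> N \<longrightarrow> f x = 0) \<and> (\<forall>\<gamma>\<in>carrier G. (\<lambda>x. act \<gamma> f x - f x) \<in> filtration m)}"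

lemma act_act:
  assumes "\<gamma> \<in> carrier G" "\<delta> \<in> carrier G" shows "act \<gamma> (act \<delta> f) = act (\<gamma> \<otimes> \<delta>) f"
  using assms by (auto simp: act_def fun_eq_iff inv_mult_group d_mult d_closed)

lemma act_one: "(\<And>x. x \<notin> N \<Longrightarrow> f x = 0) \<Longrightarrow> act \<one> f = f"
  by (auto simp: act_def fun_eq_iff d_one)

lemma lin_act_eq_sum:
  assumes "finite S" "{\<gamma>. a \<gamma> \<noteq> 0} \<subseteq> S"
  shows "lin_act a f x = (\<Sum>\<gamma>\<in>S. of_int (a \<gamma>) * act \<gamma> f x)"
  unfolding lin_act_def using assms by (intro sum.mono_neutral_left) auto

lemma lin_act_add:
  assumes a: "a \<in> carrier (group_ring G)" and b: "b \<in> carrier (group_ring G)"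
  shows "lin_act (\<lambda>k. a k + b k) f = (\<lambda>x. lin_act a f x + lin_act b f x)"
proof
  fix x
  let ?S = "{\<gamma>. a \<gamma> \<noteq> 0} \<union> {\<gamma>. b \<gamma> \<noteq> 0}"
  have fin: "finite ?S" using a b by simp
  have "lin_act (\<lambda>k. a k + b k) f x = (\<Sum>\<gamma>\<in>?S. of_int (a \<gamma> + b \<gamma>) * act \<gamma> f x)"
    by (rule lin_act_eq_sum[OF fin]) auto
  also have "\<dots> = (\<Sum>\<gamma>\<in>?S. of_int (a \<gamma>) * act \<gamma> f x) + (\<Sum>\<gamma>\<in>?S. of_int (b \<gamma>) * act \<gamma> f x)"
    by (simp add: distrib_right sum.distrib)
  also have "\<dots> = lin_act a f x + lin_act b f x"
    using lin_act_eq_sum[OF fin, of a f x] lin_act_eq_sum[OF fin, of b f x] by auto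
  finally show "lin_act (\<lambda>k. a k + b k) f x = lin_act a f x + lin_act b f x" .
qed

lemma group_ring_mult:
  "a \<otimes>\<^bsub>group_ring G\<^esub> b = (\<lambda>k. \<Sum>g | a g \<noteq> 0. \<Sum>h | b h \<noteq> 0. if g \<otimes> h = k then a g * b h else 0)"
  by (simp add: group_ring_def)

lemma group_ring_mult_support:
  "{k. (a \<otimes>\<^bsub>group_ring G\<^esub> b) k \<noteq> 0} \<subseteq> (\<lambda>(g, h). g \<otimes> h) ` ({g. a g \<noteq> 0} \<times> {h. b h \<noteq> 0})"
proof
  fix k assume "k \<in> {k. (a \<otimes>\<^bsub>group_ring G\<^esub> b) k \<noteq> 0}"
  then have "(\<Sum>g | a g \<noteq> 0. \<Sum>h | b h \<noteq> 0. if g \<otimes> h = k then a g * b h else 0) \<noteq> 0"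
    by (simp add: group_ring_mult)
  then obtain g where g: "g \<in> {g. a g \<noteq> 0}" "(\<Sum>h | b h \<noteq> 0. if g \<otimes> h = k then a g * b h else 0) \<noteq> 0"
    by (rule sum.not_neutral_contains_not_neutral)
  from g(2) obtain h where "h \<in> {h. b h \<noteq> 0}" "(if g \<otimes> h = k then a g * b h else 0) \<noteq> 0"
    by (rule sum.not_neutral_contains_not_neutral)
  then show "k \<in> (\<lambda>(g, h). g \<otimes> h) ` ({g. a g \<noteq> 0} \<times> {h. b h \<noteq> 0})"
    using g(1) by (auto split: if_splits)
qed

lemma group_ring_mult_closed:
  assumes a: "a \<in> carrier (group_ring G)" and b: "b \<in> carrier (group_ring G)"
  shows "a \<otimes>\<^bsub>group_ring G\<^esub> b \<in> carrier (group_ring G)"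
proof -
  let ?P = "(\<lambda>(g, h). g \<otimes> h) ` ({g. a g \<noteq> 0} \<times> {h. b h \<noteq> 0})"
  have "finite ?P" using a b by simp
  moreover have "?P \<subseteq> carrier G" using a b by auto
  ultimately show ?thesis
    using group_ring_mult_support[of a b] finite_subset by auto
qed

lemma lin_act_mult:
  assumes a: "a \<in> carrier (group_ring G)" and b: "b \<in> carrier (group_ring G)"
  shows "lin_act (a \<otimes>\<^bsub>group_ring G\<^esub> b) f = lin_act a (lin_act b f)"
proof
  fix x
  let ?A = "{g. a g \<noteq> 0}" and ?B = "{h. b h \<noteq> 0}"
  let ?P = "(\<lambda>(g, h). g \<otimes> h) ` (?A \<times> ?B)"
  have fin: "finite ?A" "finite ?B" "finite ?P" and sub: "?A \<subseteq> carrier G" "?B \<subseteq> carrier G" using a b by auto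
  have "lin_act (a \<otimes>\<^bsub>group_ring G\<^esub> b) f x = (\<Sum>k\<in>?P. of_int ((a \<otimes>\<^bsub>group_ring G\<^esub> b) k) * act k f x)"
    by (rule lin_act_eq_sum[OF fin(3) group_ring_mult_support])
  also have "\<dots> = (\<Sum>k\<in>?P. \<Sum>g\<in>?A. \<Sum>h\<in>?B. if g \<otimes> h = k then of_int (a g) * of_int (b h) * act k f x else 0)"
    unfolding group_ring_mult by (simp add: sum_distrib_right if_distrib[of of_int] if_distrib[of "\<lambda>z. z * _"] cong: if_cong)
  also have "\<dots> = (\<Sum>g\<in>?A. \<Sum>k\<in>?P. \<Sum>h\<in>?B. if g \<otimes> h = k then of_int (a g) * of_int (b h) * act k f x else 0)"
    by (rule sum.swap)
  also have "\<dots> = (\<Sum>g\<in>?A. \<Sum>h\<in>?B. \<Sum>k\<in>?P. if g \<otimes> h = k then of_int (a g) * of_int (b h) * act k f x else 0)"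
    by (intro sum.cong refl sum.swap)
  also have "\<dots> = (\<Sum>g\<in>?A. \<Sum>h\<in>?B. of_int (a g) * of_int (b h) * act (g \<otimes> h) f x)"
    using fin(3) by (intro sum.cong refl) (subst sum.delta', auto)
  also have "\<dots> = (\<Sum>g\<in>?A. of_int (a g) * act g (lin_act b f) x)"
  proof (intro sum.cong refl)
    fix g assume g: "g \<in> ?A"
    have "act g (lin_act b f) x = (\<Sum>h\<in>?B. of_int (b h) * act g (act h f) x)"
      by (simp add: act_def[of g] lin_act_def)
    also have "\<dots> = (\<Sum>h\<in>?B. of_int (b h) * act (g \<otimes> h) f x)"
    proof (intro sum.cong refl)
      fix h assume "h \<in> ?B"
      then have "g \<in> carrier G" "h \<in> carrier G" using g sub by blast+
      then show "of_int (b h) * act g (act h f) x = of_int (b h) * act (g \<otimes> h) f x" by (simp add: act_act)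
    qed
    finally show "(\<Sum>h\<in>?B. of_int (a g) * of_int (b h) * act (g \<otimes> h) f x) = of_int (a g) * act g (lin_act b f) x"
      by (simp add: sum_distrib_left mult.assoc)
  qed
  finally show "lin_act (a \<otimes>\<^bsub>group_ring G\<^esub> b) f x = lin_act a (lin_act b f) x"
    by (simp add: lin_act_def[of a])
qed

section \<open>Stability of the filtration, and powers of the augmentation ideal\<close>

lemma filtration_zero: "(\<lambda>_. 0) \<in> filtration m"
  by (induction m) (auto simp: act_def)

lemma filtration_add: "f \<in> filtration m \<Longrightarrow> g \<in> filtration m \<Longrightarrow> (\<lambda>x. f x + g x) \<in> filtration m"
proof (induction m arbitrary: f g)
  case (Suc m)
  have "(\<lambda>x. act \<gamma> (\<lambda>x. f x + g x) x - (f x + g x)) \<in> filtration m" if "\<gamma> \<in> carrier G" for \<gamma>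
  proof -
    have "(\<lambda>x. (act \<gamma> f x - f x) + (act \<gamma> g x - g x)) \<in> filtration m"
      using that Suc.prems by (intro Suc.IH) auto
    moreover have "(\<lambda>x. act \<gamma> (\<lambda>x. f x + g x) x - (f x + g x)) = (\<lambda>x. (act \<gamma> f x - f x) + (act \<gamma> g x - g x))"
      by (auto simp: act_def fun_eq_iff)
    ultimately show ?thesis by simp
  qed
  then show ?case using Suc.prems by simp
qed auto

lemma filtration_scale: "f \<in> filtration m \<Longrightarrow> (\<lambda>x. c * f x) \<in> filtration m"
proof (induction m arbitrary: f)
  case (Suc m)
  have "(\<lambda>x. act \<gamma> (\<lambda>x. c * f x) x - c * f x) \<in> filtration m" if "\<gamma> \<in> carrier G" for \<gamma>
  proof -
    have "(\<lambda>x. c * (act \<gamma> f x - f x)) \<in> filtration m" using that Suc.prems by (intro Suc.IH) auto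
    moreover have "(\<lambda>x. act \<gamma> (\<lambda>x. c * f x) x - c * f x) = (\<lambda>x. c * (act \<gamma> f x - f x))"
      by (auto simp: act_def fun_eq_iff algebra_simps)
    ultimately show ?thesis by simp
  qed
  then show ?case using Suc.prems by simp
qed auto

lemma filtration_sum:
  assumes "\<And>i. i \<in> I \<Longrightarrow> f i \<in> filtration m"
  shows "(\<lambda>x. \<Sum>i\<in>I. c i * f i x) \<in> filtration m"
  using assms
proof (induction I rule: infinite_finite_induct)
  case (insert i I)
  then have "(\<lambda>x. c i * f i x + (\<Sum>i\<in>I. c i * f i x)) \<in> filtration m"
    by (intro filtration_add filtration_scale) simp_all
  with insert show ?case by simp
qed (simp_all add: filtration_zero)

text \<open>By conjugation, \<open>\<gamma> \<delta> - \<delta>\<close> equals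
  \<open>\<delta>\<close> times \<open>inv \<delta> \<gamma> \<delta> - 1\<close>. The right factor
  lowers the level, and \<open>\<delta>\<close> preserves the lower level by induction.\<close>

lemma filtration_act:
  assumes "f \<in> filtration m" "\<delta> \<in> carrier G" shows "act \<delta> f \<in> filtration m"
  using assms
proof (induction m arbitrary: f \<delta>)
  case 0
  then show ?case by (auto simp: act_def fun_eq_iff)
next
  case (Suc m)
  have "(\<lambda>x. act \<gamma> (act \<delta> f) x - act \<delta> f x) \<in> filtration m" if \<gamma>: "\<gamma> \<in> carrier G" for \<gamma>
  proof -
    let ?\<gamma> = "inv \<delta> \<otimes> \<gamma> \<otimes> \<delta>"
    have c: "?\<gamma> \<in> carrier G" using \<gamma> Suc.prems by simp
    have "act \<delta> (\<lambda>x. act ?\<gamma> f x - f x) \<in> filtration m"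
      using Suc.prems c by (intro Suc.IH) auto
    moreover have "act \<delta> (\<lambda>x. act ?\<gamma> f x - f x) = (\<lambda>x. act \<delta> (act ?\<gamma> f) x - act \<delta> f x)"
      by (auto simp: act_def[of \<delta>] fun_eq_iff)
    moreover have "\<delta> \<otimes> ?\<gamma> = \<gamma> \<otimes> \<delta>" using \<gamma> Suc.prems by (simp add: m_assoc[symmetric])
    then have "act \<delta> (act ?\<gamma> f) = act \<gamma> (act \<delta> f)"
      using \<gamma> c Suc.prems by (simp add: act_act)
    ultimately show ?thesis by simp
  qed
  moreover have "act \<delta> f x = 0" if "x \<notin> N" for x using that by (simp add: act_def)
  ultimately show ?case by simp
qed

lemma filtration_lin_act:
  assumes "a \<in> carrier (group_ring G)" "f \<in> filtration m"
  shows "lin_act a f \<in> filtration m"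
proof -
  have "(\<lambda>x. \<Sum>\<gamma> | a \<gamma> \<noteq> 0. of_int (a \<gamma>) * act \<gamma> f x) \<in> filtration m"
    using assms by (intro filtration_sum filtration_act) auto
  then show ?thesis by (simp add: lin_act_def[abs_def])
qed

text \<open>A combination of elements \<open>g - 1\<close> acts as the same combination of the
  differences that define the filtration.\<close>

lemma augmentation_ideal_lowers_filtration:
  assumes "j \<in> augmentation_ideal G"
  shows "j \<in> carrier (group_ring G)" and "f \<in> filtration (Suc m) \<Longrightarrow> lin_act j f \<in> filtration m"
proof -
  obtain S n where S: "finite S" "S \<subseteq> carrier G"
    and j: "j = (\<lambda>k. \<Sum>g\<in>S. n g * ((if k = g then 1 else 0) - (if k = \<one> then 1 else 0)))"
    using assms unfolding augmentation_ideal_def by blast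
  \<comment> \<open>The neutral element is added because the terms \<open>- 1\<close> are all
    located there.\<close>
  let ?T = "insert \<one> S"
  have T: "finite ?T" "?T \<subseteq> carrier G" using S by auto
  have supp: "{k. j k \<noteq> 0} \<subseteq> ?T"
  proof (rule subsetI, rule ccontr)
    fix k assume k: "k \<in> {k. j k \<noteq> 0}" "k \<notin> ?T"
    have "j k = (\<Sum>g\<in>S. 0)" unfolding j using k(2) by (intro sum.cong) auto
    then show False using k(1) by simp
  qed
  then show "j \<in> carrier (group_ring G)" using T finite_subset by auto
  assume f: "f \<in> filtration (Suc m)"
  have "lin_act j f = (\<lambda>x. \<Sum>g\<in>S. of_int (n g) * (act g f x - f x))"
  proof
    fix x
    have "lin_act j f x = (\<Sum>k\<in>?T. of_int (j k) * act k f x)"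
      by (rule lin_act_eq_sum[OF T(1) supp])
    also have "\<dots> = (\<Sum>k\<in>?T. \<Sum>g\<in>S. of_int (n g) * ((if k = g then act k f x else 0) - (if k = \<one> then act k f x else 0)))"
      unfolding j of_int_sum sum_distrib_right by (intro sum.cong refl) auto
    also have "\<dots> = (\<Sum>g\<in>S. of_int (n g) * (\<Sum>k\<in>?T. (if k = g then act k f x else 0) - (if k = \<one> then act k f x else 0)))"
      by (subst sum.swap) (simp add: sum_distrib_left)
    also have "\<dots> = (\<Sum>g\<in>S. of_int (n g) * (act g f x - act \<one> f x))"
      using T(1) by (intro sum.cong refl) (simp add: sum_subtractf sum.delta)
    also have "act \<one> f = f" using f by (intro act_one) auto
    finally show "lin_act j f x = (\<Sum>g\<in>S. of_int (n g) * (act g f x - f x))" .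
  qed
  moreover have "(\<lambda>x. \<Sum>g\<in>S. of_int (n g) * (act g f x - f x)) \<in> filtration m"
    using f S by (intro filtration_sum) auto
  ultimately show "lin_act j f \<in> filtration m" by (simp only:)
qed

text \<open>The offset \<open>m\<close> carries the induction: in a product the power acts first and
  leaves level \<open>Suc m\<close> to the factor from the augmentation ideal. The zeroth power is
  the whole group ring, so the induction starts from stability under arbitrary elements.\<close>

lemma ideal_power_lowers_filtration:
  assumes "a \<in> ideal_power (group_ring G) (augmentation_ideal G) s"
  shows "a \<in> carrier (group_ring G)" and "f \<in> filtration (s + m) \<Longrightarrow> lin_act a f \<in> filtration m"
proof -
  have "a \<in> carrier (group_ring G) \<and> (\<forall>m f. f \<in> filtration (s + m) \<longrightarrow> lin_act a f \<in> filtration m)"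
    using assms
  proof (induction s arbitrary: a)
    case 0
    then have "a \<in> carrier (group_ring G)" by (simp only: ideal_power.simps)
    then show ?case using filtration_lin_act by (metis add_0)
  next
    case (Suc s)
    have "a \<in> ideal_prod (group_ring G) (augmentation_ideal G) (ideal_power (group_ring G) (augmentation_ideal G) s)"
      using Suc.prems by (simp only: ideal_power.simps)
    then show ?case
    proof (induction a rule: ideal_prod.induct)
      case (prod j b)
      have j: "j \<in> carrier (group_ring G)" "\<And>f m. f \<in> filtration (Suc m) \<Longrightarrow> lin_act j f \<in> filtration m"
        by (rule augmentation_ideal_lowers_filtration[OF prod(1)], assumption?)+
      have b: "b \<in> carrier (group_ring G)" "\<And>f m. f \<in> filtration (s + m) \<Longrightarrow> lin_act b f \<in> filtration m"
        using Suc.IH[OF prod(2)] by simp_all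
      have "lin_act (j \<otimes>\<^bsub>group_ring G\<^esub> b) f \<in> filtration m" if "f \<in> filtration (Suc s + m)" for f m
        unfolding lin_act_mult[OF j(1) b(1)] using that by (intro j(2) b(2)) simp
      then show ?case using group_ring_mult_closed[OF j(1) b(1)] by blast
    next
      case (sum a b)
      note ab = sum(3,4)[THEN conjunct1]
      have "finite ({g. a g \<noteq> 0} \<union> {g. b g \<noteq> 0})" "{g. a g + b g \<noteq> 0} \<subseteq> {g. a g \<noteq> 0} \<union> {g. b g \<noteq> 0}"
        "{g. a g \<noteq> 0} \<union> {g. b g \<noteq> 0} \<subseteq> carrier G"
        using ab by auto
      then have "(\<lambda>k. a k + b k) \<in> carrier (group_ring G)"
        unfolding ring_record_simps mem_Collect_eq by (meson finite_subset subset_trans)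
      moreover have "lin_act (\<lambda>k. a k + b k) f \<in> filtration m" if "f \<in> filtration (Suc s + m)" for f m
        unfolding lin_act_add[OF ab] using that sum(3,4) by (intro filtration_add) simp_all
      ultimately show ?case by (simp only: ring_record_simps(2)) simp
    qed
  qed
  then show "a \<in> carrier (group_ring G)" "f \<in> filtration (s + m) \<Longrightarrow> lin_act a f \<in> filtration m"
    by blast+
qed

end

section \<open>Spaces of iterated integrals\<close>

lemma iterated_integralsE:
  assumes "F \<in> iterated_integrals A s"
  obtains n :: nat and c ws where "F = (\<lambda>p. \<Sum>i<n. c i * iterated_integral A (ws i) p)"
    "\<forall>i<n. length (ws i) \<le> s \<and> set (ws i) \<subseteq> one_forms A"
  using assms unfolding iterated_integrals_def mem_Collect_eq by (elim exE conjE) (rule that)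

lemma iterated_integralsI:
  fixes n :: nat
  assumes "F = (\<lambda>p. \<Sum>i<n. c i * iterated_integral A (ws i) p)"
    "\<forall>i<n. length (ws i) \<le> s \<and> set (ws i) \<subseteq> one_forms A"
  shows "F \<in> iterated_integrals A s"
  unfolding iterated_integrals_def mem_Collect_eq
  by (intro exI[of _ n] exI[of _ c] exI[of _ ws] conjI assms)

lemma iterated_integrals_single:
  assumes "length ws \<le> s" "set ws \<subseteq> one_forms A"
  shows "iterated_integral A ws \<in> iterated_integrals A s"
  by (rule iterated_integralsI[where n = 1 and c = "\<lambda>_. 1" and ws = "\<lambda>_. ws"]) (use assms in auto)

lemma iterated_integrals_zero: "(\<lambda>_. 0) \<in> iterated_integrals A s"
  by (rule iterated_integralsI[where n = 0]) auto

lemma iterated_integrals_scale: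
  assumes "F \<in> iterated_integrals A s" shows "(\<lambda>p. a * F p) \<in> iterated_integrals A s"
proof -
  obtain n :: nat and c ws where F: "F = (\<lambda>p. \<Sum>i<n. c i * iterated_integral A (ws i) p)"
    and ws: "\<forall>i<n. length (ws i) \<le> s \<and> set (ws i) \<subseteq> one_forms A"
    using assms by (rule iterated_integralsE)
  have "(\<lambda>p. a * F p) = (\<lambda>p. \<Sum>i<n. (a * c i) * iterated_integral A (ws i) p)"
    by (simp add: F sum_distrib_left mult.assoc)
  then show ?thesis using ws by (rule iterated_integralsI)
qed

lemma sum_lessThan_append:
  "(\<Sum>i<n + m. if i < n then f i else g (i - n)) = (\<Sum>i<n. f i) + (\<Sum>i<m. g i :: 'a::comm_monoid_add)" for n m :: nat
  by (induction m) (simp_all add: add.assoc)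

lemma iterated_integrals_add:
  assumes "F \<in> iterated_integrals A s" "F' \<in> iterated_integrals A s"
  shows "(\<lambda>p. F p + F' p) \<in> iterated_integrals A s"
proof -
  obtain n :: nat and c ws where F: "F = (\<lambda>p. \<Sum>i<n. c i * iterated_integral A (ws i) p)"
    and ws: "\<forall>i<n. length (ws i) \<le> s \<and> set (ws i) \<subseteq> one_forms A"
    using assms(1) by (rule iterated_integralsE)
  obtain n' :: nat and c' ws' where F': "F' = (\<lambda>p. \<Sum>i<n'. c' i * iterated_integral A (ws' i) p)"
    and ws': "\<forall>i<n'. length (ws' i) \<le> s \<and> set (ws' i) \<subseteq> one_forms A"
    using assms(2) by (rule iterated_integralsE)
  let ?c = "\<lambda>i. if i < n then c i else c' (i - n)" and ?ws = "\<lambda>i. if i < n then ws i else ws' (i - n)"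
  have "(\<lambda>p. F p + F' p) = (\<lambda>p. \<Sum>i<n + n'. ?c i * iterated_integral A (?ws i) p)"
  proof
    fix p
    have "(\<Sum>i<n + n'. ?c i * iterated_integral A (?ws i) p) =
        (\<Sum>i<n + n'. if i < n then c i * iterated_integral A (ws i) p else c' (i - n) * iterated_integral A (ws' (i - n)) p)"
      by (intro sum.cong) auto
    also have "\<dots> = F p + F' p"
      unfolding F F' by (rule sum_lessThan_append)
    finally show "F p + F' p = (\<Sum>i<n + n'. ?c i * iterated_integral A (?ws i) p)" by simp
  qed
  moreover have "\<forall>i<n + n'. length (?ws i) \<le> s \<and> set (?ws i) \<subseteq> one_forms A"
    using ws ws' by auto
  ultimately show ?thesis by (rule iterated_integralsI)
qed

lemma iterated_integrals_sum:
  assumes "\<And>i. i \<in> I \<Longrightarrow> F i \<in> iterated_integrals A s"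
  shows "(\<lambda>p. \<Sum>i\<in>I. c i * F i p) \<in> iterated_integrals A s"
  using assms
proof (induction I rule: infinite_finite_induct)
  case (insert i I)
  then have "(\<lambda>p. c i * F i p + (\<Sum>i\<in>I. c i * F i p)) \<in> iterated_integrals A s"
    by (intro iterated_integrals_add iterated_integrals_scale) simp_all
  with insert show ?case by simp
qed (simp_all add: iterated_integrals_zero)

lemma homotopy_invariant_integralsE:
  assumes "\<omega> \<in> homotopy_invariant_integrals M A x0 s"
  obtains n :: nat and ws c where "\<And>i. i < n \<Longrightarrow> length (ws i) \<le> s" "\<And>i. i < n \<Longrightarrow> set (ws i) \<subseteq> one_forms A"
    "\<And>p. p \<in> smooth_paths_from M A x0 \<Longrightarrow> \<omega> p = (\<Sum>i<n::nat. c i * iterated_integral A (ws i) p)"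
proof -
  obtain F where F: "\<omega> = (\<lambda>p. if p \<in> smooth_paths_from M A x0 then F p else 0)" "F \<in> iterated_integrals A s"
    using assms by (auto simp: homotopy_invariant_integrals_def iterated_integrals_from_def)
  obtain n :: nat and c ws where "F = (\<lambda>p. \<Sum>i<n. c i * iterated_integral A (ws i) p)"
    "\<forall>i<n. length (ws i) \<le> s \<and> set (ws i) \<subseteq> one_forms A"
    using F(2) by (rule iterated_integralsE)
  then show ?thesis using F(1) by (intro that[of n ws c]) simp_all
qed

lemma homotopy_invariant_integrals_outside:
  "\<omega> \<in> homotopy_invariant_integrals M A x0 s \<Longrightarrow> p \<notin> smooth_paths_from M A x0 \<Longrightarrow> \<omega> p = 0"
  unfolding homotopy_invariant_integrals_def iterated_integrals_from_def by auto

lemma homotopy_invariant_integrals_eq: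
  assumes "\<omega> \<in> homotopy_invariant_integrals M A x0 s" "p \<in> smooth_paths_from M A x0" "q \<in> smooth_paths_from M A x0"
    "homotopic_paths M p q"
  shows "\<omega> p = \<omega> q"
  using assms unfolding homotopy_invariant_integrals_def by simp

text \<open>\<open>step\<close> takes values in the unit interval only, so the products coincide on
  all of \<open>real\<close>.\<close>

lemma smooth_join_cong:
  assumes "\<And>t. t \<in> {0..1} \<Longrightarrow> q t = q' t" shows "smooth_join p q = smooth_join p q'"
  using assms by (simp add: smooth_join_def step)

lemma comp_smooth_join: "f \<circ> smooth_join p q = smooth_join (f \<circ> p) (f \<circ> q)"
  by (auto simp: smooth_join_def joinpaths_def)

lemma (in smooth_mfd) smooth_path_cong:
  assumes p: "p \<in> smooth_paths M A" and eq: "\<And>t. t \<in> {0..1} \<Longrightarrow> q t = p t"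
  shows "q \<in> smooth_paths M A"
proof (rule smooth_path_local)
  have "homotopic_paths M p q" using smooth_pathD[OF p] eq by (intro homotopic_paths_eq) auto
  then show "path q" "path_image q \<subseteq> M"
    using homotopic_paths_imp_path homotopic_paths_imp_subset by blast+
  show "\<exists>G p. open G \<and> t \<in> G \<and> p \<in> smooth_paths M A \<and> (\<forall>s\<in>{0..1} \<inter> G. q s = p s)" for t
    using p eq by (intro exI[of _ UNIV] exI[of _ p]) simp
qed

section \<open>Integration on the universal covering\<close>

locale smooth_cover = N: smooth_mfd E coord N B + M: smooth_mfd E coord M A + simply_connected_cover N \<pi> M
  for E :: "'e::banach set" and coord and N :: "'b::topological_space set" and B :: "('b, 'e) chart set"
    and M :: "'a::topological_space set" and A :: "('a, 'e) chart set" and \<pi> :: "'b \<Rightarrow> 'a" +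
  fixes y0 :: 'b
  assumes y0: "y0 \<in> N"
    and local_diffeo: "\<And>y. y \<in> N \<Longrightarrow> \<exists>W g. y \<in> W \<and> openin (top_of_set N) W \<and> openin (top_of_set M) (\<pi> ` W) \<and>
        homeomorphism W (\<pi> ` W) \<pi> g \<and> smooth_map W B A \<pi> \<and> smooth_map (\<pi> ` W) A B g"
begin

abbreviation HI :: "nat \<Rightarrow> ((real \<Rightarrow> 'a) \<Rightarrow> complex) set" where
  "HI \<equiv> homotopy_invariant_integrals M A (\<pi> y0)"

abbreviation \<Psi> :: "((real \<Rightarrow> 'a) \<Rightarrow> complex) \<Rightarrow> 'b \<Rightarrow> complex" where
  "\<Psi> \<equiv> Psi N B \<pi> y0"

section \<open>Projecting and lifting smooth paths\<close>

lemma project_smooth: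
  assumes q: "q \<in> smooth_paths N B" shows "\<pi> \<circ> q \<in> smooth_paths M A"
proof (rule N.smooth_path_map[OF M.smooth_mfd_axioms q])
  show "path (\<pi> \<circ> q)" "path_image (\<pi> \<circ> q) \<subseteq> M" by (rule path_project[OF smooth_pathD(1,2)[OF q]])+
  fix t :: real assume t: "t \<in> {0..1}"
  obtain W where W: "q t \<in> W" "openin (top_of_set N) W" "smooth_map W B A \<pi>"
    using local_diffeo[OF smooth_pathD(3)[OF q t]] by blast
  obtain G where "open G" "t \<in> G" "\<And>s. s \<in> {0..1} \<inter> G \<Longrightarrow> q s \<in> W"
    using path_nbhd[OF smooth_pathD(1,2)[OF q] W(2) t W(1)] by blast
  then show "\<exists>G W f. open G \<and> t \<in> G \<and> smooth_map W B A f \<and> (\<forall>s\<in>{0..1} \<inter> G. q s \<in> W \<and> (\<pi> \<circ> q) s = f (q s))"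
    using W(3) by (intro exI[of _ G] exI[of _ W] exI[of _ \<pi>]) simp
qed

text \<open>Locally the lift is a smooth local inverse of the covering applied to the projected
  path.\<close>

lemma lift_smooth:
  assumes q: "path q" "path_image q \<subseteq> N" and \<pi>q: "\<pi> \<circ> q \<in> smooth_paths M A"
  shows "q \<in> smooth_paths N B"
proof (rule M.smooth_path_map[OF N.smooth_mfd_axioms \<pi>q q])
  fix t :: real assume t: "t \<in> {0..1}"
  then have "q t \<in> N" using q(2) unfolding path_image_def by blast
  then obtain W g where W: "q t \<in> W" "openin (top_of_set N) W" "homeomorphism W (\<pi> ` W) \<pi> g" "smooth_map (\<pi> ` W) A B g"
    using local_diffeo by blast
  obtain G where G: "open G" "t \<in> G" "\<And>s. s \<in> {0..1} \<inter> G \<Longrightarrow> q s \<in> W"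
    using path_nbhd[OF q W(2) t W(1)] by blast
  have "(\<pi> \<circ> q) s \<in> \<pi> ` W \<and> q s = g ((\<pi> \<circ> q) s)" if "s \<in> {0..1} \<inter> G" for s
    using G(3)[OF that] homeomorphism_apply1[OF W(3)] by simp
  then show "\<exists>G W f. open G \<and> t \<in> G \<and> smooth_map W A B f \<and> (\<forall>s\<in>{0..1} \<inter> G. (\<pi> \<circ> q) s \<in> W \<and> q s = f ((\<pi> \<circ> q) s))"
    using G(1,2) W(4) by (intro exI[of _ G] exI[of _ "\<pi> ` W"] exI[of _ g]) simp
qed

lemma smooth_path_to:
  assumes "x \<in> N"
  obtains q where "q \<in> smooth_paths N B" "pathstart q = y0" "pathfinish q = x"
  using N.smooth_path_connected[OF connected_N y0 assms] by blast

lemma project_from: "q \<in> smooth_paths N B \<Longrightarrow> pathstart q = y0 \<Longrightarrow> \<pi> \<circ> q \<in> smooth_paths_from M A (\<pi> y0)"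
  using project_smooth by (simp add: smooth_paths_from_def pathstart_compose)

section \<open>Independence of the path, and injectivity\<close>

text \<open>Smooth paths in \<open>N\<close> with the same ends are homotopic there, so their
  projections are homotopic in \<open>M\<close> and \<open>\<omega>\<close> does not distinguish
  them. The path chosen in \<open>Psi\<close> may thus be replaced by any convenient one.\<close>

lemma Psi_eq:
  assumes \<omega>: "\<omega> \<in> HI s" and q: "q \<in> smooth_paths N B" "pathstart q = y0" "pathfinish q = x"
  shows "\<Psi> \<omega> x = \<omega> (\<pi> \<circ> q)"
proof -
  have x: "x \<in> N" using smooth_pathD(2)[OF q(1)] q(3) pathfinish_in_path_image[of q] by blast
  define q' where "q' = (SOME q. q \<in> smooth_paths_from N B y0 \<and> pathfinish q = x)"
  have "q' \<in> smooth_paths_from N B y0 \<and> pathfinish q' = x"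
    unfolding q'_def
    by (rule someI[where P = "\<lambda>q. q \<in> smooth_paths_from N B y0 \<and> pathfinish q = x" and x = q])
      (simp add: smooth_paths_from_def q)
  then have q': "q' \<in> smooth_paths N B" "pathstart q' = y0" "pathfinish q' = x"
    by (simp_all add: smooth_paths_from_def)
  have "homotopic_paths N q' q"
    using smooth_pathD[OF q(1)] smooth_pathD[OF q'(1)] q q'
    by (intro simply_connected_imp_homotopic_paths[OF simply_connected]) auto
  then have "homotopic_paths M (\<pi> \<circ> q') (\<pi> \<circ> q)"
    by (rule homotopic_paths_continuous_image[OF _ cont_\<pi>]) (use \<pi>_image in auto)
  then have "\<omega> (\<pi> \<circ> q') = \<omega> (\<pi> \<circ> q)"
    by (intro homotopy_invariant_integrals_eq[OF \<omega>] project_from q q')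
  then show ?thesis using x by (simp add: Psi_def q'_def[symmetric])
qed

lemma Psi_inj: "inj_on \<Psi> (HI s)"
proof (rule inj_onI, rule ext)
  fix \<omega> \<eta> p assume \<omega>: "\<omega> \<in> HI s" and \<eta>: "\<eta> \<in> HI s" and eq: "\<Psi> \<omega> = \<Psi> \<eta>"
  show "\<omega> p = \<eta> p"
  proof (cases "p \<in> smooth_paths_from M A (\<pi> y0)")
    case True
    then have p: "p \<in> smooth_paths M A" "pathstart p = \<pi> y0" by (simp_all add: smooth_paths_from_def)
    \<comment> \<open>For either functional, its value on \<open>p\<close> is the value of its image
      under \<open>\<Psi>\<close> at the end of this one lift.\<close>
    obtain q where q: "path q" "path_image q \<subseteq> N" "pathstart q = y0" "\<And>t. t \<in> {0..1} \<Longrightarrow> \<pi> (q t) = p t"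
      using covering_lift_path[OF cov smooth_pathD(1,2)[OF p(1)] y0] p(2) by metis
    have "\<pi> \<circ> q \<in> smooth_paths M A"
      by (rule M.smooth_path_cong[OF p(1)]) (simp add: q(4))
    then have qs: "q \<in> smooth_paths N B" by (rule lift_smooth[OF q(1,2)])
    have hom: "homotopic_paths M p (\<pi> \<circ> q)"
      using smooth_pathD[OF p(1)] q(4) by (intro homotopic_paths_eq) auto
    have "\<zeta> p = \<Psi> \<zeta> (pathfinish q)" if "\<zeta> \<in> HI s" for \<zeta>
      using homotopy_invariant_integrals_eq[OF that True project_from[OF qs q(3)] hom] Psi_eq[OF that qs q(3) refl]
      by simp
    then show ?thesis using \<omega> \<eta> eq by metis
  next
    case False
    \<comment> \<open>On all other arguments both functionals are 0, by the convention for extending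
      them.\<close>
    then show ?thesis using \<omega> \<eta> by (simp add: homotopy_invariant_integrals_outside)
  qed
qed

section \<open>Smoothness on the covering\<close>

text \<open>A point \<open>y\<close> near \<open>y1\<close> is reached by a fixed path
  \<open>q1\<close> to \<open>y1\<close>, followed by the lift of a chart segment in
  \<open>M\<close>, where the forms live. Chen's formula gives constants from \<open>q1\<close>
  times radial integrals in the direction \<open>v\<close> of the segment, and \<open>v\<close>
  depends smoothly on the coordinates of \<open>y\<close>.\<close>

lemma Psi_smooth:
  assumes \<omega>: "\<omega> \<in> HI s" shows "\<Psi> \<omega> \<in> C_infinity N B"
proof -
  obtain n :: nat and c ws where "\<And>i. i < n \<Longrightarrow> length (ws i) \<le> s" and ws: "\<And>i. i < n \<Longrightarrow> set (ws i) \<subseteq> one_forms A"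
    and \<omega>_eq: "\<And>p. p \<in> smooth_paths_from M A (\<pi> y0) \<Longrightarrow> \<omega> p = (\<Sum>i<n. c i * iterated_integral A (ws i) p)"
    by (rule homotopy_invariant_integralsE[OF \<omega>]) (rule that, auto)
  have "Ck_on k (\<phi> ` U) (\<Psi> \<omega> \<circ> inv_into U \<phi>)" if U: "(U, \<phi>) \<in> B" for U \<phi> k
  proof (rule Ck_on_local)
    fix z assume "z \<in> \<phi> ` U"
    then obtain y1 where y1: "y1 \<in> U" "z = \<phi> y1" by blast
    then have "y1 \<in> N" using N.chart_subset[OF U] by blast
    then obtain W g where W: "y1 \<in> W" "openin (top_of_set N) W" "openin (top_of_set M) (\<pi> ` W)"
      "homeomorphism W (\<pi> ` W) \<pi> g" "smooth_map W B A \<pi>"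
      using local_diffeo by blast
    have WN: "W \<subseteq> N" using W(2) openin_imp_subset by blast
    define m1 where "m1 = \<pi> y1"
    have m1: "m1 \<in> \<pi> ` W" using W(1) by (simp add: m1_def)
    obtain V \<psi> r where V: "(V, \<psi>) \<in> A" "m1 \<in> V" "r > 0" "ball (\<psi> m1) r \<subseteq> \<psi> ` (V \<inter> \<pi> ` W)"
      "openin (top_of_set M) (V \<inter> \<psi> -` ball (\<psi> m1) r)" "V \<inter> \<psi> -` ball (\<psi> m1) r \<subseteq> \<pi> ` W"
      by (rule M.chart_ball_nbhd[OF W(3) m1])
    have bV: "ball (\<psi> m1) r \<subseteq> \<psi> ` V" using V(4) by blast
    let ?O = "V \<inter> \<psi> -` ball (\<psi> m1) r"
    \<comment> \<open>The coordinates of those \<open>y\<close> in \<open>W\<close> whose projection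
      lies in the chart ball, so that the segment from \<open>m1\<close> to \<open>\<pi> y\<close>
      lifts inside \<open>W\<close>.\<close>
    define Z where "Z = \<phi> ` (U \<inter> (W \<inter> (N \<inter> \<pi> -` ?O)))"
    have op: "openin (top_of_set N) (N \<inter> \<pi> -` ?O)"
      using \<pi>_image by (intro continuous_openin_preimage[OF cont_\<pi> _ V(5)]) auto
    have Z: "open Z" unfolding Z_def by (rule N.chart_open_Int[OF U openin_Int[OF W(2) op]])
    have zZ: "z \<in> Z" using y1 W(1) \<open>y1 \<in> N\<close> V(2,3) by (auto simp: Z_def m1_def)
    have ZU: "\<phi> ` U \<inter> Z = Z" by (auto simp: Z_def)
    obtain q1 where q1: "q1 \<in> smooth_paths N B" "pathstart q1 = y0" "pathfinish q1 = y1"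
      by (rule smooth_path_to[OF \<open>y1 \<in> N\<close>])
    \<comment> \<open>The value of \<open>\<Psi> \<omega>\<close> as Chen's formula predicts it from
      the direction of the segment.\<close>
    define K where "K v = (\<Sum>i<n. c i * (\<Sum>j\<le>length (ws i). iterated_integral A (take j (ws i)) (\<pi> \<circ> q1) *
        radial_integral (V, \<psi>) (\<psi> m1) (drop j (ws i)) v))" for v
    have fatb: "fat (ball (0::'e) r)" by (rule fat_open[OF open_ball])
    have K: "Ck_on k (ball 0 r) K"
    proof -
      have "Ck_on k (ball 0 r) (radial_integral (V, \<psi>) (\<psi> m1) (drop j (ws i)))" if "i < n" for i j
        by (rule M.radial_integral_Ck_on[OF V(1) bV]) (use ws[OF that] set_drop_subset[of j "ws i"] in blast)
      then show ?thesis
        unfolding K_def by (intro Ck_on_sum fatb Ck_on_mult Ck_on_const) auto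
    qed
    \<comment> \<open>The direction of the segment as a function of the coordinates of its lifted
      end point.\<close>
    define \<tau> where "\<tau> z' = (\<psi> \<circ> \<pi> \<circ> inv_into U \<phi>) z' + (- \<psi> m1)" for z'
    have "Ck_on k Z (\<psi> \<circ> \<pi> \<circ> inv_into U \<phi>)"
    proof (rule Ck_on_subset[OF _ _ fat_open[OF Z]])
      have "\<forall>(U, \<phi>)\<in>B. \<forall>(V, \<psi>)\<in>A. smooth_on (\<phi> ` (U \<inter> W \<inter> \<pi> -` V)) (\<psi> \<circ> \<pi> \<circ> inv_into U \<phi>)"
        using W(5)[unfolded smooth_map_def] by (rule conjunct2)
      from bspec[OF this U] have "\<forall>(V, \<psi>)\<in>A. smooth_on (\<phi> ` (U \<inter> W \<inter> \<pi> -` V)) (\<psi> \<circ> \<pi> \<circ> inv_into U \<phi>)"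
        by (simp only: prod.case)
      from bspec[OF this V(1)] show "Ck_on k (\<phi> ` (U \<inter> W \<inter> \<pi> -` V)) (\<psi> \<circ> \<pi> \<circ> inv_into U \<phi>)"
        by (simp add: smooth_on_def)
      show "Z \<subseteq> \<phi> ` (U \<inter> W \<inter> \<pi> -` V)" unfolding Z_def by blast
    qed
    then have \<tau>: "Ck_on k Z \<tau>"
      unfolding \<tau>_def by (intro Ck_on_add Ck_on_const fat_open[OF Z])
    have Zpt: "\<exists>y. y \<in> U \<and> y \<in> W \<and> \<pi> y \<in> V \<and> \<psi> (\<pi> y) \<in> ball (\<psi> m1) r \<and> inv_into U \<phi> z' = y \<and> \<tau> z' = \<psi> (\<pi> y) - \<psi> m1"
      if z': "z' \<in> Z" for z'
    proof -
      obtain y where y: "y \<in> U" "y \<in> W" "\<pi> y \<in> V" "\<psi> (\<pi> y) \<in> ball (\<psi> m1) r" "z' = \<phi> y"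
        using z' unfolding Z_def by blast
      have e: "inv_into U \<phi> z' = y" unfolding y(5) by (rule N.chart_inv[OF U y(1)])
      show ?thesis using y(1-4) e by (intro exI[of _ y]) (simp add: \<tau>_def)
    qed
    have \<tau>b: "\<tau> ` Z \<subseteq> ball 0 r"
    proof (rule image_subsetI)
      fix z' assume "z' \<in> Z"
      then show "\<tau> z' \<in> ball 0 r" using Zpt by (force simp: dist_norm norm_minus_commute)
    qed
    have "Ck_on k Z (\<lambda>z. K (\<tau> z))" by (rule N.Ck_on_comp[OF fat_open[OF Z] \<tau> K \<tau>b])
    then have "Ck_on k Z (\<Psi> \<omega> \<circ> inv_into U \<phi>)"
    proof (rule Ck_on_eq)
      fix z' assume z': "z' \<in> Z"
      then obtain y where y: "y \<in> U" "y \<in> W" "\<pi> y \<in> V" "\<psi> (\<pi> y) \<in> ball (\<psi> m1) r"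
        "inv_into U \<phi> z' = y" "\<tau> z' = \<psi> (\<pi> y) - \<psi> m1"
        using Zpt by metis
      define v where "v = \<psi> (\<pi> y) - \<psi> m1"
      have v: "v \<in> ball 0 r" using y(4) by (simp add: v_def dist_norm norm_minus_commute)
      define l where "l t = inv_into V \<psi> (\<psi> m1 + t *\<^sub>R v)" for t :: real
      have l: "l \<in> smooth_paths M A"
        unfolding l_def using M.iterated_integral_radial(1)[OF V(1) bV v, of "[]"] by simp
      have lW: "l t \<in> \<pi> ` W" if t: "t \<in> {0..1}" for t
      proof -
        have "\<psi> m1 + t *\<^sub>R v \<in> ball (\<psi> m1) r"
          using M.in_radial_ball(1)[OF V(1) bV v t] by (simp add: dist_norm)
        then obtain m where m: "m \<in> V" "m \<in> \<pi> ` W" "\<psi> m1 + t *\<^sub>R v = \<psi> m" using V(4) by blast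
        then have "l t = m" by (simp add: l_def M.chart_inv[OF V(1)])
        then show ?thesis using m(2) by simp
      qed
      have \<pi>gl: "\<pi> (g (l t)) = l t" if "t \<in> {0..1}" for t
        using homeomorphism_apply2[OF W(4) lW[OF that]] .
      have gl: "path (g \<circ> l)" "path_image (g \<circ> l) \<subseteq> N"
      proof -
        have "path_image l \<subseteq> \<pi> ` W" using lW by (auto simp: path_image_def)
        then show "path (g \<circ> l)"
          using smooth_pathD(1)[OF l] homeomorphism_cont2[OF W(4)] continuous_on_subset
          by (intro path_continuous_image) auto
        have "g ` (\<pi> ` W) = W" by (rule homeomorphism_image2[OF W(4)])
        then show "path_image (g \<circ> l) \<subseteq> N" using lW WN unfolding path_image_def by fastforce
      qed
      have "\<pi> \<circ> (g \<circ> l) \<in> smooth_paths M A" by (rule M.smooth_path_cong[OF l]) (simp add: \<pi>gl)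
      then have gls: "g \<circ> l \<in> smooth_paths N B" by (rule lift_smooth[OF gl])
      have l01: "l 0 = m1" "l 1 = \<pi> y"
        using M.chart_inv[OF V(1) V(2)] M.chart_inv[OF V(1) y(3)] by (simp_all add: l_def v_def)
      have start: "pathstart (g \<circ> l) = y1"
        using homeomorphism_apply1[OF W(4) W(1)] by (simp add: pathstart_def l01 m1_def)
      have fin: "pathfinish (g \<circ> l) = y"
        using homeomorphism_apply1[OF W(4) y(2)] by (simp add: pathfinish_def l01)
      let ?q = "smooth_join q1 (g \<circ> l)"
      have q: "?q \<in> smooth_paths N B" "pathstart ?q = y0" "pathfinish ?q = y"
        using N.smooth_join_smooth[OF q1(1) gls] q1 start fin by simp_all
      have \<pi>q: "\<pi> \<circ> ?q = smooth_join (\<pi> \<circ> q1) l"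
        unfolding comp_smooth_join by (rule smooth_join_cong) (simp add: \<pi>gl)
      have "\<Psi> \<omega> y = \<omega> (\<pi> \<circ> ?q)" by (rule Psi_eq[OF \<omega> q])
      also have "\<dots> = (\<Sum>i<n. c i * iterated_integral A (ws i) (smooth_join (\<pi> \<circ> q1) l))"
        using \<omega>_eq[OF project_from[OF q(1,2)]] by (simp only: \<pi>q)
      also have "\<dots> = K v"
        unfolding K_def
      proof (intro sum.cong refl arg_cong2[where f = "(*)"])
        fix i assume "i \<in> {..<n}"
        then have wsi: "set (ws i) \<subseteq> one_forms A" using ws by simp
        have pq: "pathfinish (\<pi> \<circ> q1) = pathstart l"
          by (simp add: pathfinish_compose q1(3) pathstart_def l01 m1_def)
        have rad: "iterated_integral A (drop j (ws i)) l = radial_integral (V, \<psi>) (\<psi> m1) (drop j (ws i)) v" for j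
          unfolding l_def by (rule M.iterated_integral_radial(2)[OF V(1) bV v])
            (use wsi set_drop_subset[of j "ws i"] in blast)
        show "iterated_integral A (ws i) (smooth_join (\<pi> \<circ> q1) l) =
            (\<Sum>j\<le>length (ws i). iterated_integral A (take j (ws i)) (\<pi> \<circ> q1) *
              radial_integral (V, \<psi>) (\<psi> m1) (drop j (ws i)) v)"
          unfolding M.iterated_integral_smooth_join[OF project_smooth[OF q1(1)] l pq wsi] rad ..
      qed
      finally show "(\<Psi> \<omega> \<circ> inv_into U \<phi>) z' = K (\<tau> z')" by (simp add: y(5,6) v_def)
    qed
    then show "\<exists>G. open G \<and> z \<in> G \<and> Ck_on k (\<phi> ` U \<inter> G) (\<Psi> \<omega> \<circ> inv_into U \<phi>)"
      using Z zZ ZU by (intro exI[of _ Z]) simp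
  qed
  then show ?thesis by (auto simp: C_infinity_def smooth_on_def Psi_def)
qed

section \<open>The order of the functions on the covering\<close>

text \<open>The effect of \<open>l - 1\<close> on functionals; the value 0 on other arguments is the
  extension used in \<open>iterated_integrals_from\<close>.\<close>

definition loop_difference :: "(real \<Rightarrow> 'a) \<Rightarrow> ((real \<Rightarrow> 'a) \<Rightarrow> complex) \<Rightarrow> (real \<Rightarrow> 'a) \<Rightarrow> complex" where
  "loop_difference l \<omega> p = (if p \<in> smooth_paths_from M A (\<pi> y0) then \<omega> (smooth_join l p) - \<omega> p else 0)"

context
  fixes l assumes l: "l \<in> smooth_paths M A" "pathstart l = \<pi> y0" "pathfinish l = \<pi> y0"
begin

lemma smooth_join_from:
  assumes "p \<in> smooth_paths_from M A (\<pi> y0)" shows "smooth_join l p \<in> smooth_paths_from M A (\<pi> y0)"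
  using assms l M.smooth_join_smooth[OF l(1)] by (simp add: smooth_paths_from_def)

text \<open>In Chen's formula the summand \<open>j = 0\<close> is the integral of the empty list
  along \<open>l\<close>, which is 1, times the integral along \<open>p\<close>. Subtracting
  \<open>\<omega> p\<close> removes it, and in all other summands the list along \<open>p\<close>
  has lost a form. For \<open>s = 0\<close> the truncated \<open>s - 1\<close> is again 0, so the
  vanishing is recorded in the last conjunct.\<close>

lemma loop_difference_eq:
  assumes "\<omega> \<in> HI s"
  shows "\<exists>F\<in>iterated_integrals A (s - 1).
    (\<forall>p\<in>smooth_paths_from M A (\<pi> y0). loop_difference l \<omega> p = F p) \<and> (s = 0 \<longrightarrow> (\<forall>p. F p = 0))"
proof -
  obtain n :: nat and c ws where len: "\<And>i. i < n \<Longrightarrow> length (ws i) \<le> s" and ws: "\<And>i. i < n \<Longrightarrow> set (ws i) \<subseteq> one_forms A"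
    and \<omega>_eq: "\<And>p. p \<in> smooth_paths_from M A (\<pi> y0) \<Longrightarrow> \<omega> p = (\<Sum>i<n. c i * iterated_integral A (ws i) p)"
    by (rule homotopy_invariant_integralsE[OF assms]) (rule that, auto)
  define F where "F p = (\<Sum>i<n. c i * (\<Sum>j\<in>{1..length (ws i)}.
      iterated_integral A (take j (ws i)) l * iterated_integral A (drop j (ws i)) p))" for p
  have 1: "loop_difference l \<omega> p = F p" if p: "p \<in> smooth_paths_from M A (\<pi> y0)" for p
  proof -
    have p': "p \<in> smooth_paths M A" "pathstart p = \<pi> y0" using p by (simp_all add: smooth_paths_from_def)
    have "\<omega> (smooth_join l p) - \<omega> p =
        (\<Sum>i<n. c i * (iterated_integral A (ws i) (smooth_join l p) - iterated_integral A (ws i) p))"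
      unfolding \<omega>_eq[OF p] \<omega>_eq[OF smooth_join_from[OF p]] by (simp add: sum_subtractf right_diff_distrib)
    also have "\<dots> = F p"
      unfolding F_def
    proof (intro sum.cong refl arg_cong2[where f = "(*)"])
      fix i assume "i \<in> {..<n}"
      then have "set (ws i) \<subseteq> one_forms A" using ws by simp
      then have "iterated_integral A (ws i) (smooth_join l p) =
          (\<Sum>j\<le>length (ws i). iterated_integral A (take j (ws i)) l * iterated_integral A (drop j (ws i)) p)"
        using l p' by (intro M.iterated_integral_smooth_join) simp_all
      also have "\<dots> = iterated_integral A (take 0 (ws i)) l * iterated_integral A (drop 0 (ws i)) p +
          (\<Sum>j\<in>{1..length (ws i)}. iterated_integral A (take j (ws i)) l * iterated_integral A (drop j (ws i)) p)"
        by (simp only: atMost_atLeast0 sum.atLeast_Suc_atMost[OF le0] One_nat_def)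
      finally show "iterated_integral A (ws i) (smooth_join l p) - iterated_integral A (ws i) p =
          (\<Sum>j\<in>{1..length (ws i)}. iterated_integral A (take j (ws i)) l * iterated_integral A (drop j (ws i)) p)"
        by (simp add: iterated_integral_eq[of A "[]"])
    qed
    finally show ?thesis using p by (simp add: loop_difference_def)
  qed
  have 2: "F \<in> iterated_integrals A (s - 1)"
  proof -
    have "iterated_integral A (drop j (ws i)) \<in> iterated_integrals A (s - 1)"
      if "i \<in> {..<n}" "j \<in> {1..length (ws i)}" for i j
    proof (rule iterated_integrals_single)
      have "length (ws i) \<le> s" "1 \<le> j" using len[of i] that by auto
      then show "length (drop j (ws i)) \<le> s - 1" unfolding length_drop by linarith
      show "set (drop j (ws i)) \<subseteq> one_forms A" using ws[of i] that set_drop_subset[of j "ws i"] by fastforce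
    qed
    then show ?thesis unfolding F_def[abs_def] by (intro iterated_integrals_sum)
  qed
  have 3: "F p = 0" if "s = 0" for p
  proof -
    have "length (ws i) = 0" if "i < n" for i using len[OF that] \<open>s = 0\<close> by simp
    then show ?thesis unfolding F_def by (intro sum.neutral) simp
  qed
  show ?thesis using 1 2 3 by (intro bexI[of _ F] conjI ballI impI allI)
qed

text \<open>Homotopy invariance must survive for the induction on the length; it does, since
  prefixing \<open>l\<close> respects homotopies.\<close>

lemma loop_difference_HI:
  assumes \<omega>: "\<omega> \<in> HI (Suc s)" shows "loop_difference l \<omega> \<in> HI s"
proof -
  obtain F where F: "\<And>p. p \<in> smooth_paths_from M A (\<pi> y0) \<Longrightarrow> loop_difference l \<omega> p = F p"
    "F \<in> iterated_integrals A (Suc s - 1)"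
    using bspec loop_difference_eq[OF \<omega>] by metis
  have "loop_difference l \<omega> = (\<lambda>p. if p \<in> smooth_paths_from M A (\<pi> y0) then F p else 0)"
  proof
    fix p show "loop_difference l \<omega> p = (if p \<in> smooth_paths_from M A (\<pi> y0) then F p else 0)"
      using F(1)[of p] by (simp add: loop_difference_def)
  qed
  then have "loop_difference l \<omega> \<in> iterated_integrals_from M A (\<pi> y0) s"
    unfolding iterated_integrals_from_def using F(2) by simp
  moreover have "loop_difference l \<omega> p = loop_difference l \<omega> q"
    if p: "p \<in> smooth_paths_from M A (\<pi> y0)" and q: "q \<in> smooth_paths_from M A (\<pi> y0)" and hom: "homotopic_paths M p q" for p q
  proof -
    have ps: "p \<in> smooth_paths M A" "pathstart p = \<pi> y0" and qs: "q \<in> smooth_paths M A" "pathstart q = \<pi> y0"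
      using p q by (simp_all add: smooth_paths_from_def)
    have "homotopic_paths M (smooth_join l p) (l +++ p)"
      by (rule homotopic_paths_sym[OF homotopic_paths_smooth_join])
        (simp_all add: smooth_pathD(1,2)[OF l(1)] smooth_pathD(1,2)[OF ps(1)] l(3) ps(2))
    also have "homotopic_paths M (l +++ p) (l +++ q)"
      by (rule homotopic_paths_join) (simp_all add: smooth_pathD(1,2)[OF l(1)] l(3) ps(2) hom)
    also have "homotopic_paths M (l +++ q) (smooth_join l q)"
      by (rule homotopic_paths_smooth_join)
        (simp_all add: smooth_pathD(1,2)[OF l(1)] smooth_pathD(1,2)[OF qs(1)] l(3) qs(2))
    finally have "\<omega> (smooth_join l p) = \<omega> (smooth_join l q)"
      by (intro homotopy_invariant_integrals_eq[OF \<omega>] smooth_join_from p q)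
    moreover have "\<omega> p = \<omega> q" by (rule homotopy_invariant_integrals_eq[OF \<omega> p q hom])
    ultimately show ?thesis using p q by (simp add: loop_difference_def)
  qed
  ultimately show ?thesis unfolding homotopy_invariant_integrals_def mem_Collect_eq by blast
qed

end

sublocale deck: function_action "fundamental_group M (\<pi> y0)" N "deck N \<pi> y0"
proof -
  have "\<pi> y0 \<in> M" using y0 \<pi>_image by blast
  then interpret group "fundamental_group M (\<pi> y0)" by (rule group_fundamental_group)
  show "function_action (fundamental_group M (\<pi> y0)) N (deck N \<pi> y0)"
  proof
    show "deck N \<pi> y0 \<gamma> x \<in> N" if "\<gamma> \<in> carrier (fundamental_group M (\<pi> y0))" "x \<in> N" for \<gamma> x
      using deck_transformationD(2)[OF deck_spec(1)[OF y0 that(1)]] that(2) by blast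
  qed (simp_all add: deck_mult[OF y0] deck_one[OF y0])
qed

lemma Psi_in_filtration:
  assumes "\<omega> \<in> HI s" shows "\<Psi> \<omega> \<in> deck.filtration (Suc s)"
  using assms
proof (induction s arbitrary: \<omega>)
  \<comment> \<open>The operator \<open>\<gamma> - 1\<close> becomes
    \<open>loop_difference l\<close> with one loop \<open>l\<close> for all \<open>x\<close>: the
    projection of a path \<open>k\<close> from \<open>y0\<close> to \<open>?h y0\<close>, where
    \<open>?h\<close> belongs to the inverse of \<open>\<gamma>\<close>, as in \<open>act\<close>. A
    path \<open>q\<close> to \<open>x\<close> gives the path \<open>k\<close> followed by
    \<open>?h \<circ> q\<close> to \<open>?h x\<close>, and \<open>?h\<close> disappears under
    projection.\<close>
  have step: "\<exists>l\<in>smooth_paths M A. pathstart l = \<pi> y0 \<and> pathfinish l = \<pi> y0 \<and>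
      (\<forall>x\<in>N. \<exists>q\<in>smooth_paths N B. pathstart q = y0 \<and> pathfinish q = x \<and>
        deck.act \<gamma> (\<Psi> \<omega>) x - \<Psi> \<omega> x = loop_difference l \<omega> (\<pi> \<circ> q))"
    if \<gamma>: "\<gamma> \<in> carrier (fundamental_group M (\<pi> y0))" and \<omega>: "\<omega> \<in> HI s" for \<gamma> \<omega> s
  proof -
    let ?h = "deck N \<pi> y0 (inv\<^bsub>fundamental_group M (\<pi> y0)\<^esub> \<gamma>)"
    note h = deck_transformationD[OF deck_spec(1)[OF y0 deck.inv_closed[OF \<gamma>]]]
    have hN: "?h x \<in> N" if "x \<in> N" for x using h(2) that by blast
    obtain k where k: "k \<in> smooth_paths N B" "pathstart k = y0" "pathfinish k = ?h y0"
      by (rule smooth_path_to[OF hN[OF y0]])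
    have "\<exists>q\<in>smooth_paths N B. pathstart q = y0 \<and> pathfinish q = x \<and>
        deck.act \<gamma> (\<Psi> \<omega>) x - \<Psi> \<omega> x = loop_difference (\<pi> \<circ> k) \<omega> (\<pi> \<circ> q)" if x: "x \<in> N" for x
    proof -
      obtain q where q: "q \<in> smooth_paths N B" "pathstart q = y0" "pathfinish q = x" by (rule smooth_path_to[OF x])
      have \<pi>hq: "\<pi> (?h (q t)) = \<pi> (q t)" if "t \<in> {0..1}" for t
        using h(3)[OF smooth_pathD(3)[OF q(1) that]] .
      have hq: "path (?h \<circ> q)" "path_image (?h \<circ> q) \<subseteq> N"
      proof -
        show "path (?h \<circ> q)"
          using smooth_pathD[OF q(1)] continuous_on_subset[OF h(1)] by (intro path_continuous_image)
        show "path_image (?h \<circ> q) \<subseteq> N" using smooth_pathD(3)[OF q(1)] hN by (auto simp: path_image_def)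
      qed
      have "\<pi> \<circ> (?h \<circ> q) \<in> smooth_paths M A"
        by (rule M.smooth_path_cong[OF project_smooth[OF q(1)]]) (simp add: \<pi>hq)
      then have hqs: "?h \<circ> q \<in> smooth_paths N B" by (rule lift_smooth[OF hq])
      have r: "smooth_join k (?h \<circ> q) \<in> smooth_paths N B"
        using k q hqs by (intro N.smooth_join_smooth) (simp_all add: pathstart_compose)
      have "\<Psi> \<omega> (?h x) = \<omega> (\<pi> \<circ> smooth_join k (?h \<circ> q))"
        by (rule Psi_eq[OF \<omega> r]) (simp_all add: k q pathfinish_compose)
      also have "\<pi> \<circ> smooth_join k (?h \<circ> q) = smooth_join (\<pi> \<circ> k) (\<pi> \<circ> q)"
        unfolding comp_smooth_join by (rule smooth_join_cong) (simp add: \<pi>hq)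
      finally have "deck.act \<gamma> (\<Psi> \<omega>) x = \<omega> (smooth_join (\<pi> \<circ> k) (\<pi> \<circ> q))"
        using x by (simp add: deck.act_def)
      moreover have "\<Psi> \<omega> x = \<omega> (\<pi> \<circ> q)" by (rule Psi_eq[OF \<omega> q])
      ultimately show ?thesis
        using q project_from[OF q(1,2)] by (intro bexI[of _ q]) (simp_all add: loop_difference_def)
    qed
    moreover have "pathstart (\<pi> \<circ> k) = \<pi> y0" "pathfinish (\<pi> \<circ> k) = \<pi> y0"
      using k h(3)[OF y0] by (simp_all add: pathstart_compose pathfinish_compose)
    ultimately show ?thesis using project_smooth[OF k(1)] by blast
  qed
  have outside: "\<Psi> \<omega> x = 0" "deck.act \<gamma> f x = 0" if "x \<notin> N" for \<omega> x \<gamma> f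
    using that by (simp_all add: Psi_def deck.act_def)
  {
    case 0
    have "deck.act \<gamma> (\<Psi> \<omega>) x - \<Psi> \<omega> x = 0" if \<gamma>: "\<gamma> \<in> carrier (fundamental_group M (\<pi> y0))" for \<gamma> x
    proof (cases "x \<in> N")
      case True
      obtain l where l: "l \<in> smooth_paths M A" "pathstart l = \<pi> y0" "pathfinish l = \<pi> y0"
        "\<forall>x\<in>N. \<exists>q\<in>smooth_paths N B. pathstart q = y0 \<and> pathfinish q = x \<and>
          deck.act \<gamma> (\<Psi> \<omega>) x - \<Psi> \<omega> x = loop_difference l \<omega> (\<pi> \<circ> q)"
        using step[OF \<gamma> 0] by metis
      obtain q where q: "q \<in> smooth_paths N B" "pathstart q = y0"
        "deck.act \<gamma> (\<Psi> \<omega>) x - \<Psi> \<omega> x = loop_difference l \<omega> (\<pi> \<circ> q)"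
        using l(4) True by metis
      \<comment> \<open>Length 0 leaves no form to lose, so the difference vanishes by the last
        conjunct of \<open>loop_difference_eq\<close>.\<close>
      have "\<forall>p\<in>smooth_paths_from M A (\<pi> y0). loop_difference l \<omega> p = 0"
        using loop_difference_eq[OF l(1-3) 0] by metis
      then show ?thesis using q project_from by simp
    qed (simp add: outside)
    then show ?case using outside by simp
  next
    case (Suc s)
    have "(\<lambda>x. deck.act \<gamma> (\<Psi> \<omega>) x - \<Psi> \<omega> x) \<in> deck.filtration (Suc s)"
      if \<gamma>: "\<gamma> \<in> carrier (fundamental_group M (\<pi> y0))" for \<gamma>
    proof -
      obtain l where l: "l \<in> smooth_paths M A" "pathstart l = \<pi> y0" "pathfinish l = \<pi> y0"
        "\<forall>x\<in>N. \<exists>q\<in>smooth_paths N B. pathstart q = y0 \<and> pathfinish q = x \<and>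
          deck.act \<gamma> (\<Psi> \<omega>) x - \<Psi> \<omega> x = loop_difference l \<omega> (\<pi> \<circ> q)"
        using step[OF \<gamma> Suc.prems] by metis
      have HI: "loop_difference l \<omega> \<in> HI s" by (rule loop_difference_HI[OF l(1-3) Suc.prems])
      have "(\<lambda>x. deck.act \<gamma> (\<Psi> \<omega>) x - \<Psi> \<omega> x) = \<Psi> (loop_difference l \<omega>)"
      proof
        fix x show "deck.act \<gamma> (\<Psi> \<omega>) x - \<Psi> \<omega> x = \<Psi> (loop_difference l \<omega>) x"
        proof (cases "x \<in> N")
          case True
          then obtain q where q: "q \<in> smooth_paths N B" "pathstart q = y0" "pathfinish q = x"
            "deck.act \<gamma> (\<Psi> \<omega>) x - \<Psi> \<omega> x = loop_difference l \<omega> (\<pi> \<circ> q)"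
            using l(4) by metis
          then show ?thesis using Psi_eq[OF HI q(1-3)] by simp
        qed (simp add: outside)
      qed
      then show ?thesis using Suc.IH[OF HI] by simp
    qed
    then show ?case using outside by (simp only: deck.filtration.simps(2)[of "Suc s"]) simp
  }
qed

lemma Psi_in_higher_invariants:
  assumes \<omega>: "\<omega> \<in> HI s"
  shows "\<Psi> \<omega> \<in> higher_invariants (fundamental_group M (\<pi> y0)) (C_infinity_module N B \<pi> M y0) (s + 1)"
proof -
  have smult: "a \<odot>\<^bsub>C_infinity_module N B \<pi> M y0\<^esub> f = deck.lin_act a f" for a f
    by (simp add: C_infinity_module_def deck.lin_act_def[abs_def] deck_action_def[abs_def] deck.act_def)
  have "deck.lin_act a (\<Psi> \<omega>) = (\<lambda>_. 0)"
    if "a \<in> ideal_power (group_ring (fundamental_group M (\<pi> y0))) (augmentation_ideal (fundamental_group M (\<pi> y0))) (s + 1)" for a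
  proof -
    \<comment> \<open>The \<open>s + 1\<close> factors use up the whole level \<open>Suc s\<close>;
      level 0 contains only the zero function.\<close>
    have "deck.lin_act a (\<Psi> \<omega>) \<in> deck.filtration 0"
      by (rule deck.ideal_power_lowers_filtration(2)[OF that]) (use Psi_in_filtration[OF \<omega>] in simp)
    then show ?thesis by simp
  qed
  moreover have "\<Psi> \<omega> \<in> carrier (C_infinity_module N B \<pi> M y0)"
    using Psi_smooth[OF \<omega>] by (simp add: C_infinity_module_def)
  moreover have "\<zero>\<^bsub>C_infinity_module N B \<pi> M y0\<^esub> = (\<lambda>_. 0)"
    by (simp add: C_infinity_module_def)
  ultimately show ?thesis by (simp only: higher_invariants_def mem_Collect_eq smult) blast
qed

end

lemma smooth_coverI:
  fixes M :: "'a::topological_space set"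
    and A :: "('a, 'e::{banach, heine_borel}) chart set"
    and N :: "'b::topological_space set"
  assumes "smooth_manifold M A" "universal_covering N B \<pi> M A" "y0 \<in> N"
  obtains E coord where "smooth_cover E coord N B M A \<pi> y0"
proof -
  have u: "smooth_manifold N B" "simply_connected N" "covering_space N \<pi> M"
    "\<And>y. y \<in> N \<Longrightarrow> \<exists>W g. y \<in> W \<and> openin (top_of_set N) W \<and> openin (top_of_set M) (\<pi> ` W) \<and>
        homeomorphism W (\<pi> ` W) \<pi> g \<and> smooth_map W B A \<pi> \<and> smooth_map (\<pi> ` W) A B g"
    using assms(2) unfolding universal_covering_def by blast+
  obtain X :: "'e set" where "finite X" "span X = UNIV" using assms(1) unfolding smooth_manifold_def by blast
  then obtain E coord where c: "coordinates E (coord :: 'e \<Rightarrow> 'e \<Rightarrow> real)" by (rule finite_span_coordinates)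
  have N: "smooth_mfd E coord N B" and M: "smooth_mfd E coord M A"
    using u(1) assms(1) by (auto simp: smooth_mfd_def smooth_mfd_axioms_def c smooth_manifold_def)
  have "simply_connected_cover N \<pi> M"
    by (rule simply_connected_cover.intro[OF u(3,2) smooth_mfd.locally_path_connected[OF N]])
  then have "smooth_cover E coord N B M A \<pi> y0"
    using N M u(4) assms(3) by (simp add: smooth_cover_def smooth_cover_axioms_def)
  then show ?thesis by (rule that)
qed

theorem theorem3p1:
  fixes M :: "'a::topological_space set"
    and A :: "('a, 'e::{banach, heine_borel}) chart set"
    and N :: "'b::topological_space set"
    and B :: "('b, 'e) chart set"
    and \<pi> :: "'b \<Rightarrow> 'a"
    and x0 :: 'a and y0 :: 'b and s :: nat
  assumes "smooth_manifold M A" and "connected M" and "x0 \<in> M"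
    and "universal_covering N B \<pi> M A" and "y0 \<in> N" and "\<pi> y0 = x0"
  shows
    "(\<forall>\<omega>\<in>homotopy_invariant_integrals M A x0 s. \<forall>q\<in>smooth_paths_from N B y0.
        Psi N B \<pi> y0 \<omega> (pathfinish q) = \<omega> (\<pi> \<circ> q)) \<and>
     Psi N B \<pi> y0 \<in>
       homotopy_invariant_integrals M A x0 s \<rightarrow>
       higher_invariants (fundamental_group M x0) (C_infinity_module N B \<pi> M y0) (s + 1) \<and>
     (\<forall>\<omega>\<in>homotopy_invariant_integrals M A x0 s. \<forall>\<eta>\<in>homotopy_invariant_integrals M A x0 s. \<forall>a b.
        Psi N B \<pi> y0 (\<lambda>p. a * \<omega> p + b * \<eta> p) =
        (\<lambda>x. a * Psi N B \<pi> y0 \<omega> x + b * Psi N B \<pi> y0 \<eta> x)) \<and>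
     inj_on (Psi N B \<pi> y0) (homotopy_invariant_integrals M A x0 s)"
proof -
  obtain E coord where "smooth_cover E coord N B M A \<pi> y0"
    using smooth_coverI[OF assms(1,4,5)] by blast
  then interpret smooth_cover E coord N B M A \<pi> y0 .
  show ?thesis
    unfolding assms(6)[symmetric]
  proof (intro conjI ballI allI funcsetI)
    show "\<Psi> \<omega> (pathfinish q) = \<omega> (\<pi> \<circ> q)" if "\<omega> \<in> HI s" "q \<in> smooth_paths_from N B y0" for \<omega> q
      using that(2) by (intro Psi_eq[OF that(1)]) (simp_all add: smooth_paths_from_def)
    show "\<Psi> \<omega> \<in> higher_invariants (fundamental_group M (\<pi> y0)) (C_infinity_module N B \<pi> M y0) (s + 1)"
      if "\<omega> \<in> HI s" for \<omega>
      by (rule Psi_in_higher_invariants[OF that])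
    \<comment> \<open>The path chosen in \<open>Psi\<close> depends on the end point but not on the
      functional, so linearity is pointwise.\<close>
    show "\<Psi> (\<lambda>p. a * \<omega> p + b * \<eta> p) = (\<lambda>x. a * \<Psi> \<omega> x + b * \<Psi> \<eta> x)" for \<omega> \<eta> a b
      by (auto simp: Psi_def)
    show "inj_on \<Psi> (HI s)" by (rule Psi_inj)
  qed
qed

end
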